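(* Let $G$ be a countable discrete group and $c$ a 2-cocycle on $G$. Suppose $S$ is maximal among abelian subgroups of $G$ on which $c$ is symmetric, and that $S$ is normal and immediately centralizing. Put $A=C^*_r(G,c)$ and $B=C^*_r(S,c)$, so that $(A,B)$ is a Cartan pair. Suppose moreover that $c$ is trivial on $S$ (i.e. $c(s,t)=1$ for all $s,t\in S$). Let $\Psi:\widehat S\to\widehat B$ be the homeomorphism determined by $\Psi(\nu)(b)=\sum_{s\in S}b(s)\nu(s)$ for $b\in C_c(S)$. Then the action $[g]\mapsto\tilde\alpha_{[g]}:=\Psi^{-1}\circ\alpha_g\circ\Psi$ of $G/S$ on $\widehat S$ induced by $\Psi$ is given by $$\tilde\alpha_{[g]}(\nu)=\Bigl[s\mapsto\overline{c(g,g^{-1})}\,c(g^{-1},s)\,c(g^{-1}s,g)\,\nu(g^{-1}sg)\Bigr]$$ for $[g]\in G/S$, $\nu\in\widehat S$, $s\in S$. Moreover the transformation groupoid $\mathcal{H}:=(G/S)\,{}_{\tilde\alpha}\!\ltimes\widehat S$ is isomorphic to the Weyl groupoid $\mathcal{G}_{(A,B)}$ (as topological groupoids) via $$\mathcal{G}_{(A,B)}\to\mathcal{H},\qquad[\alpha_g(x),\delta_g,x]\mapsto([g],\Psi^{-1}(x)).$$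
   Context: 2-cocycles. A 2-cocycle on a group $G$ is $c:G\times G\to\mathbb{T}$ with $c(g,e)=c(e,g)=1$ and $c(g,hk)c(h,k)=c(gh,k)c(g,h)$; it is symmetric on $S$ if $c(s,t)=c(t,s)$ for all $s,t\in S$. $C^*_r(G,c)$ is the completion of $C_c(G)$, with $\delta_g\delta_h=c(g,h)\delta_{gh}$ and $\delta_g^*=\overline{c(g,g^{-1})}\delta_{g^{-1}}$, in the operator norm of its left regular representation on $\ell^2(G)$, $\delta_g\,e_h=c(g,h)e_{gh}$. $C^*_r(S,c)$ is viewed as the closure of $C_c(S)$ in $C^*_r(G,c)$. Immediately centralizing. $\nu\in G$ is $k$-centralizing for $S$ if for every $t\in S$ there is $j\in\{1,\dots,k\}$ with $\nu t^j=t^j\nu$; $S$ is immediately centralizing if for every $k\ge1$ each $k$-centralizing element is $1$-centralizing. Cartan pairs. A $C^*$-subalgebra $B\subseteq A$ is Cartan if it is maximal abelian, there is a faithful conditional expectation $A\to B$, the normalizer $N(B)=\{n\in A:nbn^*,n^*bn\in B\ \forall b\in B\}$ generates $A$, and $B$ contains an approximate identity for $A$. (Under the hypotheses above, $(C^*_r(G,c),C^*_r(S,c))$ is a Cartan pair.) Weyl groupoid. Let $(A,B)$ be a separable Cartan pair; identify $B\cong C_0(\widehat B)$ by Gelfand duality. For $n\in N(B)$ let $\mathrm{dom}(n)=\{x\in\widehat B:n^*n(x)>0\}$. There is a unique homeomorphism $\alpha_n:\mathrm{dom}(n)\to\mathrm{dom}(n^* )$ with $n^*bn=(b\circ\alpha_n)\cdot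 n^*n$ for all $b\in B$. The Weyl groupoid $\mathcal{G}_{(A,B)}$ is the set of classes $[\alpha_n(x),n,x]$ of triples with $n\in N(B)$, $x\in\mathrm{dom}(n)$, where $(\alpha_n(x),n,x)\sim(\alpha_m(y),m,y)$ iff $x=y$ and $\alpha_n=\alpha_m$ on a neighborhood of $x$; multiplication is $[\alpha_n(\alpha_m(x)),n,\alpha_m(x)]\cdot[\alpha_m(x),m,x]=[\alpha_{nm}(x),nm,x]$; basic open sets are $\{[\alpha_n(x),n,x]:\alpha_n(x)\in V,\ x\in U\}$ with $U,V\subseteq\widehat B$ open and $n\in N(B)$. In the group case, each $\delta_g$ ($g\in G$) lies in $N(B)$ and is unitary, so $\alpha_g:=\alpha_{\delta_g}$ is a homeomorphism of $\widehat B$; it depends only on the coset $[g]\in G/S$, and $[g]\mapsto\alpha_{[g]}:=\alpha_g$ is an action of $G/S$ on $\widehat B$. Every element of $\mathcal{G}_{(A,B)}$ has the form $[\alpha_g(x),\delta_g,x]$. $\widehat S$ is the Pontryagin dual of $S$ (with $S$ discrete), i.e. the compact group of homomorphisms $S\to\mathbb{T}$. For an action $\beta$ of a discrete group $Q$ on a space $X$, the transformation groupoid $Q\,{}_\beta\!\ltimes X$ is $Q\times X$ with the product topology, $s(q,x)=x$, $r(q,x)=\beta_q(x)$ (units identified with points of $X$), and $(q,\beta_{q'}(x))(q',x)=(qq',x)$. *)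

theory Defs
  imports "HOL-Analysis.Analysis" "HOL-Algebra.Coset" "HOL-Algebra.Module" "HOL-Algebra.Group_Action"
begin

section \<open>Cartan pairs\<close>

record 'a star_algebra = "(complex, 'a) module" +
  star :: "'a \<Rightarrow> 'a"
  alg_norm :: "'a \<Rightarrow> real"

text \<open>In the following definitions \<open>M\<close> is meant to be a $C^*$-algebra and \<open>B\<close> the underlying
  set of a subalgebra.\<close>

definition norm_closure :: "('a, 'm) star_algebra_scheme \<Rightarrow> 'a set \<Rightarrow> 'a set" where
  "norm_closure M X =
    {a \<in> carrier M. \<forall>e>0. \<exists>x\<in>X. alg_norm M (a \<oplus>\<^bsub>M\<^esub> (- 1) \<odot>\<^bsub>M\<^esub> x) < e}"

definition cstar_subalgebra :: "('a, 'm) star_algebra_scheme \<Rightarrow> 'a set \<Rightarrow> bool" where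
  "cstar_subalgebra M B \<longleftrightarrow>
    B \<subseteq> carrier M \<and> \<zero>\<^bsub>M\<^esub> \<in> B \<and>
    (\<forall>a\<in>B. \<forall>b\<in>B. a \<oplus>\<^bsub>M\<^esub> b \<in> B \<and> a \<otimes>\<^bsub>M\<^esub> b \<in> B) \<and>
    (\<forall>z. \<forall>a\<in>B. z \<odot>\<^bsub>M\<^esub> a \<in> B) \<and>
    (\<forall>a\<in>B. star M a \<in> B) \<and>
    norm_closure M B \<subseteq> B"

definition commuting :: "('a, 'm) star_algebra_scheme \<Rightarrow> 'a set \<Rightarrow> bool" where
  "commuting M B \<longleftrightarrow> (\<forall>a\<in>B. \<forall>b\<in>B. a \<otimes>\<^bsub>M\<^esub> b = b \<otimes>\<^bsub>M\<^esub> a)"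

definition maximal_abelian :: "('a, 'm) star_algebra_scheme \<Rightarrow> 'a set \<Rightarrow> bool" where
  "maximal_abelian M B \<longleftrightarrow>
    cstar_subalgebra M B \<and> commuting M B \<and>
    (\<forall>C. cstar_subalgebra M C \<and> commuting M C \<and> B \<subseteq> C \<longrightarrow> C = B)"

definition conditional_expectation ::
    "('a, 'm) star_algebra_scheme \<Rightarrow> 'a set \<Rightarrow> ('a \<Rightarrow> 'a) \<Rightarrow> bool" where
  "conditional_expectation M B E \<longleftrightarrow>
    (\<forall>a\<in>carrier M. E a \<in> B) \<and>
    (\<forall>a\<in>carrier M. \<forall>a'\<in>carrier M. E (a \<oplus>\<^bsub>M\<^esub> a') = E a \<oplus>\<^bsub>M\<^esub> E a') \<and>
    (\<forall>z. \<forall>a\<in>carrier M. E (z \<odot>\<^bsub>M\<^esub> a) = z \<odot>\<^bsub>M\<^esub> E a) \<and>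
    (\<forall>b\<in>B. E b = b) \<and>
    (\<forall>a\<in>carrier M. \<forall>b\<in>B. E (b \<otimes>\<^bsub>M\<^esub> a) = b \<otimes>\<^bsub>M\<^esub> E a \<and> E (a \<otimes>\<^bsub>M\<^esub> b) = E a \<otimes>\<^bsub>M\<^esub> b) \<and>
    (\<forall>a\<in>carrier M. alg_norm M (E a) \<le> alg_norm M a) \<and>
    (\<forall>a\<in>carrier M. \<exists>d\<in>B. E (star M a \<otimes>\<^bsub>M\<^esub> a) = star M d \<otimes>\<^bsub>M\<^esub> d)"

definition faithful_map :: "('a, 'm) star_algebra_scheme \<Rightarrow> ('a \<Rightarrow> 'a) \<Rightarrow> bool" where
  "faithful_map M E \<longleftrightarrow>
    (\<forall>a\<in>carrier M. E (star M a \<otimes>\<^bsub>M\<^esub> a) = \<zero>\<^bsub>M\<^esub> \<longrightarrow> a = \<zero>\<^bsub>M\<^esub>)"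

definition normalizers :: "('a, 'm) star_algebra_scheme \<Rightarrow> 'a set \<Rightarrow> 'a set" where
  "normalizers M B =
    {n \<in> carrier M. \<forall>b\<in>B. n \<otimes>\<^bsub>M\<^esub> b \<otimes>\<^bsub>M\<^esub> star M n \<in> B \<and> star M n \<otimes>\<^bsub>M\<^esub> b \<otimes>\<^bsub>M\<^esub> n \<in> B}"

definition generates :: "('a, 'm) star_algebra_scheme \<Rightarrow> 'a set \<Rightarrow> bool" where
  "generates M X \<longleftrightarrow> (\<forall>C. cstar_subalgebra M C \<and> X \<subseteq> C \<longrightarrow> C = carrier M)"

text \<open>A (contractive) approximate identity, as a net presented by its filter of tails.\<close>

definition contains_approximate_identity :: "('a, 'm) star_algebra_scheme \<Rightarrow> 'a set \<Rightarrow> bool" where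
  "contains_approximate_identity M B \<longleftrightarrow>
    (\<exists>F. F \<noteq> bot \<and> (\<forall>\<^sub>F u in F. u \<in> B \<and> alg_norm M u \<le> 1) \<and>
      (\<forall>a\<in>carrier M.
        ((\<lambda>u. alg_norm M (u \<otimes>\<^bsub>M\<^esub> a \<oplus>\<^bsub>M\<^esub> (- 1) \<odot>\<^bsub>M\<^esub> a)) \<longlongrightarrow> 0) F \<and>
        ((\<lambda>u. alg_norm M (a \<otimes>\<^bsub>M\<^esub> u \<oplus>\<^bsub>M\<^esub> (- 1) \<odot>\<^bsub>M\<^esub> a)) \<longlongrightarrow> 0) F))"

definition cartan_pair :: "('a, 'm) star_algebra_scheme \<Rightarrow> 'a set \<Rightarrow> bool" where
  "cartan_pair M B \<longleftrightarrow>
    cstar_subalgebra M B \<and> maximal_abelian M B \<and>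
    (\<exists>E. conditional_expectation M B E \<and> faithful_map M E) \<and>
    generates M (normalizers M B) \<and>
    contains_approximate_identity M B"

section \<open>Topological groupoids\<close>

text \<open>The arrows are the points of \<open>arrows\<close>; units are identified with points of some type, in
  which \<open>src\<close> and \<open>rng\<close> take their values. The product \<open>gmult\<close> of \<open>a\<close> and \<open>b\<close> is only meaningful
  if \<open>src a = rng b\<close>.\<close>

record ('a, 'x) top_groupoid =
  arrows :: "'a topology"
  src :: "'a \<Rightarrow> 'x"
  rng :: "'a \<Rightarrow> 'x"
  gmult :: "'a \<Rightarrow> 'a \<Rightarrow> 'a"

definition top_groupoid_iso ::
    "('a, 'x) top_groupoid \<Rightarrow> ('b, 'y) top_groupoid \<Rightarrow> ('a \<Rightarrow> 'b) \<Rightarrow> bool" where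
  "top_groupoid_iso \<G> \<H> \<phi> \<longleftrightarrow>
    homeomorphic_map (arrows \<G>) (arrows \<H>) \<phi> \<and>
    (\<forall>a\<in>topspace (arrows \<G>). \<forall>b\<in>topspace (arrows \<G>).
      (src \<G> a = rng \<G> b \<longleftrightarrow> src \<H> (\<phi> a) = rng \<H> (\<phi> b)) \<and>
      (src \<G> a = rng \<G> b \<longrightarrow> \<phi> (gmult \<G> a b) = gmult \<H> (\<phi> a) (\<phi> b)))"

definition transformation_groupoid ::
    "('q, 'm) monoid_scheme \<Rightarrow> 'x topology \<Rightarrow> ('q \<Rightarrow> 'x \<Rightarrow> 'x) \<Rightarrow> ('q \<times> 'x, 'x) top_groupoid" where
  "transformation_groupoid Q X \<beta> =
    \<lparr>arrows = prod_topology (discrete_topology (carrier Q)) X,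
     src = (\<lambda>(q, x). x),
     rng = (\<lambda>(q, x). \<beta> q x),
     gmult = (\<lambda>(q, y) (q', x). (q \<otimes>\<^bsub>Q\<^esub> q', x))\<rparr>"

section \<open>The Weyl groupoid\<close>

text \<open>The Gelfand spectrum: nonzero multiplicative linear functionals on \<open>B\<close>, with the topology of
  pointwise convergence. Under Gelfand duality \<open>b \<in> B\<close> is the function \<open>x \<mapsto> x b\<close>.\<close>

definition spectrum :: "('a, 'm) star_algebra_scheme \<Rightarrow> 'a set \<Rightarrow> ('a \<Rightarrow> complex) set" where
  "spectrum M B = {x \<in> extensional B.
    (\<forall>a\<in>B. \<forall>b\<in>B. x (a \<oplus>\<^bsub>M\<^esub> b) = x a + x b \<and> x (a \<otimes>\<^bsub>M\<^esub> b) = x a * x b) \<and>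
    (\<forall>z. \<forall>a\<in>B. x (z \<odot>\<^bsub>M\<^esub> a) = z * x a) \<and>
    (\<exists>b\<in>B. x b \<noteq> 0)}"

definition spectrum_topology ::
    "('a, 'm) star_algebra_scheme \<Rightarrow> 'a set \<Rightarrow> ('a \<Rightarrow> complex) topology" where
  "spectrum_topology M B = subtopology (product_topology (\<lambda>_. euclidean) B) (spectrum M B)"

definition weyl_dom ::
    "('a, 'm) star_algebra_scheme \<Rightarrow> 'a set \<Rightarrow> 'a \<Rightarrow> ('a \<Rightarrow> complex) set" where
  "weyl_dom M B n =
    {x \<in> spectrum M B. x (star M n \<otimes>\<^bsub>M\<^esub> n) \<in> \<real> \<and> 0 < Re (x (star M n \<otimes>\<^bsub>M\<^esub> n))}"

text \<open>The map $\alpha_n$. The function $(b\circ\alpha_n)\cdot n^*n$ is read as \<open>0\<close> off the domain of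
  $\alpha_n$, where $n^*n$ vanishes.\<close>

definition weyl_map ::
    "('a, 'm) star_algebra_scheme \<Rightarrow> 'a set \<Rightarrow> 'a \<Rightarrow> ('a \<Rightarrow> complex) \<Rightarrow> ('a \<Rightarrow> complex)" where
  "weyl_map M B n = (THE f. f \<in> extensional (weyl_dom M B n) \<and>
    homeomorphic_map (subtopology (spectrum_topology M B) (weyl_dom M B n))
      (subtopology (spectrum_topology M B) (weyl_dom M B (star M n))) f \<and>
    (\<forall>b\<in>B. \<forall>x\<in>spectrum M B. x (star M n \<otimes>\<^bsub>M\<^esub> b \<otimes>\<^bsub>M\<^esub> n) =
      (if x \<in> weyl_dom M B n then f x b * x (star M n \<otimes>\<^bsub>M\<^esub> n) else 0)))"

type_synonym 'a weyl_triple = "('a \<Rightarrow> complex) \<times> 'a \<times> ('a \<Rightarrow> complex)"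

definition weyl_triples ::
    "('a, 'm) star_algebra_scheme \<Rightarrow> 'a set \<Rightarrow> 'a weyl_triple set" where
  "weyl_triples M B = {(weyl_map M B n x, n, x) | n x. n \<in> normalizers M B \<and> x \<in> weyl_dom M B n}"

definition weyl_equiv ::
    "('a, 'm) star_algebra_scheme \<Rightarrow> 'a set \<Rightarrow> 'a weyl_triple rel" where
  "weyl_equiv M B = {((y, n, x), (y', m, x')).
    (y, n, x) \<in> weyl_triples M B \<and> (y', m, x') \<in> weyl_triples M B \<and> x = x' \<and>
    (\<exists>U. openin (spectrum_topology M B) U \<and> x \<in> U \<and> U \<subseteq> weyl_dom M B n \<inter> weyl_dom M B m \<and>
      (\<forall>z\<in>U. weyl_map M B n z = weyl_map M B m z))}"

definition weyl_germ ::
    "('a, 'm) star_algebra_scheme \<Rightarrow> 'a set \<Rightarrow> 'a \<Rightarrow> ('a \<Rightarrow> complex) \<Rightarrow> 'a weyl_triple set" where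
  "weyl_germ M B n x = weyl_equiv M B `` {(weyl_map M B n x, n, x)}"

definition weyl_topology ::
    "('a, 'm) star_algebra_scheme \<Rightarrow> 'a set \<Rightarrow> 'a weyl_triple set topology" where
  "weyl_topology M B = topology_generated_by
    {{weyl_germ M B n x | x. x \<in> weyl_dom M B n \<and> weyl_map M B n x \<in> V \<and> x \<in> U} | n U V.
      n \<in> normalizers M B \<and> openin (spectrum_topology M B) U \<and> openin (spectrum_topology M B) V}"

definition weyl_mult ::
    "('a, 'm) star_algebra_scheme \<Rightarrow> 'a set \<Rightarrow>
      'a weyl_triple set \<Rightarrow> 'a weyl_triple set \<Rightarrow> 'a weyl_triple set" where
  "weyl_mult M B a b = (THE k. \<exists>n\<in>normalizers M B. \<exists>m\<in>normalizers M B. \<exists>x\<in>weyl_dom M B m.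
    weyl_map M B m x \<in> weyl_dom M B n \<and>
    a = weyl_germ M B n (weyl_map M B m x) \<and> b = weyl_germ M B m x \<and>
    k = weyl_germ M B (n \<otimes>\<^bsub>M\<^esub> m) x)"

definition weyl_groupoid ::
    "('a, 'm) star_algebra_scheme \<Rightarrow> 'a set \<Rightarrow>
      ('a weyl_triple set, 'a \<Rightarrow> complex) top_groupoid" where
  "weyl_groupoid M B =
    \<lparr>arrows = weyl_topology M B,
     src = (\<lambda>a. THE x. \<exists>y n. (y, n, x) \<in> a),
     rng = (\<lambda>a. THE y. \<exists>n x. (y, n, x) \<in> a),
     gmult = weyl_mult M B\<rparr>"

section \<open>Bounded operators on $\ell^2(X)$\<close>

text \<open>Elements of $\ell^2(X)$ are extended by \<open>0\<close> off \<open>X\<close>.\<close>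

definition l2_space :: "'g set \<Rightarrow> ('g \<Rightarrow> complex) set" where
  "l2_space X = {\<xi>. (\<forall>k. k \<notin> X \<longrightarrow> \<xi> k = 0) \<and> (\<lambda>k. (cmod (\<xi> k))\<^sup>2) summable_on X}"

definition l2_norm :: "'g set \<Rightarrow> ('g \<Rightarrow> complex) \<Rightarrow> real" where
  "l2_norm X \<xi> = sqrt (\<Sum>\<^sub>\<infinity>k\<in>X. (cmod (\<xi> k))\<^sup>2)"

definition l2_inner :: "'g set \<Rightarrow> ('g \<Rightarrow> complex) \<Rightarrow> ('g \<Rightarrow> complex) \<Rightarrow> complex" where
  "l2_inner X \<xi> \<eta> = (\<Sum>\<^sub>\<infinity>k\<in>X. \<xi> k * cnj (\<eta> k))"

type_synonym 'g l2_op = "('g \<Rightarrow> complex) \<Rightarrow> ('g \<Rightarrow> complex)"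

definition bounded_ops :: "'g set \<Rightarrow> 'g l2_op set" where
  "bounded_ops X = {T \<in> extensional (l2_space X).
    (\<forall>\<xi>\<in>l2_space X. T \<xi> \<in> l2_space X) \<and>
    (\<forall>\<xi>\<in>l2_space X. \<forall>\<eta>\<in>l2_space X. T (\<lambda>k. \<xi> k + \<eta> k) = (\<lambda>k. T \<xi> k + T \<eta> k)) \<and>
    (\<forall>z. \<forall>\<xi>\<in>l2_space X. T (\<lambda>k. z * \<xi> k) = (\<lambda>k. z * T \<xi> k)) \<and>
    (\<exists>K. \<forall>\<xi>\<in>l2_space X. l2_norm X (T \<xi>) \<le> K * l2_norm X \<xi>)}"

definition l2_operators :: "'g set \<Rightarrow> 'g l2_op star_algebra" where
  "l2_operators X =
    \<lparr>carrier = bounded_ops X,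
     monoid.mult = (\<lambda>T U. compose (l2_space X) T U),
     one = (\<lambda>\<xi>\<in>l2_space X. \<xi>),
     zero = (\<lambda>\<xi>\<in>l2_space X. \<lambda>k. 0),
     add = (\<lambda>T U. \<lambda>\<xi>\<in>l2_space X. \<lambda>k. T \<xi> k + U \<xi> k),
     smult = (\<lambda>z T. \<lambda>\<xi>\<in>l2_space X. \<lambda>k. z * T \<xi> k),
     star = (\<lambda>T. THE U. U \<in> bounded_ops X \<and>
       (\<forall>\<xi>\<in>l2_space X. \<forall>\<eta>\<in>l2_space X. l2_inner X (T \<xi>) \<eta> = l2_inner X \<xi> (U \<eta>))),
     alg_norm = (\<lambda>T. Inf {K. 0 \<le> K \<and> (\<forall>\<xi>\<in>l2_space X. l2_norm X (T \<xi>) \<le> K * l2_norm X \<xi>)})\<rparr>"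

section \<open>Twisted group algebras\<close>

definition two_cocycle :: "('g, 'm) monoid_scheme \<Rightarrow> ('g \<Rightarrow> 'g \<Rightarrow> complex) \<Rightarrow> bool" where
  "two_cocycle G c \<longleftrightarrow>
    (\<forall>g\<in>carrier G. \<forall>h\<in>carrier G. cmod (c g h) = 1) \<and>
    (\<forall>g\<in>carrier G. c g \<one>\<^bsub>G\<^esub> = 1 \<and> c \<one>\<^bsub>G\<^esub> g = 1) \<and>
    (\<forall>g\<in>carrier G. \<forall>h\<in>carrier G. \<forall>k\<in>carrier G.
      c g (h \<otimes>\<^bsub>G\<^esub> k) * c h k = c (g \<otimes>\<^bsub>G\<^esub> h) k * c g h)"

definition abelian_symmetric ::
    "('g, 'm) monoid_scheme \<Rightarrow> ('g \<Rightarrow> 'g \<Rightarrow> complex) \<Rightarrow> 'g set \<Rightarrow> bool" where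
  "abelian_symmetric G c S \<longleftrightarrow>
    subgroup S G \<and> (\<forall>s\<in>S. \<forall>t\<in>S. s \<otimes>\<^bsub>G\<^esub> t = t \<otimes>\<^bsub>G\<^esub> s) \<and> (\<forall>s\<in>S. \<forall>t\<in>S. c s t = c t s)"

definition maximal_abelian_symmetric ::
    "('g, 'm) monoid_scheme \<Rightarrow> ('g \<Rightarrow> 'g \<Rightarrow> complex) \<Rightarrow> 'g set \<Rightarrow> bool" where
  "maximal_abelian_symmetric G c S \<longleftrightarrow>
    abelian_symmetric G c S \<and> (\<forall>H. abelian_symmetric G c H \<and> S \<subseteq> H \<longrightarrow> H = S)"

definition k_centralizing :: "('g, 'm) monoid_scheme \<Rightarrow> 'g set \<Rightarrow> nat \<Rightarrow> 'g \<Rightarrow> bool" where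
  "k_centralizing G S k \<nu> \<longleftrightarrow> \<nu> \<in> carrier G \<and>
    (\<forall>t\<in>S. \<exists>j\<in>{1..k}. \<nu> \<otimes>\<^bsub>G\<^esub> (t [^]\<^bsub>G\<^esub> j) = (t [^]\<^bsub>G\<^esub> j) \<otimes>\<^bsub>G\<^esub> \<nu>)"

definition immediately_centralizing :: "('g, 'm) monoid_scheme \<Rightarrow> 'g set \<Rightarrow> bool" where
  "immediately_centralizing G S \<longleftrightarrow>
    (\<forall>k\<ge>1. \<forall>\<nu>. k_centralizing G S k \<nu> \<longrightarrow> k_centralizing G S 1 \<nu>)"

text \<open>$C_c(X)$ for a discrete set \<open>X\<close>, extended by \<open>0\<close>.\<close>

definition finsupp :: "'g set \<Rightarrow> ('g \<Rightarrow> complex) set" where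
  "finsupp X = {f. finite {g. f g \<noteq> 0} \<and> {g. f g \<noteq> 0} \<subseteq> X}"

definition point_mass :: "'g \<Rightarrow> 'g \<Rightarrow> complex" where
  "point_mass g = (\<lambda>h. if h = g then 1 else 0)"

text \<open>The left regular representation of \<open>f = \<Sum>\<^sub>g f(g) \<delta>\<^sub>g\<close>: evaluating
  $\delta_g\, e_h = c(g,h)\, e_{gh}$ at \<open>k = gh\<close> gives
  $(\delta_g\, \xi)(k) = c(g, g^{-1}k)\, \xi(g^{-1}k)$.\<close>

definition left_regular ::
    "('g, 'm) monoid_scheme \<Rightarrow> ('g \<Rightarrow> 'g \<Rightarrow> complex) \<Rightarrow> ('g \<Rightarrow> complex) \<Rightarrow> 'g l2_op" where
  "left_regular G c f = (\<lambda>\<xi>\<in>l2_space (carrier G). \<lambda>k. if k \<in> carrier G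
    then \<Sum>g | f g \<noteq> 0. f g * c g (inv\<^bsub>G\<^esub> g \<otimes>\<^bsub>G\<^esub> k) * \<xi> (inv\<^bsub>G\<^esub> g \<otimes>\<^bsub>G\<^esub> k) else 0)"

definition delta_op :: "('g, 'm) monoid_scheme \<Rightarrow> ('g \<Rightarrow> 'g \<Rightarrow> complex) \<Rightarrow> 'g \<Rightarrow> 'g l2_op" where
  "delta_op G c g = left_regular G c (point_mass g)"

lemma delta_op_point_mass:
  fixes G (structure)
  assumes "group G" "g \<in> carrier G" "h \<in> carrier G"
  shows "delta_op G c g (point_mass h) = (\<lambda>k. c g h * point_mass (g \<otimes>\<^bsub>G\<^esub> h) k)"
proof -
  interpret group G by fact
  have supp: "{k. point_mass g k \<noteq> 0} = {g}"
    by (auto simp: point_mass_def)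
  have "(\<lambda>k. (cmod (point_mass h k))\<^sup>2) summable_on carrier G"
    by (rule finite_nonzero_values_imp_summable_on)
      (auto simp: point_mass_def intro: finite_subset[of _ "{h}"])
  then have l2: "point_mass h \<in> l2_space (carrier G)"
    using assms by (auto simp: l2_space_def point_mass_def)
  have eq: "inv g \<otimes> k = h \<longleftrightarrow> k = g \<otimes> h" if "k \<in> carrier G" for k
    using assms that by (metis inv_solve_left' inv_closed inv_inv l_inv m_assoc l_one m_closed)
  have closed: "g \<otimes> h \<in> carrier G"
    using assms by simp
  have "delta_op G c g (point_mass h) k = c g h * point_mass (g \<otimes> h) k" for k
  proof (cases "k \<in> carrier G")
    case True
    have "delta_op G c g (point_mass h) k = c g (inv g \<otimes> k) * point_mass h (inv g \<otimes> k)"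
      using l2 True unfolding delta_op_def left_regular_def supp by (simp add: point_mass_def)
    then show ?thesis
      using eq[OF True] by (cases "inv g \<otimes> k = h") (auto simp: point_mass_def)
  next
    case False
    then show ?thesis
      using l2 closed unfolding delta_op_def left_regular_def by (auto simp: point_mass_def)
  qed
  then show ?thesis by (rule ext)
qed

text \<open>For a subgroup \<open>S\<close>, the closure of $C_c(S)$ in the bounded operators on $\ell^2(G)$.
  The completion of $C_c(G)$ is realised as its closure, with the operations of operators.\<close>

definition reduced_set ::
    "('g, 'm) monoid_scheme \<Rightarrow> ('g \<Rightarrow> 'g \<Rightarrow> complex) \<Rightarrow> 'g set \<Rightarrow> 'g l2_op set" where
  "reduced_set G c S = norm_closure (l2_operators (carrier G)) (left_regular G c ` finsupp S)"

definition reduced_algebra ::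
    "('g, 'm) monoid_scheme \<Rightarrow> ('g \<Rightarrow> 'g \<Rightarrow> complex) \<Rightarrow> 'g l2_op star_algebra" where
  "reduced_algebra G c = (l2_operators (carrier G))\<lparr>carrier := reduced_set G c (carrier G)\<rparr>"

section \<open>The dual group and the induced action\<close>

definition dual_group :: "('g, 'm) monoid_scheme \<Rightarrow> 'g set \<Rightarrow> ('g \<Rightarrow> complex) set" where
  "dual_group G S = {\<nu> \<in> extensional S. (\<forall>s\<in>S. cmod (\<nu> s) = 1) \<and>
    (\<forall>s\<in>S. \<forall>t\<in>S. \<nu> (s \<otimes>\<^bsub>G\<^esub> t) = \<nu> s * \<nu> t)}"

text \<open>As \<open>S\<close> is discrete, the compact-open topology is that of pointwise convergence.\<close>

definition dual_topology :: "('g, 'm) monoid_scheme \<Rightarrow> 'g set \<Rightarrow> ('g \<Rightarrow> complex) topology" where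
  "dual_topology G S = subtopology (product_topology (\<lambda>_. euclidean) S) (dual_group G S)"

definition Psi :: "('g, 'm) monoid_scheme \<Rightarrow> ('g \<Rightarrow> 'g \<Rightarrow> complex) \<Rightarrow> 'g set \<Rightarrow>
    ('g \<Rightarrow> complex) \<Rightarrow> ('g l2_op \<Rightarrow> complex)" where
  "Psi G c S \<nu> = (THE x. x \<in> spectrum (reduced_algebra G c) (reduced_set G c S) \<and>
    (\<forall>b\<in>finsupp S. x (left_regular G c b) = (\<Sum>s | b s \<noteq> 0. b s * \<nu> s)))"

definition Psi_inv :: "('g, 'm) monoid_scheme \<Rightarrow> ('g \<Rightarrow> 'g \<Rightarrow> complex) \<Rightarrow> 'g set \<Rightarrow>
    ('g l2_op \<Rightarrow> complex) \<Rightarrow> ('g \<Rightarrow> complex)" where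
  "Psi_inv G c S = inv_into (dual_group G S) (Psi G c S)"

definition alpha_map :: "('g, 'm) monoid_scheme \<Rightarrow> ('g \<Rightarrow> 'g \<Rightarrow> complex) \<Rightarrow> 'g set \<Rightarrow> 'g \<Rightarrow>
    ('g l2_op \<Rightarrow> complex) \<Rightarrow> ('g l2_op \<Rightarrow> complex)" where
  "alpha_map G c S g = weyl_map (reduced_algebra G c) (reduced_set G c S) (delta_op G c g)"

text \<open>The map induced on $\widehat{S}$ by the common value of \<open>alpha_map G c S\<close> on a coset \<open>q\<close>.\<close>

definition induced_action :: "('g, 'm) monoid_scheme \<Rightarrow> ('g \<Rightarrow> 'g \<Rightarrow> complex) \<Rightarrow> 'g set \<Rightarrow>
    'g set \<Rightarrow> ('g \<Rightarrow> complex) \<Rightarrow> ('g \<Rightarrow> complex)" where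
  "induced_action G c S q =
    (\<lambda>\<nu>\<in>dual_group G S. Psi_inv G c S ((THE f. \<forall>g\<in>q. alpha_map G c S g = f) (Psi G c S \<nu>)))"

end

theory Submission
  imports Defs "HOL-Algebra.Generated_Groups" "HOL-Algebra.Multiplicative_Group"
begin

text \<open>The elements of the reduced algebra are operators \<open>a\<close> determined by the family \<open>a e\<^sub>1\<close>, which lies
  in $\ell^2(G)$. If \<open>a\<close> commutes with the algebra of \<open>S\<close>, the modulus of this family is invariant under
  conjugation by \<open>S\<close>, so its support consists of elements with finitely many \<open>S\<close>-conjugates; these are
  \<open>k\<close>-centralizing, hence lie in \<open>S\<close>. The conditional expectation is the compression to the blocks
  $\ell^2(Sk)$.

  A character \<open>\<nu>\<close> of \<open>S\<close> extends to the completion because the supports of the convolution powers of a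
  finitely supported function grow polynomially. For a normalizer \<open>n\<close> the functional
  $b \mapsto x(n^* b n) / x(n^* n)$ is again a character, and it equals $\alpha_g(x)$ wherever
  $x(E(\delta_g^* n)) \neq 0$; as \<open>n\<close> is a limit of combinations of the $\delta_g$, every \<open>x\<close> in the domain
  of \<open>n\<close> has such a \<open>g\<close>, so every germ is one of a $\delta_g$. Finally, if $\alpha_g$ fixes an open set of
  characters, then all commutators of \<open>g\<close> with elements of \<open>S\<close> have a common exponent, whence
  \<open>g\<close> centralizes \<open>S\<close> compatibly with \<open>c\<close> and belongs to \<open>S\<close>; this makes the coset a function of
  the germ.\<close>

section \<open>The Hilbert space of square-summable families\<close>

text \<open>The definitions speak of extensional functions on \<open>l2_space (carrier G)\<close>.
  The analysis is done instead on families indexed by the whole type, where type classes supply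
  limits and completeness; elements of \<open>corner (carrier G)\<close> correspond to the concrete
  operators through \<open>conc\<close>, and the unit \<open>delta \<one>\<close> is the projection
  onto \<open>carrier G\<close> rather than the identity. Two facts about C*-algebras carry the
  argument. Points of \<open>spectrum\<close> are purely algebraic functionals, so their
  contractivity comes from a fixed-point argument. Expectations of positive elements must be squares
  of selfadjoint elements of the subalgebra; these come from an iteration for the square root that
  never leaves it. Triviality of \<open>c\<close> on \<open>S\<close> makes \<open>delta\<close>
  multiplicative on \<open>S\<close>, so that characters of the algebra restrict to points of the
  dual group. Conjugation by other group elements still produces a scalar; in the proof that only
  elements of \<open>S\<close> act trivially near a point, it is cancelled by comparing two
  characters in the neighbourhood.\<close>

lemma l2_space_UNIV_iff: "f \<in> l2_space UNIV \<longleftrightarrow> (\<lambda>k. (cmod (f k))\<^sup>2) summable_on UNIV"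
  by (simp add: l2_space_def)

lemma l2_spaceI:
  assumes "\<And>F. finite F \<Longrightarrow> (\<Sum>k\<in>F. (cmod (f k))\<^sup>2) \<le> K"
  shows "f \<in> l2_space UNIV"
  unfolding l2_space_UNIV_iff
  by (rule nonneg_bdd_above_summable_on) (auto intro!: bdd_aboveI[where M = K] assms)

lemma l2_summable_inner:
  assumes "f \<in> l2_space UNIV" "g \<in> l2_space UNIV"
  shows "(\<lambda>k. inner (f k) (g k)) summable_on UNIV"
proof (rule abs_summable_summable)
  have sm: "(\<lambda>k. (cmod (f k))\<^sup>2 + (cmod (g k))\<^sup>2) summable_on UNIV"
    using assms by (intro summable_on_add) (simp_all add: l2_space_UNIV_iff)
  have "norm (inner (f k) (g k)) \<le> (cmod (f k))\<^sup>2 + (cmod (g k))\<^sup>2" for k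
  proof -
    have "norm (inner (f k) (g k)) \<le> cmod (f k) * cmod (g k)"
      using Cauchy_Schwarz_ineq2[of "f k" "g k"] by simp
    also have "\<dots> \<le> (cmod (f k))\<^sup>2 + (cmod (g k))\<^sup>2"
      using sum_squares_bound[of "cmod (f k)" "cmod (g k)"] mult_nonneg_nonneg[OF norm_ge_zero norm_ge_zero, of "f k" "g k"]
      by linarith
    finally show ?thesis .
  qed
  then show "(\<lambda>k. norm (inner (f k) (g k))) summable_on UNIV"
    by (intro Infinite_Sum.abs_summable_on_comparison_test'[OF sm])
qed

lemma l2_add:
  assumes "f \<in> l2_space UNIV" "g \<in> l2_space UNIV"
  shows "(\<lambda>k. f k + g k) \<in> l2_space UNIV"
proof -
  have "(\<lambda>k. (cmod (f k))\<^sup>2 + (cmod (g k))\<^sup>2 + 2 * inner (f k) (g k)) summable_on UNIV"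
    using assms l2_summable_inner[OF assms]
    by (intro summable_on_add summable_on_cmult_right) (simp_all add: l2_space_UNIV_iff)
  moreover have "(cmod (f k + g k))\<^sup>2 = (cmod (f k))\<^sup>2 + (cmod (g k))\<^sup>2 + 2 * inner (f k) (g k)" for k
    by (simp add: power2_norm_eq_inner inner_add inner_commute)
  ultimately show ?thesis
    by (simp add: l2_space_UNIV_iff)
qed

lemma l2_mult:
  assumes "f \<in> l2_space UNIV"
  shows "(\<lambda>k. z * f k) \<in> l2_space UNIV"
  using assms by (auto simp: l2_space_UNIV_iff norm_mult power_mult_distrib intro: summable_on_cmult_right)

typedef 'a ell2 = "l2_space (UNIV :: 'a set)" morphisms coord Abs_ell2
  by (rule exI[of _ "\<lambda>_. 0"]) (simp add: l2_space_UNIV_iff)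

setup_lifting type_definition_ell2

lemma ell2_eqI: "(\<And>k. coord \<xi> k = coord \<eta> k) \<Longrightarrow> \<xi> = \<eta>"
  by (metis coord_inverse ext)

instantiation ell2 :: (type) real_inner
begin

lift_definition zero_ell2 :: "'a ell2" is "\<lambda>_. 0"
  by (simp add: l2_space_UNIV_iff)

lift_definition plus_ell2 :: "'a ell2 \<Rightarrow> 'a ell2 \<Rightarrow> 'a ell2" is "\<lambda>f g k. f k + g k"
  by (rule l2_add)

lift_definition uminus_ell2 :: "'a ell2 \<Rightarrow> 'a ell2" is "\<lambda>f k. - f k"
  using l2_mult[of _ "-1"] by simp

lift_definition minus_ell2 :: "'a ell2 \<Rightarrow> 'a ell2 \<Rightarrow> 'a ell2" is "\<lambda>f g k. f k - g k"
  using l2_add l2_mult[of _ "-1"] by (metis (no_types, lifting) diff_conv_add_uminus ext mult_minus1)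

lift_definition scaleR_ell2 :: "real \<Rightarrow> 'a ell2 \<Rightarrow> 'a ell2" is "\<lambda>r f k. of_real r * f k"
  by (rule l2_mult)

text \<open>The real part of the sesquilinear form. A real inner product gives access to
  \<open>real_inner\<close>; the complex structure is the separate operation \<open>cscale\<close>,
  and \<open>l2_inner_coord\<close> recovers the imaginary part by pairing with
  \<open>cscale \<i> \<eta>\<close>.\<close>

lift_definition inner_ell2 :: "'a ell2 \<Rightarrow> 'a ell2 \<Rightarrow> real" is "\<lambda>f g. \<Sum>\<^sub>\<infinity>k. inner (f k) (g k)" .

definition norm_ell2 :: "'a ell2 \<Rightarrow> real" where "norm_ell2 \<xi> = sqrt (inner \<xi> \<xi>)"
definition dist_ell2 :: "'a ell2 \<Rightarrow> 'a ell2 \<Rightarrow> real" where "dist_ell2 \<xi> \<eta> = norm (\<xi> - \<eta>)"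
definition sgn_ell2 :: "'a ell2 \<Rightarrow> 'a ell2" where "sgn_ell2 \<xi> = scaleR (inverse (norm \<xi>)) \<xi>"
definition uniformity_ell2 :: "('a ell2 \<times> 'a ell2) filter" where
  "uniformity_ell2 = (INF e\<in>{0 <..}. principal {(x, y). dist x y < e})"
definition open_ell2 :: "'a ell2 set \<Rightarrow> bool" where
  "open_ell2 U = (\<forall>x\<in>U. \<forall>\<^sub>F (x', y) in uniformity. x' = x \<longrightarrow> y \<in> U)"

instance
proof
  fix \<xi> \<eta> \<zeta> :: "'a ell2" and r s :: real
  show "\<xi> + \<eta> + \<zeta> = \<xi> + (\<eta> + \<zeta>)" "\<xi> + \<eta> = \<eta> + \<xi>" "0 + \<xi> = \<xi>" "- \<xi> + \<xi> = 0" "\<xi> - \<eta> = \<xi> + - \<eta>"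
    by (transfer; simp add: algebra_simps)+
  show "r *\<^sub>R (\<xi> + \<eta>) = r *\<^sub>R \<xi> + r *\<^sub>R \<eta>" "(r + s) *\<^sub>R \<xi> = r *\<^sub>R \<xi> + s *\<^sub>R \<xi>"
    "r *\<^sub>R s *\<^sub>R \<xi> = (r * s) *\<^sub>R \<xi>" "1 *\<^sub>R \<xi> = \<xi>"
    by (transfer; simp add: algebra_simps)+
  show "dist \<xi> \<eta> = norm (\<xi> - \<eta>)" "sgn \<xi> = scaleR (inverse (norm \<xi>)) \<xi>" "norm \<xi> = sqrt (inner \<xi> \<xi>)"
    by (simp_all add: dist_ell2_def sgn_ell2_def norm_ell2_def)
  show "uniformity = (INF e\<in>{0 <..}. principal {(x, y). dist (x::'a ell2) y < e})"
    by (simp add: uniformity_ell2_def)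
  show "open U = (\<forall>x\<in>U. \<forall>\<^sub>F (x', y) in uniformity. x' = x \<longrightarrow> y \<in> U)" for U :: "'a ell2 set"
    by (simp add: open_ell2_def)
  show "inner \<xi> \<eta> = inner \<eta> \<xi>"
    by transfer (simp add: inner_commute)
  show "inner (\<xi> + \<eta>) \<zeta> = inner \<xi> \<zeta> + inner \<eta> \<zeta>"
    by transfer (simp add: inner_add_left infsum_add l2_summable_inner)
  show "inner (r *\<^sub>R \<xi>) \<eta> = r * inner \<xi> \<eta>"
    by transfer (simp add: infsum_cmult_right' scaleR_conv_of_real[symmetric] del: inner_complex_def)
  show "0 \<le> inner \<xi> \<xi>"
    by transfer (simp add: infsum_nonneg)
  show "inner \<xi> \<xi> = 0 \<longleftrightarrow> \<xi> = 0"
  proof (transfer, safe)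
    fix f :: "'a \<Rightarrow> complex"
    assume f: "f \<in> l2_space UNIV" "(\<Sum>\<^sub>\<infinity>k. inner (f k) (f k)) = 0"
    have "inner (f k) (f k) = 0" for k
      by (rule nonneg_infsum_le_0D[of _ UNIV]) (use f l2_summable_inner[OF f(1) f(1)] in auto)
    then show "f = (\<lambda>_. 0)"
      by auto
  qed simp
qed

end

lemma coord_simps [simp]:
  "coord 0 k = 0" "coord (\<xi> + \<eta>) k = coord \<xi> k + coord \<eta> k" "coord (- \<xi>) k = - coord \<xi> k"
  "coord (\<xi> - \<eta>) k = coord \<xi> k - coord \<eta> k" "coord (r *\<^sub>R \<xi>) k = of_real r * coord \<xi> k"
  by (transfer; simp)+

lemma coord_sum [simp]: "coord (\<Sum>i\<in>I. f i) k = (\<Sum>i\<in>I. coord (f i) k)"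
  by (induction I rule: infinite_finite_induct) simp_all

lemma inner_ell2_eq: "inner \<xi> \<eta> = (\<Sum>\<^sub>\<infinity>k. inner (coord \<xi> k) (coord \<eta> k))"
  by transfer simp

lemma has_sum_inner_ell2: "((\<lambda>k. inner (coord \<xi> k) (coord \<eta> k)) has_sum inner \<xi> \<eta>) UNIV"
  unfolding inner_ell2_eq using coord[of \<xi>] coord[of \<eta>] by (simp add: l2_summable_inner)

lemma norm_ell2_sq: "((\<lambda>k. (cmod (coord \<xi> k))\<^sup>2) has_sum (norm \<xi>)\<^sup>2) UNIV"
  using has_sum_inner_ell2[of \<xi> \<xi>] by (simp only: power2_norm_eq_inner)

lemma sum_coord_le: "finite F \<Longrightarrow> (\<Sum>k\<in>F. (cmod (coord \<xi> k))\<^sup>2) \<le> (norm \<xi>)\<^sup>2"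
  using norm_ell2_sq[of \<xi>] finite_sum_le_infsum[of "\<lambda>k. (cmod (coord \<xi> k))\<^sup>2" UNIV F]
  by (simp add: has_sum_iff)

lemma norm_ell2_leI:
  assumes "\<And>F. finite F \<Longrightarrow> (\<Sum>k\<in>F. (cmod (coord \<xi> k))\<^sup>2) \<le> K\<^sup>2" "0 \<le> K"
  shows "norm \<xi> \<le> K"
proof -
  have "(norm \<xi>)\<^sup>2 \<le> K\<^sup>2"
    using norm_ell2_sq[of \<xi>] infsum_le_finite_sums[of "\<lambda>k. (cmod (coord \<xi> k))\<^sup>2" UNIV "K\<^sup>2"] assms(1)
    by (simp add: has_sum_iff)
  then show ?thesis
    using assms(2) by (rule power2_le_imp_le)
qed

lemma cmod_coord_le: "cmod (coord \<xi> k) \<le> norm \<xi>"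
  using sum_coord_le[of "{k}" \<xi>] by (simp add: abs_le_square_iff[symmetric])

lemma bounded_linear_coord: "bounded_linear (\<lambda>\<xi>. coord \<xi> k)"
  by (rule bounded_linear_intro[where K = 1]) (simp_all add: cmod_coord_le scaleR_conv_of_real)

lemmas continuous_on_coord [continuous_intros] = bounded_linear.continuous_on[OF bounded_linear_coord]

text \<open>Bounds on finite partial sums survive coordinatewise limits. Applied once with bound 1
  they show that the limit is square-summable, and again with bound \<open>r / 2\<close> that the
  convergence holds in norm.\<close>

instance ell2 :: (type) complete_space
proof
  fix X :: "nat \<Rightarrow> 'a ell2"
  assume X: "Cauchy X"
  have "convergent (\<lambda>n. coord (X n) k)" for k
    by (rule Cauchy_convergent) (rule bounded_linear.Cauchy[OF bounded_linear_coord X])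
  then obtain f where f: "(\<lambda>n. coord (X n) k) \<longlonglongrightarrow> f k" for k
    unfolding convergent_def by metis
  have bound: "(\<Sum>k\<in>F. (cmod (coord (X n) k - f k))\<^sup>2) \<le> e\<^sup>2"
    if F: "finite F" and N: "\<And>m n. m \<ge> N \<Longrightarrow> n \<ge> N \<Longrightarrow> norm (X m - X n) < e" and n: "n \<ge> N" for F N e n
  proof (rule tendsto_upperbound)
    show "(\<lambda>m. \<Sum>k\<in>F. (cmod (coord (X n) k - coord (X m) k))\<^sup>2) \<longlonglongrightarrow> (\<Sum>k\<in>F. (cmod (coord (X n) k - f k))\<^sup>2)"
      by (intro tendsto_intros f)
    show "\<forall>\<^sub>F m in sequentially. (\<Sum>k\<in>F. (cmod (coord (X n) k - coord (X m) k))\<^sup>2) \<le> e\<^sup>2"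
    proof (rule eventually_sequentiallyI)
      fix m assume "N \<le> m"
      then show "(\<Sum>k\<in>F. (cmod (coord (X n) k - coord (X m) k))\<^sup>2) \<le> e\<^sup>2"
        using sum_coord_le[OF F, of "X n - X m"] N[of n m] n
        by (simp add: order.trans[OF _ power_mono[of _ e 2]] less_imp_le)
    qed
  qed simp
  obtain N where N: "\<And>m n. m \<ge> N \<Longrightarrow> n \<ge> N \<Longrightarrow> norm (X m - X n) < 1"
    using CauchyD[OF X, of 1] by auto
  have "(\<lambda>k. coord (X N) k - f k) \<in> l2_space UNIV"
    by (rule l2_spaceI[where K = "1\<^sup>2"]) (rule bound[OF _ N], auto)
  then have "f \<in> l2_space UNIV"
    using l2_add[OF l2_mult[of "\<lambda>k. coord (X N) k - f k" "-1"] coord[of "X N"]] by simp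
  then obtain \<xi> where \<xi>: "f = coord \<xi>"
    using Abs_ell2_inverse by metis
  have "X \<longlonglongrightarrow> \<xi>"
  proof (rule LIMSEQ_I)
    fix r :: real assume r: "0 < r"
    obtain N where N: "\<And>m n. m \<ge> N \<Longrightarrow> n \<ge> N \<Longrightarrow> norm (X m - X n) < r / 2"
      using CauchyD[OF X, of "r / 2"] r by auto
    have "norm (X n - \<xi>) \<le> r / 2" if "n \<ge> N" for n
      by (rule norm_ell2_leI) (use bound[OF _ N that] r in \<open>simp_all add: \<xi>\<close>)
    then show "\<exists>no. \<forall>n\<ge>no. norm (X n - \<xi>) < r"
      using r by (intro exI[of _ N]) force
  qed
  then show "convergent X"
    by (auto simp: convergent_def)
qed

subsection \<open>Complex scaling and coordinate projections\<close>

lift_definition cscale :: "complex \<Rightarrow> 'a ell2 \<Rightarrow> 'a ell2" is "\<lambda>z f k. z * f k"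
  by (rule l2_mult)

lift_definition proj :: "'a set \<Rightarrow> 'a ell2 \<Rightarrow> 'a ell2" is "\<lambda>X f k. if k \<in> X then f k else 0"
  unfolding l2_space_UNIV_iff by (erule summable_on_comparison_test) auto

lift_definition basis :: "'a \<Rightarrow> 'a ell2" is point_mass
  unfolding l2_space_UNIV_iff
  by (rule finite_nonzero_values_imp_summable_on) (simp add: point_mass_def)

lemma coord_cscale [simp]: "coord (cscale z \<xi>) k = z * coord \<xi> k"
  by transfer simp

lemma coord_proj [simp]: "coord (proj X \<xi>) k = (if k \<in> X then coord \<xi> k else 0)"
  by transfer simp

lemma coord_basis: "coord (basis h) k = (if k = h then 1 else 0)"
  by transfer (simp add: point_mass_def)

lemma cscale_simps [simp]:
  "cscale z (\<xi> + \<eta>) = cscale z \<xi> + cscale z \<eta>" "cscale z (\<xi> - \<eta>) = cscale z \<xi> - cscale z \<eta>"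
  "cscale z (cscale w \<xi>) = cscale (z * w) \<xi>" "cscale z (r *\<^sub>R \<xi>) = r *\<^sub>R cscale z \<xi>"
  "cscale 1 \<xi> = \<xi>" "cscale 0 \<xi> = 0" "cscale z 0 = 0"
  by (auto intro!: ell2_eqI simp: algebra_simps)

lemma cscale_sum: "cscale z (\<Sum>i\<in>I. f i) = (\<Sum>i\<in>I. cscale z (f i))"
  by (induction I rule: infinite_finite_induct) simp_all

lemma norm_cscale [simp]: "norm (cscale z \<xi>) = cmod z * norm \<xi>"
proof -
  have "((\<lambda>k. (cmod z)\<^sup>2 * (cmod (coord \<xi> k))\<^sup>2) has_sum (cmod z)\<^sup>2 * (norm \<xi>)\<^sup>2) UNIV"
    by (intro has_sum_cmult_right norm_ell2_sq)
  then have "(norm (cscale z \<xi>))\<^sup>2 = (cmod z * norm \<xi>)\<^sup>2"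
    using norm_ell2_sq[of "cscale z \<xi>"] has_sum_unique by (fastforce simp: norm_mult power_mult_distrib)
  then show ?thesis
    by simp
qed

lemma bounded_linear_cscale: "bounded_linear (cscale z)"
  by (rule bounded_linear_intro[where K = "cmod z"]) simp_all

lemma norm_proj_le: "norm (proj X \<xi>) \<le> norm \<xi>"
proof (rule norm_ell2_leI)
  fix F :: "'a set" assume "finite F"
  then show "(\<Sum>k\<in>F. (cmod (coord (proj X \<xi>) k))\<^sup>2) \<le> (norm \<xi>)\<^sup>2"
    by (intro order.trans[OF sum_mono sum_coord_le]) auto
qed simp

text \<open>By orthogonality the squared distance from \<xi> to a finite partial sum is the squared
  norm minus the corresponding partial sum of squared coordinates, which tends to 0.\<close>

lemma has_sum_basis: "((\<lambda>k. cscale (coord \<xi> k) (basis k)) has_sum \<xi>) UNIV"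
proof -
  have dist: "norm ((\<Sum>k\<in>F. cscale (coord \<xi> k) (basis k)) - \<xi>) =
      sqrt ((norm \<xi>)\<^sup>2 - (\<Sum>k\<in>F. (cmod (coord \<xi> k))\<^sup>2))" if F: "finite F" for F
  proof -
    have eq: "(\<Sum>k\<in>F. cscale (coord \<xi> k) (basis k)) = proj F \<xi>"
      using F by (intro ell2_eqI) (simp add: coord_basis sum.delta if_distrib cong: if_cong)
    have "((\<lambda>k. (cmod (coord (proj F \<xi>) k))\<^sup>2) has_sum (\<Sum>k\<in>F. (cmod (coord \<xi> k))\<^sup>2)) UNIV"
      by (rule has_sum_finite_neutralI[OF F]) auto
    then have "((\<lambda>k. (cmod (coord \<xi> k))\<^sup>2 - (cmod (coord (proj F \<xi>) k))\<^sup>2) has_sum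
        (norm \<xi>)\<^sup>2 - (\<Sum>k\<in>F. (cmod (coord \<xi> k))\<^sup>2)) UNIV"
      using has_sum_add[OF norm_ell2_sq[of \<xi>], of "\<lambda>k. - (cmod (coord (proj F \<xi>) k))\<^sup>2"
        "- (\<Sum>k\<in>F. (cmod (coord \<xi> k))\<^sup>2)"]
      by (simp add: has_sum_uminus)
    moreover have "(\<lambda>k. (cmod (coord \<xi> k))\<^sup>2 - (cmod (coord (proj F \<xi>) k))\<^sup>2) =
        (\<lambda>k. (cmod (coord (proj F \<xi> - \<xi>) k))\<^sup>2)"
      by auto
    ultimately have "(norm (proj F \<xi> - \<xi>))\<^sup>2 = (norm \<xi>)\<^sup>2 - (\<Sum>k\<in>F. (cmod (coord \<xi> k))\<^sup>2)"
      by (simp only: has_sum_unique[OF norm_ell2_sq])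
    then show ?thesis
      unfolding eq by (rule real_sqrt_unique[symmetric]) simp
  qed
  have "((\<lambda>F. sqrt ((norm \<xi>)\<^sup>2 - (\<Sum>k\<in>F. (cmod (coord \<xi> k))\<^sup>2))) \<longlongrightarrow>
      sqrt ((norm \<xi>)\<^sup>2 - (norm \<xi>)\<^sup>2)) (finite_subsets_at_top UNIV)"
    using norm_ell2_sq[of \<xi>] unfolding has_sum_def by (intro tendsto_intros)
  then have "((\<lambda>F. norm ((\<Sum>k\<in>F. cscale (coord \<xi> k) (basis k)) - \<xi>)) \<longlongrightarrow> 0)
      (finite_subsets_at_top UNIV)"
    unfolding diff_self real_sqrt_zero
    by (rule Lim_transform_eventually) (auto simp: dist intro!: eventually_finite_subsets_at_top_weakI)
  then show ?thesis
    unfolding has_sum_def by (rule LIM_zero_cancel[OF tendsto_norm_zero_cancel])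
qed

lemma inner_cscale_left: "inner (cscale z \<xi>) \<eta> = inner \<xi> (cscale (cnj z) \<eta>)"
  unfolding inner_ell2_eq by (simp add: inner_complex_def algebra_simps)

lemma inner_basis_right: "inner \<xi> (cscale z (basis k)) = Re (coord \<xi> k * cnj z)"
proof -
  have "((\<lambda>j. inner (coord \<xi> j) (coord (cscale z (basis k)) j)) has_sum
      (\<Sum>j\<in>{k}. inner (coord \<xi> j) (coord (cscale z (basis k)) j))) UNIV"
    by (rule has_sum_finite_neutralI[of "{k}"]) (auto simp: coord_basis)
  then have "inner \<xi> (cscale z (basis k)) = (\<Sum>j\<in>{k}. inner (coord \<xi> j) (coord (cscale z (basis k)) j))"
    using has_sum_inner_ell2 has_sum_unique by blast
  then show ?thesis
    by (simp add: coord_basis inner_complex_def)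
qed

lemma coord_eq_inner: "coord \<xi> k = Complex (inner \<xi> (basis k)) (inner \<xi> (cscale \<i> (basis k)))"
  using inner_basis_right[of \<xi> 1 k] inner_basis_right[of \<xi> \<i> k] by (simp add: complex_eq_iff)

lemma norm_basis [simp]: "norm (basis h) = 1"
  using inner_basis_right[of "basis h" 1 h] by (simp add: norm_eq_sqrt_inner coord_basis)

instance ell2 :: (type) banach ..

section \<open>Bounded operators as a normed algebra with involution\<close>

text \<open>The type \<open>\<Rightarrow>\<^sub>L\<close> consists of real-linear maps; commutation
  with every \<open>cscale z\<close> singles out the complex-linear ones.\<close>

typedef 'a oper = "{T :: 'a ell2 \<Rightarrow>\<^sub>L 'a ell2. \<forall>z \<xi>. T (cscale z \<xi>) = cscale z (T \<xi>)}"
  morphisms blin Abs_oper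
  by (rule exI[of _ 0]) simp

lifting_forget ell2.lifting

setup_lifting type_definition_oper

lift_definition app :: "'a oper \<Rightarrow> 'a ell2 \<Rightarrow> 'a ell2" is blinfun_apply .

lemma oper_eqI: "(\<And>\<xi>. app T \<xi> = app U \<xi>) \<Longrightarrow> T = U"
  by transfer (rule blinfun_eqI)

instantiation oper :: (type) real_normed_algebra
begin

lift_definition zero_oper :: "'a oper" is 0 by simp
lift_definition plus_oper :: "'a oper \<Rightarrow> 'a oper \<Rightarrow> 'a oper" is plus
  by (simp add: plus_blinfun.rep_eq)
lift_definition uminus_oper :: "'a oper \<Rightarrow> 'a oper" is uminus
  by (metis (no_types, lifting) cscale_simps(2,7) diff_0 uminus_blinfun.rep_eq)
lift_definition minus_oper :: "'a oper \<Rightarrow> 'a oper \<Rightarrow> 'a oper" is minus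
  by (simp add: minus_blinfun.rep_eq)
lift_definition scaleR_oper :: "real \<Rightarrow> 'a oper \<Rightarrow> 'a oper" is scaleR
  by (simp add: scaleR_blinfun.rep_eq)
lift_definition times_oper :: "'a oper \<Rightarrow> 'a oper \<Rightarrow> 'a oper" is blinfun_compose
  by simp
lift_definition norm_oper :: "'a oper \<Rightarrow> real" is norm .

definition dist_oper :: "'a oper \<Rightarrow> 'a oper \<Rightarrow> real" where "dist_oper T U = norm (T - U)"
definition sgn_oper :: "'a oper \<Rightarrow> 'a oper" where "sgn_oper T = scaleR (inverse (norm T)) T"
definition uniformity_oper :: "('a oper \<times> 'a oper) filter" where
  "uniformity_oper = (INF e\<in>{0 <..}. principal {(x, y). dist x y < e})"
definition open_oper :: "'a oper set \<Rightarrow> bool" where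
  "open_oper U = (\<forall>x\<in>U. \<forall>\<^sub>F (x', y) in uniformity. x' = x \<longrightarrow> y \<in> U)"

instance
proof
  fix T U V :: "'a oper" and r s :: real
  show "T + U + V = T + (U + V)" "T + U = U + T" "0 + T = T" "- T + T = 0" "T - U = T + - U"
    by (transfer; simp add: algebra_simps)+
  show "r *\<^sub>R (T + U) = r *\<^sub>R T + r *\<^sub>R U" "(r + s) *\<^sub>R T = r *\<^sub>R T + s *\<^sub>R T"
    "r *\<^sub>R s *\<^sub>R T = (r * s) *\<^sub>R T" "1 *\<^sub>R T = T"
    by (transfer; simp add: algebra_simps)+
  show "T * U * V = T * (U * V)"
    by transfer (auto intro!: blinfun_eqI)
  show "(T + U) * V = T * V + U * V" "T * (U + V) = T * U + T * V"
    "r *\<^sub>R T * U = r *\<^sub>R (T * U)" "T * r *\<^sub>R U = r *\<^sub>R (T * U)"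
    by (transfer; auto intro!: blinfun_eqI simp: blinfun.bilinear_simps)+
  show "dist T U = norm (T - U)" "sgn T = scaleR (inverse (norm T)) T"
    by (simp_all add: dist_oper_def sgn_oper_def)
  show "uniformity = (INF e\<in>{0 <..}. principal {(x, y). dist (x::'a oper) y < e})"
    by (simp add: uniformity_oper_def)
  show "open U = (\<forall>x\<in>U. \<forall>\<^sub>F (x', y) in uniformity. x' = x \<longrightarrow> y \<in> U)" for U :: "'a oper set"
    by (simp add: open_oper_def)
  show "(norm T = 0) = (T = 0)" "norm (T + U) \<le> norm T + norm U" "norm (r *\<^sub>R T) = \<bar>r\<bar> * norm T"
    by (transfer; simp add: norm_triangle_ineq)+
  show "norm (T * U) \<le> norm T * norm U"
    by transfer (rule norm_blinfun_compose)
qed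

end

lemma app_simps [simp]:
  "app 0 \<xi> = 0" "app (T + U) \<xi> = app T \<xi> + app U \<xi>" "app (- T) \<xi> = - app T \<xi>"
  "app (T - U) \<xi> = app T \<xi> - app U \<xi>" "app (r *\<^sub>R T) \<xi> = r *\<^sub>R app T \<xi>" "app (T * U) \<xi> = app T (app U \<xi>)"
  "app T (cscale z \<xi>) = cscale z (app T \<xi>)" "app T (\<xi> + \<eta>) = app T \<xi> + app T \<eta>"
  "app T (\<xi> - \<eta>) = app T \<xi> - app T \<eta>" "app T 0 = 0" "app T (r *\<^sub>R \<xi>) = r *\<^sub>R app T \<xi>"
  by (transfer; simp add: blinfun.bilinear_simps)+

lemma norm_app_le: "norm (app T \<xi>) \<le> norm T * norm \<xi>"
  by transfer (rule norm_blinfun)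

lemma norm_oper_leI: "0 \<le> K \<Longrightarrow> (\<And>\<xi>. norm (app T \<xi>) \<le> K * norm \<xi>) \<Longrightarrow> norm T \<le> K"
  by transfer (rule norm_blinfun_bound)

lemma bounded_linear_app: "bounded_linear (app T)"
  by transfer (rule blinfun.bounded_linear_right)

lemma bounded_linear_app_left: "bounded_linear (\<lambda>T. app T \<xi>)"
  by (rule bounded_linear_intro[where K = "norm \<xi>"]) (simp_all add: norm_app_le)

lemmas continuous_on_app_left [continuous_intros] = bounded_linear.continuous_on[OF bounded_linear_app_left]

lemma app_sum: "app T (\<Sum>i\<in>I. f i) = (\<Sum>i\<in>I. app T (f i))"
  by (rule linear_sum[OF bounded_linear.linear[OF bounded_linear_app]])

lemma oper_of_linear:
  assumes add: "\<And>\<xi> \<eta>. f (\<xi> + \<eta>) = f \<xi> + f \<eta>" and scale: "\<And>z \<xi>. f (cscale z \<xi>) = cscale z (f \<xi>)"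
    and bound: "\<And>\<xi>. norm (f \<xi>) \<le> K * norm \<xi>"
  obtains T where "app T = f"
proof -
  have *: "r *\<^sub>R \<xi> = cscale (of_real r) \<xi>" for r and \<xi> :: "'a ell2"
    by (rule ell2_eqI) simp
  have "bounded_linear f"
    by (rule bounded_linear_intro[where K = K]) (use bound in \<open>simp_all add: add scale * mult.commute\<close>)
  then have "blinfun_apply (Blinfun f) = f"
    by (rule bounded_linear_Blinfun_apply)
  then have "app (Abs_oper (Blinfun f)) = f"
    by (simp add: app.rep_eq Abs_oper_inverse scale)
  then show ?thesis ..
qed

instance oper :: (type) banach
proof
  fix X :: "nat \<Rightarrow> 'a oper"
  assume X: "Cauchy X"
  have "Cauchy (\<lambda>n. blin (X n))"
    using X unfolding Cauchy_def dist_norm by (simp add: norm_oper.rep_eq minus_oper.rep_eq)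
  then obtain L where L: "(\<lambda>n. blin (X n)) \<longlonglongrightarrow> L"
    using Cauchy_convergent[of "\<lambda>n. blin (X n)"] by (auto simp: convergent_def)
  have "L (cscale z \<xi>) = cscale z (L \<xi>)" for z \<xi>
  proof (rule LIMSEQ_unique)
    show "(\<lambda>n. blin (X n) (cscale z \<xi>)) \<longlonglongrightarrow> L (cscale z \<xi>)"
      by (intro tendsto_intros L)
    have "(\<lambda>n. cscale z (blin (X n) \<xi>)) \<longlonglongrightarrow> cscale z (L \<xi>)"
      by (intro bounded_linear.tendsto[OF bounded_linear_cscale] tendsto_intros L)
    then show "(\<lambda>n. blin (X n) (cscale z \<xi>)) \<longlonglongrightarrow> cscale z (L \<xi>)"
      using blin[of "X _"] by simp
  qed
  then have "blin (Abs_oper L) = L"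
    by (simp add: Abs_oper_inverse)
  then have "X \<longlonglongrightarrow> Abs_oper L"
    using L by (simp add: LIMSEQ_iff norm_oper.rep_eq minus_oper.rep_eq)
  then show "convergent X"
    by (auto simp: convergent_def)
qed

lift_definition cscale_oper :: "complex \<Rightarrow> 'a oper \<Rightarrow> 'a oper" is "\<lambda>z T. Blinfun (cscale z) o\<^sub>L T"
  by (simp add: bounded_linear_Blinfun_apply[OF bounded_linear_cscale] mult.commute)

notation cscale_oper (infixr "\<star>" 75)

lemma app_cscale_oper [simp]: "app (z \<star> T) \<xi> = cscale z (app T \<xi>)"
  by transfer (simp add: bounded_linear_Blinfun_apply[OF bounded_linear_cscale])

lemma cscale_oper_simps [simp]:
  "z \<star> (T + U) = z \<star> T + z \<star> U" "z \<star> (T - U) = z \<star> T - z \<star> U" "z \<star> w \<star> T = (z * w) \<star> T" "1 \<star> T = T" "0 \<star> T = 0"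
  "z \<star> 0 = 0" "(z \<star> T) * U = z \<star> (T * U)" "T * (z \<star> U) = z \<star> (T * U)"
  by (auto intro!: oper_eqI)

lemma cscale_oper_minus_one: "(- 1) \<star> T = - T"
  by (auto intro!: oper_eqI ell2_eqI)

lemma cscale_oper_of_real: "of_real r \<star> T = r *\<^sub>R T"
  by (auto intro!: oper_eqI ell2_eqI)

lemma norm_cscale_oper_le: "norm (z \<star> T) \<le> cmod z * norm T"
  by (rule norm_oper_leI) (auto intro: mult_left_mono norm_app_le simp: mult.assoc)

lemma cscale_oper_add_left: "(z + w) \<star> T = z \<star> T + w \<star> T"
  by (auto intro!: oper_eqI ell2_eqI simp: algebra_simps)

lemma bounded_linear_cscale_oper: "bounded_linear ((\<star>) z)"
  by (rule bounded_linear_intro[where K = "cmod z"])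
    (auto simp: norm_cscale_oper_le mult.commute[of _ "cmod z"] intro!: oper_eqI)

lemmas continuous_on_cscale_oper [continuous_intros] =
  bounded_linear.continuous_on[OF bounded_linear_cscale_oper]

subsection \<open>Adjoints\<close>

text \<open>Both sides are real-linear in \<open>z\<close>, so they agree once they agree at 1 and
  \<i>. The complex number on the right is the coordinate at \<open>k\<close> that the adjoint of
  \<open>T\<close> must give to \<eta>.\<close>

lemma inner_app_cscale_basis:
  "inner \<eta> (app T (cscale z (basis k))) =
    inner (Complex (inner \<eta> (app T (basis k))) (inner \<eta> (app T (cscale \<i> (basis k))))) z"
proof -
  have "cscale z \<xi> = Re z *\<^sub>R \<xi> + Im z *\<^sub>R cscale \<i> \<xi>" for \<xi> :: "'a ell2"
    by (rule ell2_eqI) (simp add: complex_eq_iff)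
  then have "app T (cscale z (basis k)) = Re z *\<^sub>R app T (basis k) + Im z *\<^sub>R app T (cscale \<i> (basis k))"
    by (metis app_simps(8,11))
  then show ?thesis
    by (simp add: inner_add_right inner_complex_def mult.commute)
qed

lemma norm_sum_basis:
  assumes F: "finite F"
  shows "(norm (\<Sum>k\<in>F. cscale (a k) (basis k)))\<^sup>2 = (\<Sum>k\<in>F. (cmod (a k))\<^sup>2)"
proof -
  have co: "coord (\<Sum>k\<in>F. cscale (a k) (basis k)) j = (if j \<in> F then a j else 0)" for j
    using F by (simp add: coord_basis sum.delta if_distrib cong: if_cong)
  have "((\<lambda>j. (cmod (coord (\<Sum>k\<in>F. cscale (a k) (basis k)) j))\<^sup>2) has_sum (\<Sum>k\<in>F. (cmod (a k))\<^sup>2)) UNIV"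
    unfolding co by (rule has_sum_finite_neutralI[OF F]) auto
  then show ?thesis
    using norm_ell2_sq has_sum_unique by blast
qed

text \<open>The coordinates \<open>t \<eta> k\<close> of the adjoint are forced. Pairing \<eta> with
  the image under \<open>T\<close> of the finite vector \<zeta> having these coefficients gives
  \<open>(norm \<zeta>)\<^sup>2 \<le> norm T * norm \<eta> * norm \<zeta>\<close>, so all partial
  sums of squares are bounded and the coordinates define a vector.\<close>

lemma adjoint_exists: "\<exists>U. \<forall>\<xi> \<eta>. inner (app T \<xi>) \<eta> = inner \<xi> (app U \<eta>)"
proof -
  define t where "t \<eta> k = Complex (inner \<eta> (app T (basis k))) (inner \<eta> (app T (cscale \<i> (basis k))))" for \<eta> k
  have le: "(\<Sum>k\<in>F. (cmod (t \<eta> k))\<^sup>2) \<le> (norm T * norm \<eta>)\<^sup>2" if F: "finite F" for F \<eta>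
  proof -
    define s where "s = (\<Sum>k\<in>F. (cmod (t \<eta> k))\<^sup>2)"
    define \<zeta> where "\<zeta> = (\<Sum>k\<in>F. cscale (t \<eta> k) (basis k))"
    have s: "(norm \<zeta>)\<^sup>2 = s"
      by (simp add: \<zeta>_def s_def norm_sum_basis F)
    have "s = (\<Sum>k\<in>F. inner (t \<eta> k) (t \<eta> k))"
      by (simp only: s_def power2_norm_eq_inner)
    also have "\<dots> = inner \<eta> (app T \<zeta>)"
      unfolding \<zeta>_def app_sum inner_sum_right
      by (intro sum.cong refl inner_app_cscale_basis[of \<eta> T, folded t_def, symmetric])
    also have "\<dots> \<le> norm \<eta> * norm (app T \<zeta>)"
      by (rule norm_cauchy_schwarz)
    also have "\<dots> \<le> norm \<eta> * (norm T * norm \<zeta>)"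
      by (intro mult_left_mono norm_app_le norm_ge_zero)
    finally have *: "(norm \<zeta>)\<^sup>2 \<le> (norm T * norm \<eta>) * norm \<zeta>"
      by (simp add: s mult_ac)
    have "norm \<zeta> \<le> norm T * norm \<eta>"
    proof (cases "norm \<zeta> = 0")
      case False
      then show ?thesis
        using * by (simp add: power2_eq_square)
    qed simp
    then show ?thesis
      unfolding s_def[symmetric] s[symmetric] by (intro power_mono) simp_all
  qed
  define u where "u \<eta> = Abs_ell2 (t \<eta>)" for \<eta>
  have u: "coord (u \<eta>) = t \<eta>" for \<eta>
    unfolding u_def by (rule Abs_ell2_inverse) (rule l2_spaceI[OF le])
  have adj: "inner (app T \<xi>) \<eta> = inner \<xi> (u \<eta>)" for \<xi> \<eta>
  proof (rule has_sum_unique)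
    have "((\<lambda>k. inner (app T (cscale (coord \<xi> k) (basis k))) \<eta>) has_sum inner (app T \<xi>) \<eta>) UNIV"
      by (intro has_sum_bounded_linear[OF bounded_linear_inner_left]
          has_sum_bounded_linear[OF bounded_linear_app] has_sum_basis)
    moreover have "inner (app T (cscale z (basis k))) \<eta> = inner z (coord (u \<eta>) k)" for z k
      using inner_app_cscale_basis[of \<eta> T z k] by (simp only: u t_def inner_commute)
    ultimately show "((\<lambda>k. inner (coord \<xi> k) (coord (u \<eta>) k)) has_sum inner (app T \<xi>) \<eta>) UNIV"
      by (simp only:)
  qed (rule has_sum_inner_ell2)
  obtain U where "app U = u"
  proof (rule oper_of_linear)
    show "u (\<xi> + \<eta>) = u \<xi> + u \<eta>" for \<xi> \<eta>
      by (rule ell2_eqI) (simp add: u t_def inner_add_left complex_eq_iff)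
    show "u (cscale z \<eta>) = cscale z (u \<eta>)" for z \<eta>
    proof -
      have "inner \<xi> (u (cscale z \<eta>)) = inner \<xi> (cscale z (u \<eta>))" for \<xi>
        using adj[of \<xi> "cscale z \<eta>"] adj[of "cscale (cnj z) \<xi>" \<eta>]
          inner_cscale_left[of "cnj z" "app T \<xi>" \<eta>] inner_cscale_left[of "cnj z" \<xi> "u \<eta>"]
        by simp
      then show ?thesis
        using vector_eq_ldot by blast
    qed
    show "norm (u \<eta>) \<le> norm T * norm \<eta>" for \<eta>
      by (rule norm_ell2_leI) (simp_all add: u le)
  qed blast
  then show ?thesis
    using adj by auto
qed

definition adj :: "'a oper \<Rightarrow> 'a oper" where
  "adj T = (SOME U. \<forall>\<xi> \<eta>. inner (app T \<xi>) \<eta> = inner \<xi> (app U \<eta>))"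

lemma inner_adj: "inner (app T \<xi>) \<eta> = inner \<xi> (app (adj T) \<eta>)"
  using someI_ex[OF adjoint_exists, of T] unfolding adj_def by blast

lemma adj_eqI:
  assumes "\<And>\<xi> \<eta>. inner (app T \<xi>) \<eta> = inner \<xi> (app U \<eta>)"
  shows "adj T = U"
proof (rule oper_eqI)
  fix \<eta>
  have "inner \<xi> (app (adj T) \<eta>) = inner \<xi> (app U \<eta>)" for \<xi>
    using assms inner_adj by metis
  then show "app (adj T) \<eta> = app U \<eta>"
    using vector_eq_ldot by blast
qed

lemma adj_simps [simp]:
  "adj (T + U) = adj T + adj U" "adj (T - U) = adj T - adj U" "adj (T * U) = adj U * adj T"
  "adj (z \<star> T) = cnj z \<star> adj T" "adj 0 = 0" "adj (adj T) = T" "adj (r *\<^sub>R T) = r *\<^sub>R adj T"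
proof -
  show "adj (adj T) = T"
    by (rule adj_eqI) (metis inner_adj inner_commute)
  show "adj (z \<star> T) = cnj z \<star> adj T"
    by (rule adj_eqI) (simp add: inner_cscale_left inner_adj)
qed (rule adj_eqI; simp add: inner_adj inner_add inner_diff)+

lemma norm_adj [simp]: "norm (adj T) = norm T"
proof -
  have le: "norm (adj T) \<le> norm T" for T :: "'a oper"
  proof (rule norm_oper_leI)
    fix \<eta>
    have "(norm (app (adj T) \<eta>))\<^sup>2 = inner (app T (app (adj T) \<eta>)) \<eta>"
      by (simp add: power2_norm_eq_inner inner_adj)
    also have "\<dots> \<le> norm (app T (app (adj T) \<eta>)) * norm \<eta>"
      by (rule norm_cauchy_schwarz)
    also have "\<dots> \<le> norm T * norm (app (adj T) \<eta>) * norm \<eta>"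
      by (intro mult_right_mono norm_app_le norm_ge_zero)
    finally have *: "(norm (app (adj T) \<eta>))\<^sup>2 \<le> (norm T * norm \<eta>) * norm (app (adj T) \<eta>)"
      by (simp add: mult_ac)
    show "norm (app (adj T) \<eta>) \<le> norm T * norm \<eta>"
      using * by (cases "norm (app (adj T) \<eta>) = 0") (simp_all add: power2_eq_square)
  qed simp
  from le[of T] le[of "adj T"] show ?thesis
    by simp
qed

lemma bounded_linear_adj: "bounded_linear adj"
  by (rule bounded_linear_intro[where K = 1]) simp_all

lemmas continuous_on_adj [continuous_intros] = bounded_linear.continuous_on[OF bounded_linear_adj]

text \<open>In the expansion of the square the cross term is
  \<open>2 * (norm (app T \<xi>))\<^sup>2\<close>, which dominates the last term because
  \<open>adj T\<close> is a contraction. This is the input of the square root iteration in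
  \<open>expect_positive\<close>.\<close>

lemma norm_id_minus_adj_mult_le:
  assumes "norm T \<le> 1"
  shows "norm (\<xi> - app (adj T * T) \<xi>) \<le> norm \<xi>"
proof -
  have "norm (app (adj T) (app T \<xi>)) \<le> norm (app T \<xi>)"
    using norm_app_le[of "adj T" "app T \<xi>"] mult_right_mono[OF assms norm_ge_zero[of "app T \<xi>"]] by simp
  then have "(norm (app (adj T) (app T \<xi>)))\<^sup>2 \<le> inner (app T \<xi>) (app T \<xi>)"
    unfolding power2_norm_eq_inner[symmetric] by (intro power_mono) simp_all
  then have "(norm (app (adj T) (app T \<xi>)))\<^sup>2 \<le> inner \<xi> (app (adj T) (app T \<xi>))"
    by (simp add: inner_adj)
  moreover have "(norm (\<xi> - app (adj T * T) \<xi>))\<^sup>2 =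
      (norm \<xi>)\<^sup>2 - 2 * inner \<xi> (app (adj T) (app T \<xi>)) + (norm (app (adj T) (app T \<xi>)))\<^sup>2"
    by (simp add: power2_norm_eq_inner inner_diff inner_commute)
  moreover have "0 \<le> inner \<xi> (app (adj T) (app T \<xi>))"
    by (simp flip: inner_adj)
  ultimately have "(norm (\<xi> - app (adj T * T) \<xi>))\<^sup>2 \<le> (norm \<xi>)\<^sup>2"
    by linarith
  then show ?thesis
    by (rule power2_le_imp_le) simp
qed

subsection \<open>Coordinate projections and block compressions\<close>

lemma app_proj_exists: "\<exists>P. app P = proj X"
proof -
  obtain P where "app P = proj X"
    by (rule oper_of_linear[of "proj X" 1]) (auto intro!: ell2_eqI simp: norm_proj_le)
  then show ?thesis ..
qed

definition proj_oper :: "'a set \<Rightarrow> 'a oper" where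
  "proj_oper X = (SOME P. app P = proj X)"

lemma app_proj_oper [simp]: "app (proj_oper X) = proj X"
  unfolding proj_oper_def by (rule someI_ex[OF app_proj_exists])

lemma adj_proj_oper [simp]: "adj (proj_oper X) = proj_oper X"
  by (rule adj_eqI) (simp add: inner_ell2_eq, rule infsum_cong, simp)

lemma sum_norm_proj_le:
  assumes I: "finite I"
  shows "(\<Sum>i\<in>I. (norm (proj {j. q j = i} \<xi>))\<^sup>2) \<le> (norm \<xi>)\<^sup>2"
proof (rule has_sum_mono)
  show "((\<lambda>k. \<Sum>i\<in>I. (cmod (coord (proj {j. q j = i} \<xi>) k))\<^sup>2) has_sum
      (\<Sum>i\<in>I. (norm (proj {j. q j = i} \<xi>))\<^sup>2)) UNIV"
    by (induction I rule: infinite_finite_induct) (simp_all add: has_sum_add norm_ell2_sq del: coord_proj)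
  show "((\<lambda>k. (cmod (coord \<xi> k))\<^sup>2) has_sum (norm \<xi>)\<^sup>2) UNIV"
    by (rule norm_ell2_sq)
  show "(\<Sum>i\<in>I. (cmod (coord (proj {j. q j = i} \<xi>) k))\<^sup>2) \<le> (cmod (coord \<xi> k))\<^sup>2" for k
  proof -
    have "(\<Sum>i\<in>I. (cmod (coord (proj {j. q j = i} \<xi>) k))\<^sup>2) =
        (\<Sum>i\<in>I. if q k = i then (cmod (coord \<xi> k))\<^sup>2 else 0)"
      by (rule sum.cong) auto
    then show ?thesis
      using I by (simp add: sum.delta)
  qed
qed

text \<open>The fibres of \<open>q\<close> split the space into orthogonal blocks. On each block the
  bound for \<open>T\<close> applies to the part of \<xi> in that block, and the squared norms of
  these parts sum to at most that of \<xi>, so the norm does not grow.\<close>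

lemma compression_exists:
  "\<exists>U. (\<forall>\<xi> k. coord (app U \<xi>) k = coord (app T (proj {j. q j = q k} \<xi>)) k) \<and> norm U \<le> norm T"
proof -
  define f where "f \<xi> k = coord (app T (proj {j. q j = q k} \<xi>)) k" for \<xi> k
  have le: "(\<Sum>k\<in>F. (cmod (f \<xi> k))\<^sup>2) \<le> (norm T * norm \<xi>)\<^sup>2" if F: "finite F" for F \<xi>
  proof -
    have "(\<Sum>k\<in>F. (cmod (f \<xi> k))\<^sup>2) = (\<Sum>i\<in>q ` F. \<Sum>k\<in>{k. k \<in> F \<and> q k = i}. (cmod (f \<xi> k))\<^sup>2)"
      by (rule sum.group[symmetric]) (use F in auto)
    also have "\<dots> = (\<Sum>i\<in>q ` F. \<Sum>k\<in>{k. k \<in> F \<and> q k = i}. (cmod (coord (app T (proj {j. q j = i} \<xi>)) k))\<^sup>2)"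
      by (intro sum.cong refl) (auto simp: f_def)
    also have "\<dots> \<le> (\<Sum>i\<in>q ` F. (norm (app T (proj {j. q j = i} \<xi>)))\<^sup>2)"
      by (intro sum_mono sum_coord_le) (use F in auto)
    also have "\<dots> \<le> (\<Sum>i\<in>q ` F. (norm T)\<^sup>2 * (norm (proj {j. q j = i} \<xi>))\<^sup>2)"
      unfolding power_mult_distrib[symmetric] by (intro sum_mono power_mono norm_app_le norm_ge_zero)
    also have "\<dots> \<le> (norm T)\<^sup>2 * (norm \<xi>)\<^sup>2"
      unfolding sum_distrib_left[symmetric] by (intro mult_left_mono sum_norm_proj_le) (use F in auto)
    finally show ?thesis
      by (simp add: power_mult_distrib)
  qed
  have f: "coord (Abs_ell2 (f \<xi>)) = f \<xi>" for \<xi>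
    by (rule Abs_ell2_inverse) (rule l2_spaceI[OF le])
  have proj_add: "proj Y (\<xi> + \<eta>) = proj Y \<xi> + proj Y \<eta>" and proj_cscale: "proj Y (cscale z \<xi>) = cscale z (proj Y \<xi>)"
    for Y z and \<xi> \<eta> :: "'a ell2"
    by (auto intro!: ell2_eqI)
  have norm_f: "norm (Abs_ell2 (f \<xi>)) \<le> norm T * norm \<xi>" for \<xi>
    by (rule norm_ell2_leI) (simp_all add: f le)
  obtain U where U: "app U = (\<lambda>\<xi>. Abs_ell2 (f \<xi>))"
  proof (rule oper_of_linear[OF _ _ norm_f])
    show "Abs_ell2 (f (\<xi> + \<eta>)) = Abs_ell2 (f \<xi>) + Abs_ell2 (f \<eta>)" for \<xi> \<eta>
      by (rule ell2_eqI) (simp add: f, simp add: f_def proj_add)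
    show "Abs_ell2 (f (cscale z \<xi>)) = cscale z (Abs_ell2 (f \<xi>))" for z \<xi>
      by (rule ell2_eqI) (simp add: f, simp add: f_def proj_cscale)
  qed blast
  have "norm U \<le> norm T"
    by (rule norm_oper_leI) (simp_all add: U norm_f)
  moreover have "coord (app U \<xi>) k = coord (app T (proj {j. q j = q k} \<xi>)) k" for \<xi> k
    by (simp add: U f) (simp add: f_def)
  ultimately show ?thesis
    by blast
qed

text \<open>The block-diagonal part of \<open>T\<close>. With \<open>q\<close> sending
  \<open>k\<close> to the coset \<open>S #> k\<close> it becomes the conditional expectation
  \<open>expect\<close>.\<close>

definition compression :: "('a \<Rightarrow> 'b) \<Rightarrow> 'a oper \<Rightarrow> 'a oper" where
  "compression q T = (SOME U.
    (\<forall>\<xi> k. coord (app U \<xi>) k = coord (app T (proj {j. q j = q k} \<xi>)) k) \<and> norm U \<le> norm T)"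

lemma coord_compression:
  "coord (app (compression q T) \<xi>) k = coord (app T (proj {j. q j = q k} \<xi>)) k"
  using someI_ex[OF compression_exists, of T q] unfolding compression_def by blast

lemma norm_compression_le: "norm (compression q T) \<le> norm T"
  using someI_ex[OF compression_exists, of T q] unfolding compression_def by blast

lemma compression_simps [simp]:
  "compression q (T + U) = compression q T + compression q U"
  "compression q (T - U) = compression q T - compression q U"
  "compression q (z \<star> T) = z \<star> compression q T" "compression q (r *\<^sub>R T) = r *\<^sub>R compression q T"
  "compression q 0 = 0"
  by (auto intro!: oper_eqI ell2_eqI simp: coord_compression)

lemma bounded_linear_compression: "bounded_linear (compression q)"
  by (rule bounded_linear_intro[where K = 1]) (simp_all add: norm_compression_le)

section \<open>The concrete operators on a subset of the index set\<close>

lemma l2_space_iff: "f \<in> l2_space X \<longleftrightarrow> f \<in> l2_space UNIV \<and> (\<forall>k. k \<notin> X \<longrightarrow> f k = 0)"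
proof (cases "\<forall>k. k \<notin> X \<longrightarrow> f k = 0")
  case True
  then have "(\<lambda>k. (cmod (f k))\<^sup>2) summable_on X \<longleftrightarrow> (\<lambda>k. (cmod (f k))\<^sup>2) summable_on UNIV"
    by (intro summable_on_cong_neutral) auto
  with True show ?thesis
    by (simp add: l2_space_def)
next
  case False
  then show ?thesis
    by (auto simp: l2_space_def)
qed

lemma proj_eq_iff: "proj X \<xi> = \<xi> \<longleftrightarrow> (\<forall>k. k \<notin> X \<longrightarrow> coord \<xi> k = 0)"
  by (metis coord_proj ell2_eqI)

lemma l2_space_eq: "l2_space X = coord ` {\<xi>. proj X \<xi> = \<xi>}"
proof safe
  fix f :: "'a \<Rightarrow> complex" assume "f \<in> l2_space X"
  then have "f \<in> l2_space UNIV \<and> (\<forall>k. k \<notin> X \<longrightarrow> f k = 0)"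
    by (rule l2_space_iff[THEN iffD1])
  then show "f \<in> coord ` {\<xi>. proj X \<xi> = \<xi>}"
    by (intro image_eqI[of _ _ "Abs_ell2 f"]) (simp_all add: proj_eq_iff Abs_ell2_inverse)
next
  fix \<xi> :: "'a ell2" assume "proj X \<xi> = \<xi>"
  then have "\<forall>k. k \<notin> X \<longrightarrow> coord \<xi> k = 0"
    by (simp only: proj_eq_iff)
  with coord[of \<xi>] show "coord \<xi> \<in> l2_space X"
    by (rule l2_space_iff[THEN iffD2, OF conjI])
qed

lemma proj_proj [simp]: "proj X (proj X \<xi>) = proj X \<xi>"
  by (rule ell2_eqI) simp

lemma proj_linear [simp]: "proj X 0 = 0" "proj X (\<xi> + \<eta>) = proj X \<xi> + proj X \<eta>"
  "proj X (\<xi> - \<eta>) = proj X \<xi> - proj X \<eta>" "proj X (cscale z \<xi>) = cscale z (proj X \<xi>)"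
  by (auto intro!: ell2_eqI)

lemma l2_norm_coord: "proj X \<xi> = \<xi> \<Longrightarrow> l2_norm X (coord \<xi>) = norm \<xi>"
proof -
  assume "proj X \<xi> = \<xi>"
  then have "(\<Sum>\<^sub>\<infinity>k\<in>X. (cmod (coord \<xi> k))\<^sup>2) = (\<Sum>\<^sub>\<infinity>k. (cmod (coord \<xi> k))\<^sup>2)"
    by (intro infsum_cong_neutral) (auto simp: proj_eq_iff)
  also have "\<dots> = (norm \<xi>)\<^sup>2"
    using norm_ell2_sq by (rule infsumI)
  finally show ?thesis
    by (simp add: l2_norm_def)
qed

lemma l2_inner_coord:
  assumes "proj X \<xi> = \<xi>"
  shows "l2_inner X (coord \<xi>) (coord \<eta>) = Complex (inner \<xi> \<eta>) (inner \<xi> (cscale \<i> \<eta>))"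
proof -
  have "(\<Sum>\<^sub>\<infinity>k\<in>X. coord \<xi> k * cnj (coord \<eta> k)) = (\<Sum>\<^sub>\<infinity>k. coord \<xi> k * cnj (coord \<eta> k))"
    using assms by (intro infsum_cong_neutral) (auto simp: proj_eq_iff)
  moreover have "((\<lambda>k. of_real (inner (coord \<xi> k) (coord \<eta> k)) +
      \<i> * of_real (inner (coord \<xi> k) (coord (cscale \<i> \<eta>) k))) has_sum
      of_real (inner \<xi> \<eta>) + \<i> * of_real (inner \<xi> (cscale \<i> \<eta>))) UNIV"
    by (intro has_sum_add has_sum_cmult_right has_sum_of_real has_sum_inner_ell2)
  moreover have "of_real (inner (coord \<xi> k) (coord \<eta> k)) +
      \<i> * of_real (inner (coord \<xi> k) (coord (cscale \<i> \<eta>) k)) = coord \<xi> k * cnj (coord \<eta> k)" for k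
    by (simp add: complex_eq_iff inner_complex_def)
  ultimately show ?thesis
    by (simp add: l2_inner_def Complex_eq infsumI)
qed

text \<open>Bounded operators on the families supported in \<open>X\<close>, extended by 0 to all
  families so that they share one type and one norm.\<close>

definition corner :: "'a set \<Rightarrow> 'a oper set" where
  "corner X = {T. proj_oper X * T = T \<and> T * proj_oper X = T}"

lemma corner_app: "T \<in> corner X \<Longrightarrow> proj X (app T \<xi>) = app T \<xi>" "T \<in> corner X \<Longrightarrow> app T (proj X \<xi>) = app T \<xi>"
  unfolding corner_def by (metis (mono_tags, lifting) app_proj_oper app_simps(6) mem_Collect_eq)+

lemma cornerI:
  assumes "\<And>\<xi>. proj X (app T \<xi>) = app T \<xi>" "\<And>\<xi>. app T (proj X \<xi>) = app T \<xi>"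
  shows "T \<in> corner X"
  using assms unfolding corner_def by (auto intro!: oper_eqI)

lemma corner_closed_ops:
  "T \<in> corner X \<Longrightarrow> U \<in> corner X \<Longrightarrow> T + U \<in> corner X"
  "T \<in> corner X \<Longrightarrow> U \<in> corner X \<Longrightarrow> T - U \<in> corner X"
  "T \<in> corner X \<Longrightarrow> U \<in> corner X \<Longrightarrow> T * U \<in> corner X"
  "T \<in> corner X \<Longrightarrow> z \<star> T \<in> corner X" "0 \<in> corner X"
  by (auto simp: corner_def algebra_simps) (metis mult.assoc)+

lemma corner_adj: "T \<in> corner X \<Longrightarrow> adj T \<in> corner X"
  unfolding corner_def by (metis (mono_tags, lifting) adj_proj_oper adj_simps(3) mem_Collect_eq)

lemma closed_corner: "closed (corner X)"
  unfolding corner_def by (intro closed_Collect_conj closed_Collect_eq continuous_intros)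

definition conc :: "'a set \<Rightarrow> 'a oper \<Rightarrow> 'a l2_op" where
  "conc X T = (\<lambda>f\<in>l2_space X. coord (app T (Abs_ell2 f)))"

lemma conc_coord: "proj X \<xi> = \<xi> \<Longrightarrow> conc X T (coord \<xi>) = coord (app T \<xi>)"
  unfolding conc_def by (simp add: l2_space_eq coord_inverse)

lemma coord_fun_simps:
  "(\<lambda>k. coord \<xi> k + coord \<eta> k) = coord (\<xi> + \<eta>)" "(\<lambda>k. z * coord \<xi> k) = coord (cscale z \<xi>)"
  "(\<lambda>k. 0) = coord 0"
  by auto

lemma conc_extensional [simp]: "conc X T \<in> extensional (l2_space X)"
  by (simp add: conc_def)

lemma l2_op_eqI:
  assumes "t \<in> extensional (l2_space X)" "u \<in> extensional (l2_space X)"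
    "\<And>\<xi>. proj X \<xi> = \<xi> \<Longrightarrow> t (coord \<xi>) = u (coord \<xi>)"
  shows "t = u"
  by (rule extensionalityI[OF assms(1,2)]) (auto simp: l2_space_eq assms(3))

lemma inj_on_conc: "inj_on (conc X) (corner X)"
proof (rule inj_onI)
  fix T U assume TU: "T \<in> corner X" "U \<in> corner X" "conc X T = conc X U"
  show "T = U"
  proof (rule oper_eqI)
    fix \<xi>
    have "coord (app T (proj X \<xi>)) = coord (app U (proj X \<xi>))"
      using TU(3) conc_coord[of X "proj X \<xi>"] by (metis proj_proj)
    then show "app T \<xi> = app U \<xi>"
      using TU(1,2) by (simp add: corner_app coord_inject)
  qed
qed

lemma conc_in_bounded_ops:
  assumes T: "T \<in> corner X"
  shows "conc X T \<in> bounded_ops X"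
proof -
  have "app T \<xi> \<in> {\<xi>. proj X \<xi> = \<xi>}" for \<xi>
    using corner_app[OF T] by simp
  moreover have "\<exists>K. \<forall>\<xi>\<in>l2_space X. l2_norm X (conc X T \<xi>) \<le> K * l2_norm X \<xi>"
    by (rule exI[of _ "norm T"]) (auto simp: l2_space_eq conc_coord l2_norm_coord corner_app[OF T] norm_app_le)
  ultimately show ?thesis
    using conc_extensional[of X T]
    unfolding bounded_ops_def by (auto simp: l2_space_eq conc_coord coord_fun_simps)
qed

lemma bounded_ops_conc:
  assumes t: "t \<in> bounded_ops X"
  obtains T where "T \<in> corner X" "t = conc X T"
proof -
  have ext: "t \<in> extensional (l2_space X)"
    using t by (simp add: bounded_ops_def)
  have "t (coord \<xi>) \<in> l2_space X" if "proj X \<xi> = \<xi>" for \<xi>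
    using t that by (auto simp: bounded_ops_def l2_space_eq)
  then have "t (coord (proj X \<xi>)) \<in> l2_space X" for \<xi>
    by simp
  then have "\<exists>\<zeta>. t (coord (proj X \<xi>)) = coord \<zeta> \<and> proj X \<zeta> = \<zeta>" for \<xi>
    unfolding l2_space_eq by (simp add: image_iff) metis
  then obtain f where f: "\<And>\<xi>. t (coord (proj X \<xi>)) = coord (f \<xi>)" and pf: "\<And>\<xi>. proj X (f \<xi>) = f \<xi>"
    by metis
  have mem: "coord (proj X \<xi>) \<in> l2_space X" for \<xi>
    by (simp add: l2_space_eq)
  obtain K where K: "\<And>\<xi>. \<xi> \<in> l2_space X \<Longrightarrow> l2_norm X (t \<xi>) \<le> K * l2_norm X \<xi>"
    using t unfolding bounded_ops_def by blast
  obtain T where T: "app T = f"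
  proof (rule oper_of_linear)
    show "f (\<xi> + \<eta>) = f \<xi> + f \<eta>" for \<xi> \<eta>
    proof -
      have "t (\<lambda>k. coord (proj X \<xi>) k + coord (proj X \<eta>) k) =
          (\<lambda>k. t (coord (proj X \<xi>)) k + t (coord (proj X \<eta>)) k)"
        using t mem unfolding bounded_ops_def by blast
      then have "coord (f (\<xi> + \<eta>)) = coord (f \<xi> + f \<eta>)"
        unfolding coord_fun_simps f by (simp flip: f)
      then show ?thesis
        by (simp only: coord_inject)
    qed
    show "f (cscale z \<xi>) = cscale z (f \<xi>)" for z \<xi>
    proof -
      have "t (\<lambda>k. z * coord (proj X \<xi>) k) = (\<lambda>k. z * t (coord (proj X \<xi>)) k)"
        using t mem unfolding bounded_ops_def by blast
      then have "coord (f (cscale z \<xi>)) = coord (cscale z (f \<xi>))"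
        unfolding coord_fun_simps f by (simp flip: f)
      then show ?thesis
        by (simp only: coord_inject)
    qed
    show "norm (f \<xi>) \<le> \<bar>K\<bar> * norm \<xi>" for \<xi>
    proof -
      have "norm (f \<xi>) \<le> K * norm (proj X \<xi>)"
        using K[OF mem, of \<xi>] by (simp add: f l2_norm_coord pf)
      also have "\<dots> \<le> \<bar>K\<bar> * norm \<xi>"
        by (intro mult_mono norm_proj_le) auto
      finally show ?thesis .
    qed
  qed
  have fp: "f (proj X \<xi>) = f \<xi>" for \<xi>
    using f[of "proj X \<xi>"] f[of \<xi>] by (simp add: coord_inject)
  have "T \<in> corner X"
    by (rule cornerI) (simp_all add: T pf fp)
  moreover have "t = conc X T"
    by (rule l2_op_eqI[OF ext conc_extensional]) (metis T conc_coord f)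
  ultimately show ?thesis
    by (rule that)
qed

lemma bounded_ops_eq: "bounded_ops X = conc X ` corner X"
  using bounded_ops_conc conc_in_bounded_ops by blast

lemma l2_operators_simps:
  "carrier (l2_operators X) = bounded_ops X"
  "zero (l2_operators X) = conc X 0"
  "add (l2_operators X) (conc X T) (conc X U) = conc X (T + U)"
  "smult (l2_operators X) z (conc X T) = conc X (z \<star> T)"
  by (auto simp: l2_operators_def conc_def fun_eq_iff restrict_def)

text \<open>The values of \<open>U\<close> must be supported in \<open>X\<close>, since
  \<open>conc X T\<close> is meaningful only on \<open>l2_space X\<close>.\<close>

lemma l2_operators_mult:
  assumes "U \<in> corner X"
  shows "monoid.mult (l2_operators X) (conc X T) (conc X U) = conc X (T * U)"
  unfolding l2_operators_def
  using conc_extensional[of X "T * U"]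
  by (intro l2_op_eqI[of _ X])
    (auto simp: compose_def conc_coord corner_app[OF assms] l2_space_eq)

lemma alg_norm_conc:
  assumes T: "T \<in> corner X"
  shows "alg_norm (l2_operators X) (conc X T) = norm T"
proof -
  define A where "A = {K. 0 \<le> K \<and> (\<forall>\<xi>\<in>l2_space X. l2_norm X (conc X T \<xi>) \<le> K * l2_norm X \<xi>)}"
  have "Inf A = norm T"
  proof (rule cInf_eq_minimum)
    show "norm T \<in> A"
      unfolding A_def by (auto simp: l2_space_eq conc_coord l2_norm_coord corner_app[OF T] norm_app_le)
    fix K assume "K \<in> A"
    then have K: "0 \<le> K" "proj X \<xi> = \<xi> \<Longrightarrow> norm (app T \<xi>) \<le> K * norm \<xi>" for \<xi>
      unfolding A_def by (auto simp: l2_space_eq conc_coord l2_norm_coord corner_app[OF T])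
    show "norm T \<le> K"
    proof (rule norm_oper_leI[OF K(1)])
      fix \<xi>
      have "norm (app T \<xi>) \<le> K * norm (proj X \<xi>)"
        using K(2)[of "proj X \<xi>"] by (simp add: corner_app[OF T])
      also have "\<dots> \<le> K * norm \<xi>"
        by (intro mult_left_mono norm_proj_le K(1))
      finally show "norm (app T \<xi>) \<le> K * norm \<xi>" .
    qed
  qed
  then show ?thesis
    by (simp add: l2_operators_def A_def)
qed

text \<open>Uniqueness in the definition of \<open>star\<close> uses only the real part of the
  adjoint identity: it already determines the adjoint for the real inner product. Vectors are
  projected first because the identity is assumed on \<open>l2_space X\<close> alone.\<close>

lemma star_conc:
  assumes T: "T \<in> corner X"
  shows "star (l2_operators X) (conc X T) = conc X (adj T)"
proof -
  define P where "P U \<longleftrightarrow> U \<in> bounded_ops X \<and>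
    (\<forall>\<xi>\<in>l2_space X. \<forall>\<eta>\<in>l2_space X. l2_inner X (conc X T \<xi>) \<eta> = l2_inner X \<xi> (U \<eta>))" for U
  have "(THE U. P U) = conc X (adj T)"
  proof (rule the_equality)
    show "P (conc X (adj T))"
      unfolding P_def using conc_in_bounded_ops[OF corner_adj[OF T]]
      by (auto simp: l2_space_eq conc_coord l2_inner_coord corner_app[OF T] inner_adj)
    fix U assume U: "P U"
    then obtain V where V: "V \<in> corner X" "U = conc X V"
      unfolding P_def using bounded_ops_conc by blast
    have "adj T = V"
    proof (rule adj_eqI)
      fix \<xi> \<eta>
      have "l2_inner X (conc X T (coord (proj X \<xi>))) (coord (proj X \<eta>)) =
          l2_inner X (coord (proj X \<xi>)) (conc X V (coord (proj X \<eta>)))"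
        using U unfolding P_def V(2) by (auto simp: l2_space_eq)
      then have "inner (app T \<xi>) (proj X \<eta>) = inner (proj X \<xi>) (app V \<eta>)"
        by (simp add: conc_coord l2_inner_coord corner_app[OF T] corner_app[OF V(1)])
      then show "inner (app T \<xi>) \<eta> = inner \<xi> (app V \<eta>)"
        using inner_adj[of "proj_oper X" "app T \<xi>" \<eta>] inner_adj[of "proj_oper X" \<xi> "app V \<eta>"]
        by (simp add: corner_app[OF T] corner_app[OF V(1)])
    qed
    with V show "U = conc X (adj T)"
      by simp
  qed
  then show ?thesis
    by (simp add: l2_operators_def P_def)
qed

text \<open>The carrier \<open>C\<close> is left open because closures are taken in two ambient
  algebras: in all bounded operators for \<open>reduced_set\<close>, and in the reduced algebra for
  its subalgebras.\<close>

lemma norm_closure_conc: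
  assumes Y: "Y \<subseteq> corner X" and M: "M = (l2_operators X)\<lparr>carrier := conc X ` C\<rparr>"
    and C: "C \<subseteq> corner X"
  shows "norm_closure M (conc X ` Y) = conc X ` (C \<inter> closure Y)"
proof -
  have *: "alg_norm M (add M (conc X T) (smult M (- 1) (conc X U))) = dist U T"
    if "T \<in> C" "U \<in> Y" for T U
  proof -
    have "T + (- 1) \<star> U = T - U"
      by (simp only: cscale_oper_minus_one diff_conv_add_uminus)
    then have "alg_norm M (add M (conc X T) (smult M (- 1) (conc X U))) = norm (T - U)"
      using that Y C corner_closed_ops(2)[of T X U]
      by (subst alg_norm_conc[symmetric, of _ X]) (auto simp: M l2_operators_simps)
    then show ?thesis
      by (simp add: dist_norm norm_minus_commute)
  qed
  have carrier: "carrier M = conc X ` C"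
    by (simp add: M)
  have "conc X T \<in> norm_closure M (conc X ` Y) \<longleftrightarrow> T \<in> closure Y" if "T \<in> C" for T
    using that unfolding norm_closure_def closure_approachable carrier by (simp add: * cong: bex_cong)
  moreover have "norm_closure M (conc X ` Y) \<subseteq> conc X ` C"
    by (auto simp: norm_closure_def M)
  ultimately show ?thesis
    by auto
qed

section \<open>Two iterations in Banach algebras\<close>

text \<open>Writing \<open>1 - Y\<close> for the square root of \<open>1 - X\<close> turns the equation into \<open>2 Y = X + Y\<^sup>2\<close>,
  which makes sense without a unit; the iterates are dominated by those of the scalar case \<open>X = 1\<close>.\<close>

lemma square_root_iteration:
  fixes X :: "'b :: {real_normed_algebra, banach}"
  assumes X: "norm X \<le> 1" and C: "closed C" "0 \<in> C" "\<And>A. A \<in> C \<Longrightarrow> (1 / 2) *\<^sub>R (X + A * A) \<in> C"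
  obtains Y where "Y \<in> C" "2 *\<^sub>R Y = X + Y * Y"
proof -
  define Y where "Y n = ((\<lambda>A. (1 / 2) *\<^sub>R (X + A * A)) ^^ n) 0" for n
  define y :: "nat \<Rightarrow> real" where "y n = ((\<lambda>a. (1 / 2) * (1 + a * a)) ^^ n) 0" for n
  have Y0: "Y 0 = 0" and YS: "Y (Suc n) = (1 / 2) *\<^sub>R (X + Y n * Y n)" for n
    by (simp_all add: Y_def)
  have y0: "y 0 = 0" and yS: "y (Suc n) = (1 / 2) * (1 + y n * y n)" for n
    by (simp_all add: y_def)
  have y01: "0 \<le> y n \<and> y n \<le> 1" for n
  proof (induction n)
    case (Suc n)
    then have "y n * y n \<le> 1" "0 \<le> y n * y n"
      by (simp_all add: mult_le_one)
    then show ?case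
      by (simp add: yS)
  qed (simp add: y0)
  have nY: "norm (Y n) \<le> y n" for n
  proof (induction n)
    case (Suc n)
    have "norm (X + Y n * Y n) \<le> norm X + norm (Y n * Y n)"
      by (rule norm_triangle_ineq)
    also have "\<dots> \<le> 1 + norm (Y n) * norm (Y n)"
      by (intro add_mono X norm_mult_ineq)
    also have "\<dots> \<le> 1 + y n * y n"
      using Suc.IH y01[of n] by (intro add_left_mono mult_mono) auto
    finally show ?case
      by (simp add: YS yS)
  qed (simp add: Y0 y0)
  have diff: "norm (Y (Suc n) - Y n) \<le> y (Suc n) - y n" for n
  proof (induction n)
    case 0
    then show ?case
      using nY[of "Suc 0"] by (simp add: Y0 y0)
  next
    case (Suc n)
    let ?D = "Y (Suc n) - Y n"
    have h: "0 \<le> y n" "0 \<le> y (Suc n)" "y n \<le> y (Suc n)"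
      using Suc.IH norm_ge_zero[of ?D] y01[of n] y01[of "Suc n"] by linarith+
    \<comment> \<open>The difference of the squares of A and B in noncommuting form: A (A - B) + (A
      - B) B.\<close>
    have "Y (Suc (Suc n)) - Y (Suc n) = (1 / 2) *\<^sub>R (Y (Suc n) * ?D + ?D * Y n)"
      by (simp add: YS[of "Suc n"] YS[of n] algebra_simps flip: YS)
    then have "norm (Y (Suc (Suc n)) - Y (Suc n)) = (1 / 2) * norm (Y (Suc n) * ?D + ?D * Y n)"
      by simp
    also have "\<dots> \<le> (1 / 2) * (norm (Y (Suc n)) * norm ?D + norm ?D * norm (Y n))"
      by (intro mult_left_mono order.trans[OF norm_triangle_ineq] add_mono norm_mult_ineq) simp
    also have "\<dots> \<le> (1 / 2) * (y (Suc n) * (y (Suc n) - y n) + (y (Suc n) - y n) * y n)"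
      using Suc.IH nY h by (intro mult_left_mono add_mono mult_mono) simp_all
    also have "\<dots> = y (Suc (Suc n)) - y (Suc n)"
    proof -
      have "(1 / 2) * (a * (a - b) + (a - b) * b) = (1 / 2) * (1 + a * a) - a"
        if "a = (1 / 2) * (1 + b * b)" for a b :: real
        unfolding that by (simp add: field_simps)
      then show ?thesis
        unfolding yS[of "Suc n"] using yS[of n] by blast
    qed
    finally show ?case .
  qed
  have inc: "y n \<le> y (Suc n)" for n
    using diff[of n] norm_ge_zero[of "Y (Suc n) - Y n"] by linarith
  have "incseq y"
    using inc by (rule incseq_SucI)
  then have "convergent y"
    using y01 by (metis Bseq_monoseq_convergent Bseq_def abs_of_nonneg incseq_imp_monoseq real_norm_def zero_less_one)
  \<comment> \<open>The bounded increasing scalar sequence has summable increments, and these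
    dominate the increments of \<open>Y\<close>.\<close>
  then have "summable (\<lambda>n. y (Suc n) - y n)"
    by (metis convergent_def telescope_summable)
  then have "summable (\<lambda>n. Y (Suc n) - Y n)"
    by (rule summable_comparison_test'[where N = 0]) (rule diff)
  then have "(\<lambda>n. \<Sum>i<n. Y (Suc i) - Y i) \<longlonglongrightarrow> suminf (\<lambda>n. Y (Suc n) - Y n)"
    by (rule summable_LIMSEQ)
  moreover have "(\<Sum>i<n. Y (Suc i) - Y i) = Y n" for n
    by (simp add: sum_lessThan_telescope Y0)
  ultimately obtain L where L: "Y \<longlonglongrightarrow> L"
    by auto
  have "Y n \<in> C" for n
    by (induction n) (use C in \<open>simp_all add: Y0 YS\<close>)
  then have "L \<in> C"
    using C(1) L closed_sequentially by blast
  moreover have "(\<lambda>n. (1 / 2) *\<^sub>R (X + Y n * Y n)) \<longlonglongrightarrow> (1 / 2) *\<^sub>R (X + L * L)"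
    by (intro tendsto_intros L)
  then have "(\<lambda>n. Y (Suc n)) \<longlonglongrightarrow> (1 / 2) *\<^sub>R (X + L * L)"
    by (simp add: YS)
  then have "L = (1 / 2) *\<^sub>R (X + L * L)"
    using L LIMSEQ_Suc LIMSEQ_unique by blast
  then have "2 *\<^sub>R L = X + L * L"
    by (metis scaleR_half_double scaleR_2 scaleR_scaleR scaleR_one mult_2 nonzero_eq_divide_eq zero_neq_numeral times_divide_eq_right mult_1_right)
  with \<open>L \<in> C\<close> show ?thesis
    by (rule that)
qed

text \<open>The map sending \<open>A\<close> to \<open>b + b * A\<close> contracts distances by the
  factor \<open>norm b\<close>; its fixed point is the sum of all positive powers of
  \<open>b\<close>, obtained inside \<open>C\<close> without reference to a unit.\<close>

lemma neumann_fixpoint: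
  fixes b :: "'b :: {real_normed_algebra, banach}"
  assumes b: "norm b < 1" and C: "closed C" "C \<noteq> {}" "\<And>A. A \<in> C \<Longrightarrow> b + b * A \<in> C"
  obtains Y where "Y \<in> C" "Y = b + b * Y"
proof -
  have "\<exists>!x\<in>C. b + b * x = x"
  proof (rule Banach_fix)
    show "complete C"
      using C(1) by (simp add: complete_eq_closed)
    show "dist (b + b * x) (b + b * y) \<le> norm b * dist x y" for x y
      using norm_mult_ineq[of b "x - y"] by (simp add: dist_norm algebra_simps)
  qed (use b C in auto)
  then show ?thesis
    using that by metis
qed

section \<open>Twisted group algebras\<close>

lemma app_sum_left: "app (\<Sum>i\<in>I. T i) \<xi> = (\<Sum>i\<in>I. app (T i) \<xi>)"
  by (induction I rule: infinite_finite_induct) simp_all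

lemma oper_eq_basisI:
  assumes "\<And>h. app T (basis h) = app U (basis h)"
  shows "T = U"
proof (rule oper_eqI)
  fix \<xi>
  have "((\<lambda>k. app T (cscale (coord \<xi> k) (basis k))) has_sum app T \<xi>) UNIV"
    "((\<lambda>k. app U (cscale (coord \<xi> k) (basis k))) has_sum app U \<xi>) UNIV"
    by (intro has_sum_bounded_linear[OF bounded_linear_app] has_sum_basis)+
  then show "app T \<xi> = app U \<xi>"
    by (simp add: assms has_sum_unique)
qed

lemma closed_Collect_mem: "closed S \<Longrightarrow> continuous_on UNIV f \<Longrightarrow> closed {x. f x \<in> S}"
  using closed_vimage[of S f] by (simp add: vimage_def)

locale twisted_group = group G for G :: "('g, 'm) monoid_scheme" (structure) +
  fixes c :: "'g \<Rightarrow> 'g \<Rightarrow> complex"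
  assumes cocycle: "two_cocycle G c"
begin

lemma cmod_c [simp]: "g \<in> carrier G \<Longrightarrow> h \<in> carrier G \<Longrightarrow> cmod (c g h) = 1"
  and c_one [simp]: "g \<in> carrier G \<Longrightarrow> c g \<one> = 1" "g \<in> carrier G \<Longrightarrow> c \<one> g = 1"
  and c_assoc: "g \<in> carrier G \<Longrightarrow> h \<in> carrier G \<Longrightarrow> k \<in> carrier G \<Longrightarrow>
    c g (h \<otimes> k) * c h k = c (g \<otimes> h) k * c g h"
  using cocycle by (auto simp: two_cocycle_def)

lemma c_nonzero [simp]: "g \<in> carrier G \<Longrightarrow> h \<in> carrier G \<Longrightarrow> c g h \<noteq> 0"
  using cmod_c by fastforce

lemma cnj_c: "g \<in> carrier G \<Longrightarrow> h \<in> carrier G \<Longrightarrow> cnj (c g h) * c g h = 1"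
  by (simp add: complex_norm_square[symmetric] mult.commute)

lemma inv_cancel [simp]:
  "g \<in> carrier G \<Longrightarrow> k \<in> carrier G \<Longrightarrow> inv g \<otimes> (g \<otimes> k) = k"
  "g \<in> carrier G \<Longrightarrow> k \<in> carrier G \<Longrightarrow> g \<otimes> (inv g \<otimes> k) = k"
  "g \<in> carrier G \<Longrightarrow> k \<in> carrier G \<Longrightarrow> k \<otimes> g \<otimes> inv g = k"
  "g \<in> carrier G \<Longrightarrow> k \<in> carrier G \<Longrightarrow> k \<otimes> inv g \<otimes> g = k"
  by (simp_all add: m_assoc) (simp_all flip: m_assoc)

lemma c_inv_commute: "g \<in> carrier G \<Longrightarrow> c (inv g) g = c g (inv g)"
  using c_assoc[of g "inv g" g] by simp

lemma delta_exists:
  assumes g: "g \<in> carrier G"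
  shows "\<exists>T. \<forall>\<xi> k. coord (app T \<xi>) k =
    (if k \<in> carrier G then c g (inv g \<otimes> k) * coord \<xi> (inv g \<otimes> k) else 0)"
proof -
  define f where "f \<xi> k = (if k \<in> carrier G then c g (inv g \<otimes> k) * coord \<xi> (inv g \<otimes> k) else 0)" for \<xi> k
  have le: "(\<Sum>k\<in>F. (cmod (f \<xi> k))\<^sup>2) \<le> (norm \<xi>)\<^sup>2" if F: "finite F" for F \<xi>
  proof -
    have "inj_on (\<lambda>k. inv g \<otimes> k) (F \<inter> carrier G)"
      using g by (intro inj_onI) (metis IntD2 inv_cancel(2))
    then have "(\<Sum>k\<in>(\<lambda>k. inv g \<otimes> k) ` (F \<inter> carrier G). (cmod (coord \<xi> k))\<^sup>2) =
        (\<Sum>k\<in>F \<inter> carrier G. (cmod (coord \<xi> (inv g \<otimes> k)))\<^sup>2)"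
      by (simp add: sum.reindex)
    also have "\<dots> = (\<Sum>k\<in>F. (cmod (f \<xi> k))\<^sup>2)"
      using F g by (intro sum.mono_neutral_cong_left) (auto simp: f_def norm_mult)
    finally show ?thesis
      using F sum_coord_le[of "(\<lambda>k. inv g \<otimes> k) ` (F \<inter> carrier G)" \<xi>] by simp
  qed
  have f: "coord (Abs_ell2 (f \<xi>)) = f \<xi>" for \<xi>
    by (rule Abs_ell2_inverse) (rule l2_spaceI[OF le])
  obtain T where "app T = (\<lambda>\<xi>. Abs_ell2 (f \<xi>))"
  proof (rule oper_of_linear)
    show "Abs_ell2 (f (\<xi> + \<eta>)) = Abs_ell2 (f \<xi>) + Abs_ell2 (f \<eta>)" for \<xi> \<eta>
      by (rule ell2_eqI) (simp add: f, simp add: f_def algebra_simps)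
    show "Abs_ell2 (f (cscale z \<xi>)) = cscale z (Abs_ell2 (f \<xi>))" for z \<xi>
      by (rule ell2_eqI) (simp add: f, simp add: f_def)
    show "norm (Abs_ell2 (f \<xi>)) \<le> 1 * norm \<xi>" for \<xi>
      by (rule norm_ell2_leI) (simp_all add: f le)
  qed blast
  then show ?thesis
    by (intro exI[of _ T]) (simp add: f, simp add: f_def)
qed

definition delta :: "'g \<Rightarrow> 'g oper" where
  "delta g = (SOME T. \<forall>\<xi> k. coord (app T \<xi>) k =
    (if k \<in> carrier G then c g (inv g \<otimes> k) * coord \<xi> (inv g \<otimes> k) else 0))"

lemma coord_delta: "g \<in> carrier G \<Longrightarrow> coord (app (delta g) \<xi>) k =
    (if k \<in> carrier G then c g (inv g \<otimes> k) * coord \<xi> (inv g \<otimes> k) else 0)"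
  using someI_ex[OF delta_exists[of g]] unfolding delta_def by blast

text \<open>Coordinates at indices outside \<open>carrier G\<close> are killed, so this projection,
  not the identity of the ambient space, is the unit of the group algebra.\<close>

lemma delta_one: "delta \<one> = proj_oper (carrier G)"
  by (auto intro!: oper_eqI ell2_eqI simp: coord_delta)

lemma delta_basis:
  assumes g: "g \<in> carrier G" and h: "h \<in> carrier G"
  shows "app (delta g) (basis h) = cscale (c g h) (basis (g \<otimes> h))"
proof (rule ell2_eqI)
  fix k
  have "inv g \<otimes> k = h \<longleftrightarrow> k = g \<otimes> h" if "k \<in> carrier G"
    using g h that inv_cancel(1,2) by metis
  then show "coord (app (delta g) (basis h)) k = coord (cscale (c g h) (basis (g \<otimes> h))) k"
    using g h by (auto simp: coord_delta coord_basis)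
qed

lemma delta_mult:
  assumes g: "g \<in> carrier G" and h: "h \<in> carrier G"
  shows "delta g * delta h = c g h \<star> delta (g \<otimes> h)"
proof (intro oper_eqI ell2_eqI)
  fix \<xi> k
  show "coord (app (delta g * delta h) \<xi>) k = coord (app (c g h \<star> delta (g \<otimes> h)) \<xi>) k"
  proof (cases "k \<in> carrier G")
    case True
    define m where "m = inv (g \<otimes> h) \<otimes> k"
    have m: "m \<in> carrier G" "inv h \<otimes> (inv g \<otimes> k) = m" "inv g \<otimes> k = h \<otimes> m"
      using g h True by (simp_all add: m_def inv_mult_group m_assoc)
    show ?thesis
      using g h True c_assoc[OF g h m(1)] m
      by (simp add: coord_delta mult_ac flip: m_def)
  qed (use g h in \<open>simp add: coord_delta\<close>)
qed

lemma adj_delta: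
  assumes g: "g \<in> carrier G"
  shows "adj (delta g) = cnj (c g (inv g)) \<star> delta (inv g)"
proof (rule adj_eqI)
  fix \<xi> \<eta>
  have bij: "bij_betw (\<lambda>k. g \<otimes> k) (carrier G) (carrier G)"
    using g by (intro bij_betwI[where g = "\<lambda>k. inv g \<otimes> k"]) auto
  have "inner (app (delta g) \<xi>) \<eta> =
      (\<Sum>\<^sub>\<infinity>k\<in>carrier G. inner (c g (inv g \<otimes> k) * coord \<xi> (inv g \<otimes> k)) (coord \<eta> k))"
    unfolding inner_ell2_eq by (rule infsum_cong_neutral) (use g in \<open>auto simp: coord_delta\<close>)
  also have "\<dots> = (\<Sum>\<^sub>\<infinity>m\<in>carrier G. inner (c g (inv g \<otimes> (g \<otimes> m)) * coord \<xi> (inv g \<otimes> (g \<otimes> m))) (coord \<eta> (g \<otimes> m)))"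
    by (rule infsum_reindex_bij_betw[OF bij, symmetric])
  also have "\<dots> = (\<Sum>\<^sub>\<infinity>m\<in>carrier G. inner (coord \<xi> m) (cnj (c g (inv g)) * (c (inv g) (g \<otimes> m) * coord \<eta> (g \<otimes> m))))"
  proof (rule infsum_cong)
    fix m assume m: "m \<in> carrier G"
    \<comment> \<open>The cocycle identity for \<open>inv g\<close>, \<open>g\<close>,
      \<open>m\<close>, whose first two entries multiply to \<one>.\<close>
    have "c (inv g) (g \<otimes> m) * c g m = c g (inv g)"
      using c_assoc[of "inv g" g m] g m by (simp add: c_inv_commute)
    then have "cnj (c g (inv g)) * c (inv g) (g \<otimes> m) = cnj (c g m) * (cnj (c (inv g) (g \<otimes> m)) * c (inv g) (g \<otimes> m))"
      by (metis complex_cnj_mult mult.assoc mult.commute)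
    then have *: "cnj (c g (inv g)) * c (inv g) (g \<otimes> m) = cnj (c g m)"
      using g m by (simp add: cnj_c)
    show "inner (c g (inv g \<otimes> (g \<otimes> m)) * coord \<xi> (inv g \<otimes> (g \<otimes> m))) (coord \<eta> (g \<otimes> m)) =
        inner (coord \<xi> m) (cnj (c g (inv g)) * (c (inv g) (g \<otimes> m) * coord \<eta> (g \<otimes> m)))"
      unfolding mult.assoc[symmetric] * using g m by (simp add: inner_complex_def algebra_simps)
  qed
  also have "\<dots> = inner \<xi> (app (cnj (c g (inv g)) \<star> delta (inv g)) \<eta>)"
    unfolding inner_ell2_eq by (rule infsum_cong_neutral) (use g in \<open>auto simp: coord_delta\<close>)
  finally show "inner (app (delta g) \<xi>) \<eta> = inner \<xi> (app (cnj (c g (inv g)) \<star> delta (inv g)) \<eta>)" .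
qed

lemma delta_unitary:
  assumes g: "g \<in> carrier G"
  shows "adj (delta g) * delta g = delta \<one>" "delta g * adj (delta g) = delta \<one>"
  using g by (simp_all add: adj_delta delta_mult c_inv_commute cnj_c)

lemma delta_corner: "g \<in> carrier G \<Longrightarrow> delta g \<in> corner (carrier G)"
  by (simp add: corner_def delta_mult flip: delta_one)

lemma norm_delta_le: "g \<in> carrier G \<Longrightarrow> norm (delta g) \<le> 1"
proof (rule norm_oper_leI)
  fix \<xi>
  assume g: "g \<in> carrier G"
  have "(norm (app (delta g) \<xi>))\<^sup>2 = inner \<xi> (app (adj (delta g) * delta g) \<xi>)"
    by (simp add: power2_norm_eq_inner inner_adj)
  also have "\<dots> = inner (proj (carrier G) \<xi>) (proj (carrier G) \<xi>)"
    using inner_adj[of "proj_oper (carrier G)" \<xi> "proj (carrier G) \<xi>"]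
    by (simp only: delta_unitary[OF g] delta_one app_proj_oper adj_proj_oper proj_proj)
  also have "\<dots> = (norm (proj (carrier G) \<xi>))\<^sup>2"
    by (simp add: power2_norm_eq_inner)
  finally show "norm (app (delta g) \<xi>) \<le> 1 * norm \<xi>"
    using norm_proj_le[of "carrier G" \<xi>] by simp
qed simp

definition regular :: "('g \<Rightarrow> complex) \<Rightarrow> 'g oper" where
  "regular f = (\<Sum>g | f g \<noteq> 0. f g \<star> delta g)"

lemma regular_superset: "finite F \<Longrightarrow> {g. f g \<noteq> 0} \<subseteq> F \<Longrightarrow> regular f = (\<Sum>g\<in>F. f g \<star> delta g)"
  unfolding regular_def by (rule sum.mono_neutral_left) auto

lemma regular_add:
  assumes "f \<in> finsupp X" "h \<in> finsupp X"
  shows "(\<lambda>g. f g + h g) \<in> finsupp X" "regular (\<lambda>g. f g + h g) = regular f + regular h"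
proof -
  let ?F = "{g. f g \<noteq> 0} \<union> {g. h g \<noteq> 0}"
  have F: "finite ?F" "{g. f g + h g \<noteq> 0} \<subseteq> ?F" "?F \<subseteq> X"
    using assms by (auto simp: finsupp_def)
  then show "(\<lambda>g. f g + h g) \<in> finsupp X"
    unfolding finsupp_def using finite_subset by blast
  show "regular (\<lambda>g. f g + h g) = regular f + regular h"
    using regular_superset[OF F(1,2)] regular_superset[OF F(1), of f] regular_superset[OF F(1), of h]
    by (simp add: cscale_oper_add_left sum.distrib)
qed

lemma regular_scale:
  assumes "f \<in> finsupp X"
  shows "(\<lambda>g. z * f g) \<in> finsupp X" "regular (\<lambda>g. z * f g) = z \<star> regular f"
proof -
  have F: "finite {g. f g \<noteq> 0}" "{g. z * f g \<noteq> 0} \<subseteq> {g. f g \<noteq> 0}" "{g. f g \<noteq> 0} \<subseteq> X"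
    using assms by (auto simp: finsupp_def)
  then show "(\<lambda>g. z * f g) \<in> finsupp X"
    unfolding finsupp_def using finite_subset by blast
  show "regular (\<lambda>g. z * f g) = z \<star> regular f"
    unfolding regular_superset[OF F(1,2)] regular_def
    by (simp add: linear_sum[OF bounded_linear.linear[OF bounded_linear_cscale_oper]])
qed

lemma regular_point_mass: "regular (point_mass g) = delta g"
  using regular_superset[of "{g}" "point_mass g"] by (auto simp: point_mass_def)

lemma point_mass_finsupp: "g \<in> X \<Longrightarrow> point_mass g \<in> finsupp X"
  by (auto simp: finsupp_def point_mass_def)

lemma zero_finsupp: "(\<lambda>_. 0) \<in> finsupp X"
  by (simp add: finsupp_def)

lemma regular_zero: "regular (\<lambda>_. 0) = 0"
  by (simp add: regular_def)

lemma regular_induct: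
  assumes f: "f \<in> finsupp X" and "Q 0" "\<And>g. g \<in> X \<Longrightarrow> Q (delta g)"
    "\<And>a b. Q a \<Longrightarrow> Q b \<Longrightarrow> Q (a + b)" "\<And>z a. Q a \<Longrightarrow> Q (z \<star> a)"
  shows "Q (regular f)"
proof -
  have "finite F \<Longrightarrow> F \<subseteq> X \<Longrightarrow> Q (\<Sum>g\<in>F. f g \<star> delta g)" for F
    by (induction F rule: finite_induct) (use assms in auto)
  then show ?thesis
    using f unfolding regular_def finsupp_def by blast
qed

definition alg :: "'g set \<Rightarrow> 'g oper set" where
  "alg X = closure (regular ` finsupp X)"

lemma closed_alg [simp]: "closed (alg X)"
  by (simp add: alg_def)

text \<open>The set where \<open>Q\<close> holds is closed and contains the span of the operators
  \<open>delta g\<close>. An identity between continuous linear expressions is thus checked on these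
  operators alone, and a bilinear one by two nested inductions.\<close>

lemma alg_induct [consumes 1, case_names closed zero delta add scale]:
  assumes a: "a \<in> alg X" and cl: "closed {a. Q a}" and Q: "Q 0" "\<And>g. g \<in> X \<Longrightarrow> Q (delta g)"
    "\<And>a b. Q a \<Longrightarrow> Q b \<Longrightarrow> Q (a + b)" "\<And>z a. Q a \<Longrightarrow> Q (z \<star> a)"
  shows "Q a"
proof -
  have "alg X \<subseteq> {a. Q a}"
    unfolding alg_def by (rule closure_minimal[OF _ cl]) (use regular_induct[of _ X Q] Q in auto)
  then show ?thesis
    using a by auto
qed

lemma regular_alg: "f \<in> finsupp X \<Longrightarrow> regular f \<in> alg X"
  unfolding alg_def by (rule subsetD[OF closure_subset imageI])

lemma delta_alg [simp]: "g \<in> X \<Longrightarrow> delta g \<in> alg X"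
  using regular_alg[OF point_mass_finsupp] by (simp add: regular_point_mass)

lemma zero_alg [simp]: "0 \<in> alg X"
  using regular_alg[OF zero_finsupp] by (simp add: regular_zero)

text \<open>Serves to prove closure under sums and multiples, which an induction with
  \<open>alg_induct\<close> on membership would presuppose.\<close>

lemma alg_limit:
  assumes "a \<in> alg X" "continuous_on UNIV \<phi>" "\<And>f. f \<in> finsupp X \<Longrightarrow> \<phi> (regular f) \<in> alg X"
  shows "\<phi> a \<in> alg X"
proof -
  have "\<phi> ` closure (regular ` finsupp X) \<subseteq> alg X"
    using assms(2,3) by (intro image_closure_subset[OF _ closed_alg]) (auto intro: continuous_on_subset)
  then show ?thesis
    using assms(1) by (auto simp: alg_def)
qed

lemma alg_add [simp]:
  assumes a: "a \<in> alg X" and b: "b \<in> alg X"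
  shows "a + b \<in> alg X"
proof (rule alg_limit[OF a, where \<phi> = "\<lambda>a. a + b"])
  fix f assume f: "f \<in> finsupp X"
  show "regular f + b \<in> alg X"
  proof (rule alg_limit[OF b, where \<phi> = "\<lambda>b. regular f + b"])
    fix h assume "h \<in> finsupp X"
    then show "regular f + regular h \<in> alg X"
      using regular_alg[OF regular_add(1)[OF f]] by (simp add: regular_add(2)[OF f])
  qed (intro continuous_intros)
qed (intro continuous_intros)

lemma alg_scale [simp]: "a \<in> alg X \<Longrightarrow> z \<star> a \<in> alg X"
proof (erule alg_limit[where \<phi> = "\<lambda>a. z \<star> a"])
  fix f assume "f \<in> finsupp X"
  then show "z \<star> regular f \<in> alg X"
    using regular_alg[OF regular_scale(1)] by (simp flip: regular_scale(2))
qed (intro continuous_intros)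

lemma alg_diff [simp]: "a \<in> alg X \<Longrightarrow> b \<in> alg X \<Longrightarrow> a - b \<in> alg X"
  using alg_add[OF _ alg_scale[of b X "- 1"]] by (simp only: cscale_oper_minus_one diff_conv_add_uminus)

lemma alg_scaleR [simp]: "a \<in> alg X \<Longrightarrow> r *\<^sub>R a \<in> alg X"
  by (simp flip: cscale_oper_of_real)

lemma alg_mono: "X \<subseteq> Y \<Longrightarrow> alg X \<subseteq> alg Y"
  unfolding alg_def by (intro closure_mono image_mono) (auto simp: finsupp_def)

lemma alg_mult:
  assumes X: "subgroup X G" and a: "a \<in> alg X" and b: "b \<in> alg X"
  shows "a * b \<in> alg X"
  using a
proof (induction rule: alg_induct)
  case closed
  show ?case
    by (intro closed_Collect_mem closed_alg continuous_intros)
next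
  case (delta g)
  show ?case
    using b
  proof (induction rule: alg_induct)
    case closed
    show ?case
      by (intro closed_Collect_mem closed_alg continuous_intros)
  next
    case (delta h)
    have "g \<in> carrier G" "h \<in> carrier G" "g \<otimes> h \<in> X"
      using \<open>g \<in> X\<close> delta by (simp_all add: subgroup.mem_carrier[OF X] subgroup.m_closed[OF X])
    then show ?case
      by (simp add: delta_mult)
  qed (simp_all add: distrib_left)
qed (simp_all add: distrib_right)

lemma alg_adj:
  assumes X: "subgroup X G" and a: "a \<in> alg X"
  shows "adj a \<in> alg X"
  using a
proof (induction rule: alg_induct)
  case closed
  show ?case
    by (intro closed_Collect_mem closed_alg continuous_intros)
next
  case (delta g)
  then show ?case
    using X by (simp add: adj_delta subgroup.mem_carrier subgroup.m_inv_closed)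
qed simp_all

lemma alg_corner: "alg (carrier G) \<subseteq> corner (carrier G)"
proof
  fix a assume "a \<in> alg (carrier G)"
  then show "a \<in> corner (carrier G)"
    by (induction rule: alg_induct) (simp_all add: closed_corner corner_closed_ops delta_corner)
qed

lemma unit_alg [simp]: "a \<in> alg (carrier G) \<Longrightarrow> delta \<one> * a = a" "a \<in> alg (carrier G) \<Longrightarrow> a * delta \<one> = a"
  using alg_corner by (auto simp: corner_def delta_one)

lemma left_regular_eq:
  assumes f: "f \<in> finsupp (carrier G)"
  shows "left_regular G c f = conc (carrier G) (regular f)"
proof (rule l2_op_eqI)
  show "left_regular G c f \<in> extensional (l2_space (carrier G))"
    by (simp add: left_regular_def)
  fix \<xi> :: "'g ell2" assume \<xi>: "proj (carrier G) \<xi> = \<xi>"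
  then have "coord \<xi> \<in> l2_space (carrier G)"
    by (simp add: l2_space_eq)
  moreover have "{g. f g \<noteq> 0} \<subseteq> carrier G"
    using f by (simp add: finsupp_def)
  ultimately show "left_regular G c f (coord \<xi>) = conc (carrier G) (regular f) (coord \<xi>)"
    unfolding conc_coord[OF \<xi>] left_regular_def regular_def app_sum_left
    by (auto simp: fun_eq_iff coord_delta subset_iff mult.assoc intro!: sum.cong)
qed simp

lemma delta_op_eq: "g \<in> carrier G \<Longrightarrow> delta_op G c g = conc (carrier G) (delta g)"
  by (simp add: delta_op_def left_regular_eq point_mass_finsupp regular_point_mass)

lemma regular_corner: "X \<subseteq> carrier G \<Longrightarrow> regular ` finsupp X \<subseteq> corner (carrier G)"
  using alg_corner alg_mono regular_alg by blast

lemma reduced_set_eq: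
  assumes X: "X \<subseteq> carrier G"
  shows "reduced_set G c X = conc (carrier G) ` alg X"
proof -
  have "left_regular G c ` finsupp X = conc (carrier G) ` regular ` finsupp X"
    unfolding image_image by (rule image_cong[OF refl]) (use X in \<open>auto simp: finsupp_def intro!: left_regular_eq\<close>)
  moreover have "l2_operators (carrier G) =
      (l2_operators (carrier G))\<lparr>carrier := conc (carrier G) ` corner (carrier G)\<rparr>"
    by (simp add: l2_operators_def bounded_ops_eq)
  then have "norm_closure (l2_operators (carrier G)) (conc (carrier G) ` regular ` finsupp X) =
      conc (carrier G) ` (corner (carrier G) \<inter> closure (regular ` finsupp X))"
    by (intro norm_closure_conc regular_corner X) auto
  moreover have "corner (carrier G) \<inter> closure (regular ` finsupp X) = alg X"
    using alg_corner alg_mono[OF X] by (auto simp: alg_def)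
  ultimately show ?thesis
    by (simp add: reduced_set_def)
qed

subsection \<open>Matrix coefficients\<close>

text \<open>For \<open>delta g\<close> both sides equal \<open>c g h\<close> at
  \<open>k = g \<otimes> h\<close> and 0 elsewhere, and both are linear and continuous in
  \<open>a\<close>. The matrix of \<open>a\<close> over the group is therefore read off from its
  column at \<one>.\<close>

lemma alg_coefficient:
  assumes "a \<in> alg (carrier G)" and h: "h \<in> carrier G" and k: "k \<in> carrier G"
  shows "coord (app a (basis h)) k = c (k \<otimes> inv h) h * coord (app a (basis \<one>)) (k \<otimes> inv h)"
  using assms(1)
proof (induction rule: alg_induct)
  case closed
  show ?case
    by (intro closed_Collect_eq continuous_intros)
next
  case (delta g)
  have "k = g \<otimes> h \<longleftrightarrow> k \<otimes> inv h = g"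
    using delta h k inv_cancel(3,4) by metis
  then show ?case
    using delta h k by (auto simp: delta_basis coord_basis)
qed (simp_all add: algebra_simps)

lemma alg_separating:
  assumes a: "a \<in> alg (carrier G)" and 0: "\<And>g. g \<in> carrier G \<Longrightarrow> coord (app a (basis \<one>)) g = 0"
  shows "a = 0"
proof (rule oper_eq_basisI)
  fix h
  have "a \<in> corner (carrier G)"
    using a alg_corner by blast
  note co = corner_app[OF this]
  show "app a (basis h) = app 0 (basis h)"
  proof (cases "h \<in> carrier G")
    case True
    have "coord (app a (basis h)) k = 0" for k
    proof (cases "k \<in> carrier G")
      case True
      then show ?thesis
        using alg_coefficient[OF a \<open>h \<in> carrier G\<close>] 0 \<open>h \<in> carrier G\<close> by simp
    qed (metis co(1) coord_proj)
    then show ?thesis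
      by (auto intro!: ell2_eqI)
  next
    case False
    then have "proj (carrier G) (basis h) = 0"
      by (auto intro!: ell2_eqI simp: coord_basis)
    then show ?thesis
      using co(2)[of "basis h"] by simp
  qed
qed

end

subsection \<open>The conditional expectation onto the algebra of a subgroup\<close>

locale twisted_subgroup = twisted_group G c + subgroup S G
  for G :: "('g, 'm) monoid_scheme" (structure) and c and S
begin

lemma S_carrier [simp]: "s \<in> S \<Longrightarrow> s \<in> carrier G"
  by (rule mem_carrier)

lemma subgroup_S: "subgroup S G"
  by (rule subgroup_axioms)

lemma alg_S_alg [simp]: "b \<in> alg S \<Longrightarrow> b \<in> alg (carrier G)"
  using alg_mono[OF subset] by blast

lemmas alg_S_mult [simp] = alg_mult[OF subgroup_S]
lemmas alg_S_adj [simp] = alg_adj[OF subgroup_S]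
lemmas alg_G_mult [simp] = alg_mult[OF subgroup_self]
lemmas alg_G_adj [simp] = alg_adj[OF subgroup_self]

lemma coset_eq_iff:
  assumes a: "a \<in> carrier G" and b: "b \<in> carrier G"
  shows "S #> a = S #> b \<longleftrightarrow> a \<otimes> inv b \<in> S"
proof
  assume "S #> a = S #> b"
  then have "a \<in> S #> b"
    using rcos_self[OF a subgroup_S] by simp
  then obtain s where "s \<in> S" "a = s \<otimes> b"
    by (auto simp: r_coset_def)
  then show "a \<otimes> inv b \<in> S"
    using b by simp
next
  assume "a \<otimes> inv b \<in> S"
  then have "a \<in> S #> b"
    unfolding r_coset_def using a b by (auto intro!: bexI[of _ "a \<otimes> inv b"])
  then show "S #> a = S #> b"
    using repr_independence[OF _ b subgroup_S] by simp
qed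

definition expect :: "'g oper \<Rightarrow> 'g oper" where
  "expect = compression (\<lambda>k. S #> k)"

lemma expect_simps [simp]:
  "expect (T + U) = expect T + expect U" "expect (T - U) = expect T - expect U"
  "expect (z \<star> T) = z \<star> expect T" "expect (r *\<^sub>R T) = r *\<^sub>R expect T" "expect 0 = 0"
  by (simp_all add: expect_def)

lemma norm_expect_le: "norm (expect T) \<le> norm T"
  unfolding expect_def by (rule norm_compression_le)

lemma bounded_linear_expect: "bounded_linear expect"
  unfolding expect_def by (rule bounded_linear_compression)

lemmas continuous_on_expect [continuous_intros] = bounded_linear.continuous_on[OF bounded_linear_expect]

text \<open>Left translation by \<open>g\<close> maps the right coset of \<open>k\<close> to itself
  if \<open>g\<close> lies in \<open>S\<close>, and to a disjoint coset piece otherwise. So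
  \<open>delta g\<close> is block-diagonal or has no diagonal block at all.\<close>

lemma expect_delta:
  assumes g: "g \<in> carrier G"
  shows "expect (delta g) = (if g \<in> S then delta g else 0)"
proof (intro oper_eqI ell2_eqI)
  fix \<xi> k
  have "S #> (inv g \<otimes> k) = S #> k \<longleftrightarrow> g \<in> S" if "k \<in> carrier G"
  proof -
    have "inv g \<otimes> k \<otimes> inv k = inv g"
      using g that by (simp add: m_assoc)
    moreover have "inv g \<in> S \<longleftrightarrow> g \<in> S"
      using g m_inv_closed[of g] m_inv_closed[of "inv g"] by auto
    ultimately show ?thesis
      using g that by (simp add: coset_eq_iff)
  qed
  then show "coord (app (expect (delta g)) \<xi>) k = coord (app (if g \<in> S then delta g else 0) \<xi>) k"
    using g by (auto simp: expect_def coord_compression coord_delta)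
qed

lemma expect_alg [simp]: "a \<in> alg (carrier G) \<Longrightarrow> expect a \<in> alg S"
proof (induction rule: alg_induct)
  case closed
  show ?case
    by (intro closed_Collect_mem closed_alg continuous_intros)
qed (simp_all add: expect_delta)

lemma expect_id [simp]: "b \<in> alg S \<Longrightarrow> expect b = b"
proof (induction rule: alg_induct)
  case closed
  show ?case
    by (intro closed_Collect_eq continuous_intros)
qed (simp_all add: expect_delta)

lemma expect_mult_left:
  assumes "b \<in> alg S" and a: "a \<in> alg (carrier G)"
  shows "expect (b * a) = b * expect a"
  using assms(1)
proof (induction rule: alg_induct)
  case closed
  show ?case
    by (intro closed_Collect_eq continuous_intros)
next
  case (delta s)
  show ?case
    using a
  proof (induction rule: alg_induct)
    case closed
    show ?case
      by (intro closed_Collect_eq continuous_intros)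
  next
    case (delta g)
    have "s \<otimes> g \<in> S \<longleftrightarrow> g \<in> S"
      using \<open>s \<in> S\<close> delta by (metis S_carrier inv_cancel(1) m_closed m_inv_closed)
    then show ?case
      using \<open>s \<in> S\<close> delta by (simp add: delta_mult expect_delta)
  qed (simp_all add: distrib_left)
qed (simp_all add: distrib_right)

lemma expect_adj: "a \<in> alg (carrier G) \<Longrightarrow> expect (adj a) = adj (expect a)"
proof (induction rule: alg_induct)
  case closed
  show ?case
    by (intro closed_Collect_eq continuous_intros)
next
  case (delta g)
  then have "inv g \<in> S \<longleftrightarrow> g \<in> S"
    by (metis inv_inv m_inv_closed)
  then show ?case
    using delta by (simp add: adj_delta expect_delta)
qed simp_all

lemma expect_mult_right:
  assumes b: "b \<in> alg S" and a: "a \<in> alg (carrier G)"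
  shows "expect (a * b) = expect a * b"
  using expect_mult_left[of "adj b" "adj a"] expect_adj[of "adj b * adj a"] a b
  by (simp add: expect_adj)

lemma delta_one_alg [simp]: "delta \<one> \<in> alg S"
  by simp

text \<open>The diagonal entry of \<open>expect (adj a * a)\<close> at \<one> is the squared norm of
  \<open>app a (basis \<one>)\<close>, and this column determines \<open>a\<close>.\<close>

lemma expect_faithful:
  assumes a: "a \<in> alg (carrier G)" and 0: "expect (adj a * a) = 0"
  shows "a = 0"
proof (rule alg_separating[OF a])
  have proj: "proj {j. S #> j = S #> \<one>} (basis \<one>) = basis \<one>"
    by (auto intro!: ell2_eqI simp: coord_basis)
  have "0 = coord (app (expect (adj a * a)) (basis \<one>)) \<one>"
    by (simp add: 0)
  also have "\<dots> = coord (app (adj a * a) (basis \<one>)) \<one>"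
    by (simp only: expect_def coord_compression proj)
  finally have "Re (coord (app (adj a * a) (basis \<one>)) \<one>) = 0"
    by simp
  then have "inner (basis \<one>) (app (adj a) (app a (basis \<one>))) = 0"
    by (simp add: coord_eq_inner inner_commute)
  then have "app a (basis \<one>) = 0"
    by (simp flip: inner_adj)
  then show "coord (app a (basis \<one>)) g = 0" for g
    by simp
qed

text \<open>After scaling \<open>a\<close> to norm 1, the complement of
  \<open>expect (adj a1 * a1)\<close> in the unit is a selfadjoint contraction \<open>X\<close> in
  \<open>alg S\<close>. The iteration gives \<open>Y\<close> with
  \<open>2 *\<^sub>R Y = X + Y * Y\<close>, which says that the square of
  \<open>delta \<one> - Y\<close> is \<open>delta \<one> - X\<close>.\<close>

lemma expect_positive:
  assumes a: "a \<in> alg (carrier G)"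
  obtains d where "d \<in> alg S" "adj d = d" "expect (adj a * a) = d * d"
proof (cases "a = 0")
  case True
  then show ?thesis
    using that[of 0] by simp
next
  case False
  define r where "r = norm a"
  define a1 where "a1 = (1 / r) *\<^sub>R a"
  have r: "r > 0"
    using False by (simp add: r_def)
  have a1: "a1 \<in> alg (carrier G)" "norm a1 \<le> 1" "a = r *\<^sub>R a1"
    using a r by (auto simp: a1_def r_def)
  define X where "X = expect (delta \<one> - adj a1 * a1)"
  have X_alg: "X \<in> alg S"
    using a1 by (simp add: X_def)
  have "adj (delta \<one>) = delta \<one>"
    by (simp add: delta_one)
  then have X_adj: "adj X = X"
    using a1 by (simp add: X_def flip: expect_adj)
  have "norm (delta \<one> - adj a1 * a1) \<le> 1"
  proof (rule norm_oper_leI)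
    fix \<xi>
    have "adj a1 * a1 \<in> corner (carrier G)"
      using a1 alg_corner by auto
    \<comment> \<open>The contraction bound concerns the identity of the ambient space, whereas
      \<open>delta \<one>\<close> is a projection; on projected vectors the two agree.\<close>
    then have "app (delta \<one> - adj a1 * a1) \<xi> =
        proj (carrier G) \<xi> - app (adj a1 * a1) (proj (carrier G) \<xi>)"
      by (simp only: corner_app(2)) (simp add: delta_one)
    also have "norm \<dots> \<le> norm (proj (carrier G) \<xi>)"
      using a1(2) by (rule norm_id_minus_adj_mult_le)
    also have "\<dots> \<le> norm \<xi>"
      by (rule norm_proj_le)
    finally show "norm (app (delta \<one> - adj a1 * a1) \<xi>) \<le> 1 * norm \<xi>"
      by simp
  qed simp
  then have "norm X \<le> 1"
    using norm_expect_le order.trans unfolding X_def by blast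
  then obtain Y where Y: "Y \<in> alg S \<inter> {Y. adj Y = Y}" "2 *\<^sub>R Y = X + Y * Y"
  proof (rule square_root_iteration)
    show "closed (alg S \<inter> {Y. adj Y = Y})"
      by (intro closed_Int closed_alg closed_Collect_eq continuous_intros)
  qed (use X_alg X_adj in auto)
  define d where "d = r *\<^sub>R (delta \<one> - Y)"
  have "(delta \<one> - Y) * (delta \<one> - Y) = delta \<one> - (2 *\<^sub>R Y - Y * Y)"
    using Y(1) by (simp add: algebra_simps scaleR_2)
  also have "\<dots> = expect (adj a1 * a1)"
    using a1 by (simp add: Y(2) X_def)
  finally have "d * d = expect (adj a * a)"
    by (simp add: d_def a1(3))
  moreover have "d \<in> alg S" "adj d = d"
    using Y(1) \<open>adj (delta \<one>) = delta \<one>\<close> by (simp_all add: d_def)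
  ultimately show ?thesis
    using that by metis
qed

end

subsection \<open>Commutants\<close>

context twisted_group
begin

text \<open>For elements of the group this says exactly that \<open>delta g\<close> and
  \<open>delta h\<close> commute.\<close>

definition delta_commute :: "'g \<Rightarrow> 'g \<Rightarrow> bool" where
  "delta_commute g h \<longleftrightarrow> g \<otimes> h = h \<otimes> g \<and> c g h = c h g"

lemma delta_commute_sym: "delta_commute g h \<longleftrightarrow> delta_commute h g"
  by (auto simp: delta_commute_def)

text \<open>Compatibility with products compares the cocycle identity for the triples with
  \<open>g\<close> in the first, middle and last place; the remaining factor \<open>c h k\<close>
  cancels since values of \<open>c\<close> are nonzero.\<close>

lemma subgroup_delta_commute:
  assumes g: "g \<in> carrier G"
  shows "subgroup {h \<in> carrier G. delta_commute g h} G"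
proof
  show "\<one> \<in> {h \<in> carrier G. delta_commute g h}"
    using g by (simp add: delta_commute_def)
next
  fix h k assume "h \<in> {h \<in> carrier G. delta_commute g h}" "k \<in> {h \<in> carrier G. delta_commute g h}"
  then have h: "h \<in> carrier G" "g \<otimes> h = h \<otimes> g" "c g h = c h g"
    and k: "k \<in> carrier G" "g \<otimes> k = k \<otimes> g" "c g k = c k g"
    by (auto simp: delta_commute_def)
  have "g \<otimes> (h \<otimes> k) = h \<otimes> k \<otimes> g"
    using g h k by (metis m_assoc)
  moreover have "c g (h \<otimes> k) * c h k = c (h \<otimes> k) g * c h k"
    using c_assoc[OF g h(1) k(1)] c_assoc[OF h(1) g k(1)] c_assoc[OF h(1) k(1) g] h k
    by (simp add: mult.commute)
  ultimately show "h \<otimes> k \<in> {h \<in> carrier G. delta_commute g h}"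
    using h k by (simp add: delta_commute_def)
next
  fix h assume "h \<in> {h \<in> carrier G. delta_commute g h}"
  then have h: "h \<in> carrier G" "g \<otimes> h = h \<otimes> g" "c g h = c h g"
    by (auto simp: delta_commute_def)
  have comm: "g \<otimes> inv h = inv h \<otimes> g"
    using g h(1,2) by (metis inv_cancel(1,3) inv_closed m_assoc m_closed)
  have "c (g \<otimes> inv h) h * c g (inv h) = c (g \<otimes> inv h) h * c (inv h) g"
    using c_assoc[of g "inv h" h] c_assoc[of "inv h" g h] c_assoc[of "inv h" h g] g h comm
    by (simp add: mult.commute)
  then show "inv h \<in> {h \<in> carrier G. delta_commute g h}"
    using g h(1) comm by (simp add: delta_commute_def)
qed auto

text \<open>The subgroup generated by \<open>g\<close> and \<open>S\<close> is abelian with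
  \<open>c\<close> symmetric on it: commutation extends from the generators in one argument and
  then, by symmetry, in the other. Maximality makes this subgroup equal to \<open>S\<close>.\<close>

lemma maximal_abelian_symmetric_commutant:
  assumes max: "maximal_abelian_symmetric G c S" and g: "g \<in> carrier G"
    and comm: "\<And>s. s \<in> S \<Longrightarrow> delta_commute g s"
  shows "g \<in> S"
proof -
  define A where "A = insert g S"
  define H where "H = generate G A"
  have S: "subgroup S G" "\<And>s t. s \<in> S \<Longrightarrow> t \<in> S \<Longrightarrow> delta_commute s t"
    using max by (auto simp: maximal_abelian_symmetric_def abelian_symmetric_def delta_commute_def)
  have A: "A \<subseteq> carrier G"
    using g S(1) by (auto simp: A_def subgroup.mem_carrier)
  have AA: "delta_commute a b" if "a \<in> A" "b \<in> A" for a b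
    using that comm S(2) delta_commute_sym by (auto simp: A_def delta_commute_def)
  have AH: "delta_commute a h" if "a \<in> A" "h \<in> H" for a h
  proof -
    have "H \<subseteq> {h \<in> carrier G. delta_commute a h}"
      unfolding H_def by (rule generate_subgroup_incl[OF _ subgroup_delta_commute]) (use that A AA in auto)
    then show ?thesis
      using that by blast
  qed
  have HG: "H \<subseteq> carrier G"
    unfolding H_def using A by (rule generate_incl)
  have HH: "delta_commute h k" if "h \<in> H" "k \<in> H" for h k
  proof -
    have "H \<subseteq> {k \<in> carrier G. delta_commute h k}"
      unfolding H_def
      by (rule generate_subgroup_incl[OF _ subgroup_delta_commute]) (use that A AH HG delta_commute_sym in auto)
    then show ?thesis
      using that by blast
  qed
  have "abelian_symmetric G c H"
    unfolding abelian_symmetric_def using HH generate_is_subgroup[OF A]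
    by (auto simp: H_def delta_commute_def)
  moreover have "A \<subseteq> H"
    unfolding H_def by (auto intro: generate.incl)
  ultimately have "H = S"
    using max by (auto simp: maximal_abelian_symmetric_def A_def)
  then show ?thesis
    using \<open>A \<subseteq> H\<close> by (auto simp: A_def)
qed

end

section \<open>Elements with finitely many conjugates and the relative commutant\<close>

lemma (in group) conj_pow_commute:
  assumes s: "s \<in> carrier G" and g: "g \<in> carrier G" and ij: "i < j"
    and eq: "s [^] (i::nat) \<otimes> g \<otimes> inv (s [^] i) = s [^] (j::nat) \<otimes> g \<otimes> inv (s [^] j)"
  shows "g \<otimes> s [^] (j - i) = s [^] (j - i) \<otimes> g"
proof -
  define a b where "a = s [^] i" and "b = s [^] (j - i)"
  have ab: "a \<in> carrier G" "b \<in> carrier G" "s [^] j = a \<otimes> b"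
    using s ij by (simp_all add: a_def b_def nat_pow_mult)
  have "a \<otimes> g \<otimes> inv a = a \<otimes> b \<otimes> g \<otimes> (inv b \<otimes> inv a)"
    using eq ab by (simp add: a_def[symmetric] inv_mult_group)
  then have "a \<otimes> g \<otimes> inv a \<otimes> a = a \<otimes> b \<otimes> g \<otimes> (inv b \<otimes> inv a) \<otimes> a"
    by simp
  then have "a \<otimes> g = a \<otimes> (b \<otimes> g \<otimes> inv b)"
    using ab g by (simp add: m_assoc)
  then have "g = b \<otimes> g \<otimes> inv b"
    using ab g by simp
  then have "g \<otimes> b = b \<otimes> g \<otimes> inv b \<otimes> b"
    by simp
  then show ?thesis
    using ab g by (simp add: m_assoc b_def)
qed

context twisted_subgroup
begin

text \<open>Both products are applied to \<open>basis \<one>\<close> and compared at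
  \<open>s \<otimes> g\<close>; on the right the column of \<open>a\<close> at \<open>s\<close> is
  rewritten by \<open>alg_coefficient\<close>.\<close>

lemma commutant_coefficient:
  assumes a: "a \<in> alg (carrier G)" and s: "s \<in> S" and comm: "delta s * a = a * delta s"
    and g: "g \<in> carrier G"
  shows "c s g * coord (app a (basis \<one>)) g =
    c (s \<otimes> g \<otimes> inv s) s * coord (app a (basis \<one>)) (s \<otimes> g \<otimes> inv s)"
proof -
  have "coord (app (delta s * a) (basis \<one>)) (s \<otimes> g) = coord (app (a * delta s) (basis \<one>)) (s \<otimes> g)"
    by (simp only: comm)
  then show ?thesis
    using s g alg_coefficient[OF a, of s "s \<otimes> g"] by (simp add: coord_delta delta_basis)
qed

lemma commutant_alg:
  assumes max: "maximal_abelian_symmetric G c S" and imm: "immediately_centralizing G S"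
    and a: "a \<in> alg (carrier G)" and comm: "\<And>s. s \<in> S \<Longrightarrow> delta s * a = a * delta s"
  shows "a \<in> alg S"
proof -
  define f where "f = coord (app a (basis \<one>))"
  have coeff: "c s g * f g = c (s \<otimes> g \<otimes> inv s) s * f (s \<otimes> g \<otimes> inv s)" if "s \<in> S" "g \<in> carrier G" for s g
    unfolding f_def by (rule commutant_coefficient[OF a that(1) comm[OF that(1)] that(2)])
  have cmod_f: "cmod (f (s \<otimes> g \<otimes> inv s)) = cmod (f g)" if "s \<in> S" "g \<in> carrier G" for s g
  proof -
    have "cmod (c s g * f g) = cmod (c (s \<otimes> g \<otimes> inv s) s * f (s \<otimes> g \<otimes> inv s))"
      by (simp only: coeff[OF that])
    then show ?thesis
      using that by (simp add: norm_mult)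
  qed
  have supp: "g \<in> S" if g: "g \<in> carrier G" and fg: "f g \<noteq> 0" for g
  proof -
    define C where "C = {h. cmod (f h) = cmod (f g)}"
    have "finite C"
    proof (rule ccontr)
      assume "infinite C"
      \<comment> \<open>More entries of modulus \<open>cmod (f g)\<close> than the squared norm of
        the column permits.\<close>
      define n where "n = Suc (nat \<lceil>(norm (app a (basis \<one>)))\<^sup>2 / (cmod (f g))\<^sup>2\<rceil>)"
      obtain F where F: "finite F" "F \<subseteq> C" "card F = n"
        using infinite_arbitrarily_large[OF \<open>infinite C\<close>] by blast
      have "real n * (cmod (f g))\<^sup>2 = (\<Sum>k\<in>F. (cmod (f k))\<^sup>2)"
        using F by (simp add: C_def subset_iff)
      also have "\<dots> \<le> (norm (app a (basis \<one>)))\<^sup>2"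
        unfolding f_def using F(1) by (rule sum_coord_le)
      finally have "real n \<le> (norm (app a (basis \<one>)))\<^sup>2 / (cmod (f g))\<^sup>2"
        using fg by (simp add: pos_le_divide_eq)
      then show False
        unfolding n_def by linarith
    qed
    \<comment> \<open>Pigeonhole among the conjugates of \<open>g\<close> by the powers of
      \<open>t\<close> with exponents 0 to \<open>card C\<close>, all of which lie in
      \<open>C\<close>. The bound depends on \<open>g\<close> only, as one \<open>m\<close> must
      serve every \<open>t\<close>.\<close>
    define m where "m = Suc (card C)"
    have "k_centralizing G S m g"
      unfolding k_centralizing_def
    proof (intro conjI ballI g)
      fix t assume t: "t \<in> S"
      have tp: "t [^] i \<in> S" for i :: nat
        using t by (induction i) auto
      define \<psi> where "\<psi> i = t [^] i \<otimes> g \<otimes> inv (t [^] i)" for i :: nat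
      have "\<psi> ` {0..card C} \<subseteq> C"
        using cmod_f[OF tp g] by (auto simp: \<psi>_def C_def)
      then have "\<not> inj_on \<psi> {0..card C}"
        using card_inj_on_le[OF _ _ \<open>finite C\<close>, of \<psi> "{0..card C}"] by auto
      then obtain i j where "i \<in> {0..card C}" "j \<in> {0..card C}" "i < j" "\<psi> i = \<psi> j"
        unfolding inj_on_def by (metis linorder_neqE_nat)
      then show "\<exists>j\<in>{1..m}. g \<otimes> t [^] j = t [^] j \<otimes> g"
        using conj_pow_commute[of t g i j] t g
        by (intro bexI[of _ "j - i"]) (auto simp: \<psi>_def m_def)
    qed
    then have "k_centralizing G S 1 g"
      using imm unfolding immediately_centralizing_def m_def by (metis Suc_eq_plus1_left le_add1)
    then have gs: "g \<otimes> s = s \<otimes> g" if "s \<in> S" for s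
      using that by (force simp: k_centralizing_def)
    show ?thesis
    proof (rule maximal_abelian_symmetric_commutant[OF max g])
      fix s assume s: "s \<in> S"
      \<comment> \<open>When \<open>s\<close> fixes \<open>g\<close> the coefficient identity reads
        \<open>c s g * f g = c g s * f g\<close>, and \<open>f g\<close> cancels.\<close>
      then have "s \<otimes> g \<otimes> inv s = g"
        using g gs[OF s] by (metis S_carrier inv_cancel(3))
      then show "delta_commute g s"
        using coeff[OF s g] fg gs[OF s] by (simp add: delta_commute_def)
    qed
  qed
  have "expect a = a"
  proof (rule oper_eq_basisI)
    fix h
    have "a \<in> corner (carrier G)"
      using a alg_corner by blast
    note co = corner_app[OF this]
    show "app (expect a) (basis h) = app a (basis h)"
    proof (rule ell2_eqI)
      fix k
      \<comment> \<open>Entries between different cosets are governed by the value of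
        \<open>f\<close> at \<open>k \<otimes> inv h\<close>, which lies outside
        \<open>S\<close>.\<close>
      have "coord (app a (basis h)) k = 0" if ne: "S #> h \<noteq> S #> k"
      proof (cases "h \<in> carrier G \<and> k \<in> carrier G")
        case True
        then have "S #> k \<noteq> S #> h" "k \<otimes> inv h \<in> carrier G"
          using ne by auto
        then have "f (k \<otimes> inv h) = 0"
          using supp True coset_eq_iff by blast
        then show ?thesis
          using alg_coefficient[OF a, of h k] True by (simp add: f_def)
      next
        case False
        show ?thesis
        proof (cases "k \<in> carrier G")
          case True
          with False have "proj (carrier G) (basis h) = 0"
            by (auto intro!: ell2_eqI simp: coord_basis)
          then show ?thesis
            using co(2)[of "basis h"] by simp
        next
          case False
          then show ?thesis
            using co(1)[of "basis h"] by (metis coord_proj)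
        qed
      qed
      moreover have "proj {j. S #> j = S #> k} (basis h) = (if S #> h = S #> k then basis h else 0)"
        by (rule ell2_eqI) (simp add: coord_basis)
      ultimately show "coord (app (expect a) (basis h)) k = coord (app a (basis h)) k"
        by (simp add: expect_def coord_compression)
    qed
  qed
  then show ?thesis
    using expect_alg[OF a] by simp
qed

end

section \<open>Characters of discrete abelian groups\<close>

context group
begin

text \<open>Graphs instead of functions, so that unions of chains need no gluing.\<close>

definition partial_character :: "'a set \<Rightarrow> ('a \<times> complex) set \<Rightarrow> bool" where
  "partial_character S R \<longleftrightarrow> R \<subseteq> S \<times> {z. cmod z = 1} \<and> (\<one>, 1) \<in> R \<and>
    (\<forall>s z t w. (s, z) \<in> R \<longrightarrow> (t, w) \<in> R \<longrightarrow> (s \<otimes> t, z * w) \<in> R) \<and>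
    (\<forall>s z. (s, z) \<in> R \<longrightarrow> (inv s, inverse z) \<in> R) \<and> (\<forall>z. (\<one>, z) \<in> R \<longrightarrow> z = 1)"

lemma partial_characterD:
  assumes "partial_character S R"
  shows "(s, z) \<in> R \<Longrightarrow> s \<in> S" "(s, z) \<in> R \<Longrightarrow> cmod z = 1" "(\<one>, 1) \<in> R"
    "(s, z) \<in> R \<Longrightarrow> (t, w) \<in> R \<Longrightarrow> (s \<otimes> t, z * w) \<in> R" "(s, z) \<in> R \<Longrightarrow> (inv s, inverse z) \<in> R"
    "(\<one>, z) \<in> R \<Longrightarrow> z = 1"
  using assms unfolding partial_character_def by auto

lemma partial_character_power:
  assumes R: "partial_character S R" and S: "subgroup S G" and s: "(s, z) \<in> R"
  shows "(s [^] (k :: int), z powi k) \<in> R"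
proof -
  have z: "z \<noteq> 0"
    using partial_characterD(2)[OF R s] by auto
  have sG: "s \<in> carrier G"
    using partial_characterD(1)[OF R s] subgroup.mem_carrier[OF S] by blast
  have nat: "(s [^] n, z ^ n) \<in> R" for n :: nat
    by (induction n) (use partial_characterD(3,4)[OF R] s in \<open>auto simp: power_Suc2 simp del: power_Suc\<close>)
  show ?thesis
  proof (cases k rule: int_cases2)
    case (nonneg n)
    then show ?thesis
      using nat[of n] by (simp add: int_pow_int)
  next
    case (nonpos n)
    then show ?thesis
      using partial_characterD(5)[OF R nat[of n]] sG by (simp add: int_pow_int int_pow_neg power_int_minus)
  qed
qed

text \<open>Uniqueness of values is encoded in the last clause of \<open>partial_character\<close>:
  if \<open>s \<otimes> t [^] k = \<one>\<close>, then \<open>s\<close> is the power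
  \<open>t [^] (- k)\<close> in the old domain, and \<open>compat\<close> fixes its value as
  \<open>w powi (- k)\<close>.\<close>

lemma partial_character_adjoin:
  assumes R: "partial_character S R" and S: "subgroup S G"
    and comm: "\<And>s t. s \<in> S \<Longrightarrow> t \<in> S \<Longrightarrow> s \<otimes> t = t \<otimes> s"
    and t: "t \<in> S" and w: "cmod w = 1" and compat: "\<And>(k::int) z. (t [^] k, z) \<in> R \<Longrightarrow> z = w powi k"
  shows "partial_character S {(s \<otimes> t [^] (k :: int), z * w powi k) | s z k. (s, z) \<in> R}"
    (is "partial_character S ?R")
proof -
  note RD = partial_characterD[OF R]
  have w0: "w \<noteq> 0"
    using w by auto
  have tG: "t \<in> carrier G" and SG: "s \<in> S \<Longrightarrow> s \<in> carrier G" for s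
    using t subgroup.mem_carrier[OF S] by auto
  have tk: "t [^] k \<in> S" for k :: int
    using t by (intro subgroup_int_pow_closed[OF S])
  have "?R \<subseteq> S \<times> {z. cmod z = 1}"
    using RD(1,2) tk w subgroup.m_closed[OF S] by (auto simp: norm_mult norm_power_int)
  moreover have "(\<one>, 1) \<in> ?R"
    using RD(3) by (intro CollectI exI[of _ \<one>] exI[of _ 1] exI[of _ "0::int"]) simp
  moreover have "(a \<otimes> b, z * y) \<in> ?R" if ab: "(a, z) \<in> ?R" "(b, y) \<in> ?R" for a b z y
  proof -
    obtain s z1 k where 1: "a = s \<otimes> t [^] (k::int)" "z = z1 * w powi k" "(s, z1) \<in> R"
      using ab(1) by auto
    obtain s' z2 k' where 2: "b = s' \<otimes> t [^] (k'::int)" "y = z2 * w powi k'" "(s', z2) \<in> R"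
      using ab(2) by auto
    have s: "s \<in> carrier G" "s' \<in> carrier G" "s' \<in> S"
      using 1 2 RD(1) SG by auto
    have "a \<otimes> b = s \<otimes> (t [^] k \<otimes> s') \<otimes> t [^] k'"
      using s tG by (simp add: 1 2 m_assoc)
    also have "t [^] k \<otimes> s' = s' \<otimes> t [^] k"
      using comm[OF tk s(3)] .
    also have "s \<otimes> (s' \<otimes> t [^] k) \<otimes> t [^] k' = s \<otimes> s' \<otimes> t [^] (k + k')"
      using s tG by (simp add: m_assoc int_pow_mult)
    finally have "(a \<otimes> b, z * y) = (s \<otimes> s' \<otimes> t [^] (k + k'), (z1 * z2) * w powi (k + k'))"
      using w0 by (simp add: 1 2 power_int_add)
    then show ?thesis
      using RD(4)[OF 1(3) 2(3)] by blast
  qed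
  moreover have "(inv a, inverse z) \<in> ?R" if a: "(a, z) \<in> ?R" for a z
  proof -
    obtain s z1 k where 1: "a = s \<otimes> t [^] (k::int)" "z = z1 * w powi k" "(s, z1) \<in> R"
      using a by auto
    have s: "s \<in> carrier G" "inv s \<in> S"
      using 1 RD(1) RD(5)[OF 1(3)] SG by auto
    have "inv a = t [^] (- k) \<otimes> inv s"
      using s tG by (simp add: 1 inv_mult_group int_pow_neg)
    also have "\<dots> = inv s \<otimes> t [^] (- k)"
      using comm[OF tk s(2)] .
    finally have "(inv a, inverse z) = (inv s \<otimes> t [^] (- k), inverse z1 * w powi (- k))"
      using w0 by (simp add: 1 power_int_minus)
    then show ?thesis
      using RD(5)[OF 1(3)] by blast
  qed
  moreover have "z = 1" if a: "(\<one>, z) \<in> ?R" for z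
  proof -
    obtain s z1 k where 1: "\<one> = s \<otimes> t [^] (k::int)" "z = z1 * w powi k" "(s, z1) \<in> R"
      using a by auto
    then have "s = t [^] (- k)"
      using RD(1) SG tG by (metis int_pow_closed int_pow_neg inv_equality inv_inv)
    then have "z1 = w powi (- k)"
      using compat 1(3) by blast
    then show ?thesis
      using w0 by (simp add: 1 power_int_minus)
  qed
  ultimately show ?thesis
    unfolding partial_character_def by blast
qed

text \<open>The circle is divisible. If some positive power of \<open>t\<close> has a value,
  \<open>w\<close> is a root of the value at the least such power; otherwise only the exponent 0 is
  constrained and \<open>w = 1\<close> will do.\<close>

lemma partial_character_compatible:
  assumes R: "partial_character S R" and S: "subgroup S G" and t: "t \<in> S"
  obtains w where "cmod w = 1" "\<And>(k::int) z. (t [^] k, z) \<in> R \<Longrightarrow> z = w powi k"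
proof -
  note RD = partial_characterD[OF R]
  have tG: "t \<in> carrier G"
    using t subgroup.mem_carrier[OF S] by auto
  define P where "P n \<longleftrightarrow> n > 0 \<and> (\<exists>z. (t [^] n, z) \<in> R)" for n :: nat
  have pos: "\<exists>n. P n" if "(t [^] k, z) \<in> R" "k \<noteq> 0" for k :: int and z
  proof (cases k rule: int_cases2)
    case (nonneg n)
    then have "P n"
      using that by (auto simp: P_def int_pow_int)
    then show ?thesis ..
  next
    case (nonpos n)
    have "(t [^] (- k), inverse z) \<in> R"
      using RD(5)[OF that(1)] tG by (simp add: int_pow_neg)
    then have "P n"
      using nonpos that(2) by (auto simp: P_def int_pow_int)
    then show ?thesis ..
  qed
  show ?thesis
  proof (cases "\<exists>n. P n")
    case False
    have "z = 1 powi k" if "(t [^] k, z) \<in> R" for k :: int and z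
      using pos[OF that] False that RD(6) by (cases "k = 0") auto
    then show ?thesis
      using that[of 1] by simp
  next
    case True
    define n where "n = (LEAST n. P n)"
    have "P n"
      unfolding n_def using True by (rule LeastI_ex)
    then obtain z0 where n: "n > 0" and z0: "(t [^] n, z0) \<in> R"
      by (auto simp: P_def)
    have "cmod z0 = 1"
      using RD(2)[OF z0] .
    then have "z0 \<noteq> 0" "sgn z0 = z0"
      by (auto simp: sgn_eq)
    then obtain \<theta> where \<theta>: "z0 = cis \<theta>"
      using cis_Arg by metis
    define w where "w = cis (\<theta> / n)"
    have w: "cmod w = 1" "w ^ n = z0"
      using n by (simp_all add: w_def \<theta> Complex.DeMoivre)
    have "z = w powi k" if k: "(t [^] k, z) \<in> R" for k :: int and z
    proof -
      \<comment> \<open>Division with remainder by the least exponent \<open>n\<close>: the power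
        \<open>t [^] r\<close> again has a value, so minimality forces \<open>r = 0\<close>.\<close>
      define q r where "q = k div int n" and "r = k mod int n"
      have kqr: "k = int n * q + r" and r: "0 \<le> r" "r < int n"
        using n by (simp_all add: q_def r_def)
      have "(t [^] k \<otimes> (t [^] n) [^] (- q), z * z0 powi (- q)) \<in> R"
        by (intro RD(4) k partial_character_power[OF R S z0])
      moreover have "t [^] k \<otimes> (t [^] n) [^] (- q) = t [^] (k + int n * (- q))"
        using tG by (simp add: int_pow_pow flip: int_pow_int int_pow_mult)
      ultimately have rR: "(t [^] r, z * z0 powi (- q)) \<in> R"
        by (simp add: kqr)
      have "r = 0"
      proof (rule ccontr)
        assume "r \<noteq> 0"
        obtain j where j: "r = int j"
          using r(1) nonneg_int_cases by blast
        then have "P j"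
          using rR \<open>r \<noteq> 0\<close> by (auto simp: P_def int_pow_int)
        then have "n \<le> j"
          unfolding n_def by (rule Least_le)
        then show False
          using r j by simp
      qed
      then have "z * z0 powi (- q) = 1"
        using rR RD(6) by simp
      moreover have "z0 \<noteq> 0"
        using \<open>cmod z0 = 1\<close> by auto
      ultimately have "z = z0 powi q"
        by (simp add: power_int_minus field_simps)
      also have "\<dots> = w powi k"
        by (simp add: kqr \<open>r = 0\<close> power_int_mult flip: w(2))
      finally show ?thesis .
    qed
    then show ?thesis
      using that w(1) by blast
  qed
qed

text \<open>A nontrivial value at \<open>t\<close> is chosen first: -1 if \<open>t\<close> has
  infinite order, and otherwise a primitive root of unity of order \<open>ord t\<close>. Zorn's
  lemma extends this character of the powers of \<open>t\<close>, and a maximal extension is total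
  because any further element can be adjoined.\<close>

lemma dual_group_separates:
  assumes S: "subgroup S G" and comm: "\<And>s t. s \<in> S \<Longrightarrow> t \<in> S \<Longrightarrow> s \<otimes> t = t \<otimes> s"
    and t: "t \<in> S" "t \<noteq> \<one>"
  obtains \<nu> where "\<nu> \<in> dual_group G S" "\<nu> t \<noteq> 1"
proof -
  have tG: "t \<in> carrier G" and SG: "s \<in> S \<Longrightarrow> s \<in> carrier G" for s
    using t subgroup.mem_carrier[OF S] by auto
  have triv: "partial_character S {(\<one>, 1)}"
    using subgroup.one_closed[OF S] by (simp add: partial_character_def)
  obtain w where w: "cmod w = 1" "w \<noteq> 1" "\<And>k :: int. t [^] k = \<one> \<Longrightarrow> w powi k = 1"
  proof (cases "ord t = 0")
    case True
    then show ?thesis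
      using that[of "- 1"] tG by (simp add: int_pow_eq_id)
  next
    case False
    define n where "n = ord t"
    have n: "n > 1"
      using False t(2) tG ord_eq_1[OF tG] by (simp add: n_def)
    have "cis (2 * pi / n) \<noteq> 1"
    proof
      assume "cis (2 * pi / n) = 1"
      then have "cos (2 * pi / n) = 1"
        by (simp add: complex_eq_iff)
      then obtain i :: int where "2 * pi / n = of_int i * (2 * pi)"
        by (auto simp: cos_one_2pi_int)
      then have "1 = of_int i * real n"
        using n by (simp add: field_simps)
      then have "1 = i * int n"
        by (metis of_int_eq_1_iff of_int_mult of_int_of_nat_eq)
      then have "int n dvd 1"
        by (metis dvd_triv_right)
      then show False
        using n by simp
    qed
    moreover have "cis (2 * pi / n) powi k = 1" if tk: "t [^] k = \<one>" for k :: int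
    proof -
      obtain j where "k = int n * j"
        using tk int_pow_eq_id[OF tG, of k] by (auto simp: n_def dvd_def)
      moreover have "cis (2 * pi / n) ^ n = 1"
        using n by (simp add: Complex.DeMoivre)
      ultimately show ?thesis
        by (simp add: power_int_mult)
    qed
    ultimately show ?thesis
      using that[of "cis (2 * pi / n)"] by simp
  qed
  define R0 where "R0 = {(s \<otimes> t [^] (k :: int), z * w powi k) | s z k. (s, z) \<in> {(\<one>, 1 :: complex)}}"
  have R0: "partial_character S R0"
    unfolding R0_def
    by (rule partial_character_adjoin[OF triv S comm t(1) w(1)]) (use w(3) in auto)
  have tR0: "(t, w) \<in> R0"
    unfolding R0_def using tG by (auto intro!: exI[of _ "1::int"])
  define \<A> where "\<A> = {R. partial_character S R \<and> R0 \<subseteq> R}"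
  have "\<exists>M\<in>\<A>. \<forall>X\<in>\<A>. M \<subseteq> X \<longrightarrow> X = M"
  proof (rule subset_Zorn_nonempty)
    show "\<A> \<noteq> {}"
      using R0 by (auto simp: \<A>_def)
    fix \<C> assume ne: "\<C> \<noteq> {}" and ch: "subset.chain \<A> \<C>"
    have pc: "partial_character S R" "R0 \<subseteq> R" if "R \<in> \<C>" for R
      using ch that by (auto simp: subset.chain_def \<A>_def)
    have both: "\<exists>R\<in>\<C>. p \<in> R \<and> q \<in> R" if "p \<in> \<Union>\<C>" "q \<in> \<Union>\<C>" for p q
      using that ch by (meson UnionE subset.chain_def subset_chain_def in_mono)
    have "partial_character S (\<Union>\<C>)"
      unfolding partial_character_def
    proof (intro conjI allI impI)
      show "\<Union>\<C> \<subseteq> S \<times> {z. cmod z = 1}"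
        using pc(1) unfolding partial_character_def by (intro Union_least) blast
      show "(\<one>, 1) \<in> \<Union>\<C>"
        using ne pc(1) partial_characterD(3) by blast
      show "(s \<otimes> t, z * w) \<in> \<Union>\<C>" if st: "(s, z) \<in> \<Union>\<C>" "(t, w) \<in> \<Union>\<C>" for s z t w
        using both[OF st] partial_characterD(4)[OF pc(1)] by blast
      show "(inv s, inverse z) \<in> \<Union>\<C>" if "(s, z) \<in> \<Union>\<C>" for s z
        using that partial_characterD(5)[OF pc(1)] by blast
      show "z = 1" if "(\<one>, z) \<in> \<Union>\<C>" for z
        using that partial_characterD(6)[OF pc(1)] by blast
    qed
    then show "\<Union>\<C> \<in> \<A>"
      using ne pc(2) by (auto simp: \<A>_def)
  qed
  then obtain M where M: "partial_character S M" "R0 \<subseteq> M"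
    and max: "\<And>X. partial_character S X \<Longrightarrow> M \<subseteq> X \<Longrightarrow> X = M"
    unfolding \<A>_def by auto
  note MD = partial_characterD[OF M(1)]
  have total: "\<exists>z. (s, z) \<in> M" if s: "s \<in> S" for s
  proof -
    obtain v where v: "cmod v = 1" "\<And>(k::int) z. (s [^] k, z) \<in> M \<Longrightarrow> z = v powi k"
      using partial_character_compatible[OF M(1) S s] by metis
    define M' where "M' = {(a \<otimes> s [^] (k :: int), z * v powi k) | a z k. (a, z) \<in> M}"
    have "partial_character S M'"
      unfolding M'_def by (rule partial_character_adjoin[OF M(1) S comm s v])
    moreover have "M \<subseteq> M'"
    proof safe
      fix a z assume az: "(a, z) \<in> M"
      then have "a \<in> carrier G"
        using MD(1) SG by blast
      then have "(a, z) = (a \<otimes> s [^] (0 :: int), z * v powi 0)"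
        by simp
      then show "(a, z) \<in> M'"
        unfolding M'_def using az by blast
    qed
    ultimately have "M' = M"
      by (rule max)
    moreover have "(s, v) = (\<one> \<otimes> s [^] (1 :: int), 1 * v powi 1)"
      using s SG by simp
    then have "(s, v) \<in> M'"
      unfolding M'_def using MD(3) by blast
    ultimately show ?thesis
      by blast
  qed
  have unique: "z = y" if "(s, z) \<in> M" "(s, y) \<in> M" for s z y
  proof -
    have "(s \<otimes> inv s, z * inverse y) \<in> M"
      by (intro MD(4) MD(5) that)
    then have "z * inverse y = 1"
      using MD(1)[OF that(1)] SG MD(6) by simp
    then show ?thesis
      using MD(2)[OF that(2)] by (auto simp: field_simps split: if_splits)
  qed
  define \<nu> where "\<nu> = (\<lambda>s\<in>S. THE z. (s, z) \<in> M)"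
  have \<nu>: "(s, \<nu> s) \<in> M" if "s \<in> S" for s
    using total[OF that] unique that unfolding \<nu>_def by (auto intro: theI2)
  have "\<nu> \<in> dual_group G S"
    unfolding dual_group_def
  proof (intro CollectI conjI ballI)
    show "\<nu> \<in> extensional S"
      by (simp add: \<nu>_def)
    show "cmod (\<nu> s) = 1" if "s \<in> S" for s
      using MD(2)[OF \<nu>[OF that]] .
    show "\<nu> (s \<otimes> t) = \<nu> s * \<nu> t" if "s \<in> S" "t \<in> S" for s t
      using unique[OF \<nu>[OF subgroup.m_closed[OF S that]] MD(4)[OF \<nu>[OF that(1)] \<nu>[OF that(2)]]] .
  qed
  moreover have "\<nu> t = w"
    using unique[OF \<nu>[OF t(1)]] tR0 M(2) by blast
  ultimately show ?thesis
    using that w(2) by blast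
qed

lemma dual_group_simps:
  assumes "subgroup S G" and \<nu>: "\<nu> \<in> dual_group G S"
  shows "\<nu> \<one> = 1" "s \<in> S \<Longrightarrow> \<nu> (inv s) = cnj (\<nu> s)" "s \<in> S \<Longrightarrow> \<nu> (s [^] (n :: nat)) = \<nu> s ^ n"
proof -
  interpret subgroup S G by fact
  have \<nu>1: "cmod (\<nu> s) = 1" if "s \<in> S" for s
    using \<nu> that by (simp add: dual_group_def)
  have \<nu>m: "\<nu> (s \<otimes> t) = \<nu> s * \<nu> t" if "s \<in> S" "t \<in> S" for s t
    using \<nu> that by (simp add: dual_group_def)
  show one: "\<nu> \<one> = 1"
    using \<nu>m[of \<one> \<one>] \<nu>1[of \<one>] by (auto simp: one_closed)
  show "\<nu> (inv s) = cnj (\<nu> s)" if s: "s \<in> S"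
  proof -
    have "\<nu> s * \<nu> (inv s) = 1"
      using \<nu>m[of s "inv s"] s one by (simp add: mem_carrier)
    moreover have "\<nu> s * cnj (\<nu> s) = 1"
      using \<nu>1[OF s] by (simp add: complex_norm_square[symmetric])
    ultimately show ?thesis
      by (metis mult_left_cancel mult_zero_left zero_neq_one)
  qed
  show "\<nu> (s [^] n) = \<nu> s ^ n" if s: "s \<in> S"
  proof (induction n)
    case (Suc n)
    have "s [^] n \<in> S"
      using s by (induction n) auto
    then show ?case
      using \<nu>m[of "s [^] n" s] s Suc by simp
  qed (simp add: one)
qed

end

section \<open>Characters of the algebra of an abelian subgroup\<close>

locale twisted_trivial = twisted_subgroup +
  assumes comm_S: "s \<in> S \<Longrightarrow> t \<in> S \<Longrightarrow> s \<otimes> t = t \<otimes> s" and c_S [simp]: "s \<in> S \<Longrightarrow> t \<in> S \<Longrightarrow> c s t = 1"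
begin

lemma delta_S_mult: "s \<in> S \<Longrightarrow> t \<in> S \<Longrightarrow> delta s * delta t = delta (s \<otimes> t)"
  by (simp add: delta_mult)

lemma adj_delta_S: "s \<in> S \<Longrightarrow> adj (delta s) = delta (inv s)"
  by (simp add: adj_delta)

lemma alg_S_commute:
  assumes a: "a \<in> alg S" and b: "b \<in> alg S"
  shows "a * b = b * a"
  using a
proof (induction rule: alg_induct)
  case closed
  show ?case
    by (intro closed_Collect_eq continuous_intros)
next
  case (delta s)
  show ?case
    using b
  proof (induction rule: alg_induct)
    case closed
    show ?case
      by (intro closed_Collect_eq continuous_intros)
  next
    case (delta t)
    then show ?case
      using \<open>s \<in> S\<close> by (simp add: delta_S_mult comm_S)
  qed (simp_all add: algebra_simps)
qed (simp_all add: algebra_simps)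

lemma coord_regular: "f \<in> finsupp S \<Longrightarrow> coord (app (regular f) (basis \<one>)) g = f g"
proof -
  assume f: "f \<in> finsupp S"
  then have F: "finite {s. f s \<noteq> 0}" "s \<in> carrier G" if "f s \<noteq> 0" for s
    using that by (auto simp: finsupp_def)
  have "coord (app (regular f) (basis \<one>)) g = (\<Sum>s | f s \<noteq> 0. f s * (if g = s then 1 else 0))"
    unfolding regular_def app_sum_left coord_sum
    by (rule sum.cong) (auto simp: F delta_basis coord_basis)
  also have "\<dots> = f g"
    using f by (cases "f g = 0") (auto simp: finsupp_def sum.delta if_distrib cong: if_cong)
  finally show ?thesis .
qed

section \<open>Polynomial growth and the bound for evaluation at a character\<close>

primrec pball :: "'a list \<Rightarrow> nat \<Rightarrow> 'a set" where
  "pball [] n = {\<one>}"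
| "pball (s # ss) n = (\<lambda>(i, y). s [^] (i :: nat) \<otimes> y) ` ({..n} \<times> pball ss n)"

lemma pow_S: "s \<in> S \<Longrightarrow> s [^] (i :: nat) \<in> S"
  by (induction i) auto

text \<open>\<open>pball ss n\<close> is a box: products of powers of the listed elements, in order,
  with each exponent at most \<open>n\<close>. Counting tuples of exponents bounds its size by a
  polynomial in \<open>n\<close> of degree \<open>length ss\<close>.\<close>

lemma pball_props:
  assumes "set ss \<subseteq> S"
  shows "pball ss n \<subseteq> S" "finite (pball ss n)" "card (pball ss n) \<le> Suc n ^ length ss"
    "pball ss n \<subseteq> pball ss (Suc n)" "\<one> \<in> pball ss n"
proof -
  have "pball ss n \<subseteq> S \<and> finite (pball ss n) \<and> card (pball ss n) \<le> Suc n ^ length ss \<and>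
    pball ss n \<subseteq> pball ss (Suc n) \<and> \<one> \<in> pball ss n"
    using assms
  proof (induction ss)
    case (Cons s ss)
    then have IH: "pball ss n \<subseteq> S" "finite (pball ss n)" "card (pball ss n) \<le> Suc n ^ length ss"
        "pball ss n \<subseteq> pball ss (Suc n)" "\<one> \<in> pball ss n" and s: "s \<in> S"
      by auto
    have "card (pball (s # ss) n) \<le> card ({..n} \<times> pball ss n)"
      unfolding pball.simps by (rule card_image_le) (simp add: IH)
    also have "\<dots> = Suc n * card (pball ss n)"
      by (simp add: card_cartesian_product)
    also have "\<dots> \<le> Suc n * Suc n ^ length ss"
      by (intro mult_le_mono2 IH(3))
    also have "\<dots> = Suc n ^ length (s # ss)"
      by simp
    finally have "card (pball (s # ss) n) \<le> Suc n ^ length (s # ss)" .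
    moreover have "pball (s # ss) n \<subseteq> pball (s # ss) (Suc n)"
      unfolding pball.simps using IH(4) by (intro image_mono Sigma_mono) auto
    moreover have "\<one> \<in> pball (s # ss) n"
      unfolding pball.simps using IH(5) s by (intro image_eqI[of _ _ "(0, \<one>)"]) auto
    moreover have "pball (s # ss) n \<subseteq> S"
      using IH(1) s pow_S by auto
    ultimately show ?case
      using IH(2) by simp
  qed auto
  then show "pball ss n \<subseteq> S" "finite (pball ss n)" "card (pball ss n) \<le> Suc n ^ length ss"
    "pball ss n \<subseteq> pball ss (Suc n)" "\<one> \<in> pball ss n"
    by auto
qed

text \<open>As \<open>S\<close> is abelian, the factor \<open>s\<close> can be moved to its own
  power, raising one exponent by one.\<close>

lemma pball_mult:
  assumes "set ss \<subseteq> S" "s \<in> set ss" "k \<in> pball ss n"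
  shows "s \<otimes> k \<in> pball ss (Suc n)"
  using assms
proof (induction ss arbitrary: k)
  case (Cons t ss)
  then obtain i y where k: "k = t [^] i \<otimes> y" "i \<le> n" "y \<in> pball ss n" and t: "t \<in> S" and s: "s \<in> S"
    by auto
  have y: "y \<in> S" "y \<in> pball ss (Suc n)"
    using k(3) pball_props[of ss n] Cons.prems(1) by auto
  show ?case
  proof (cases "s = t")
    case True
    then have "s \<otimes> k = t [^] Suc i \<otimes> y"
      using comm_S[OF t pow_S[OF t, of i]] t y by (simp add: k m_assoc[symmetric])
    then show ?thesis
      unfolding pball.simps using k(2) y(2) by (intro image_eqI[of _ _ "(Suc i, y)"]) auto
  next
    case False
    then have "s \<otimes> y \<in> pball ss (Suc n)"
      using Cons k(3) by auto
    moreover have "s \<otimes> k = t [^] i \<otimes> (s \<otimes> y)"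
      using comm_S[OF s pow_S[OF t, of i]] s t y by (simp add: k m_assoc[symmetric])
    ultimately show ?thesis
      unfolding pball.simps using k(2) by (intro image_eqI[of _ _ "(i, s \<otimes> y)"]) auto
  qed
qed simp

text \<open>The value at \<nu> of the Fourier transform of \<open>f\<close>.\<close>

definition evaluation :: "('a \<Rightarrow> complex) \<Rightarrow> ('a \<Rightarrow> complex) \<Rightarrow> complex" where
  "evaluation \<nu> f = (\<Sum>s | f s \<noteq> 0. f s * \<nu> s)"

text \<open>If \<open>r\<close> exceeded a positive \<open>K\<close>, the number
  \<open>q = (r / K)\<^sup>2 > 1\<close> would satisfy \<open>q ^ n \<le> (n + 1) ^ m\<close>, so
  that \<open>ln q \<le> m * ln (n + 1) / n\<close>, which tends to 0.\<close>

lemma root_growth_le: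
  fixes r K :: real
  assumes le: "\<And>n. r ^ n \<le> sqrt (real (Suc n ^ m)) * K ^ n" and K: "0 \<le> K" and r: "0 \<le> r"
  shows "r \<le> K"
proof (rule ccontr)
  assume "\<not> r \<le> K"
  then have rK: "K < r" by simp
  show False
  proof (cases "K = 0")
    case True
    then show ?thesis
      using le[of 1] rK by simp
  next
    case False
    with K have K0: "K > 0" by simp
    define q where "q = (r / K)\<^sup>2"
    have q: "q > 1"
      using rK K0 by (simp add: q_def power_divide less_divide_eq power_strict_mono)
    have "q ^ n \<le> real (Suc n) ^ m" for n
    proof -
      have "(r / K) ^ n \<le> sqrt (real (Suc n ^ m))"
        using le[of n] K0 by (simp add: power_divide divide_le_eq)
      then have "((r / K) ^ n)\<^sup>2 \<le> (sqrt (real (Suc n ^ m)))\<^sup>2"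
        using r K by (intro power_mono) auto
      then show ?thesis
        by (simp add: q_def power_mult[symmetric] mult.commute)
    qed
    then have ln_le: "real n * ln q \<le> real m * ln (real (Suc n))" for n
      using q by (metis ln_le_cancel_iff ln_realpow of_nat_0_less_iff zero_less_Suc zero_less_power less_trans zero_less_one)
    have "(\<lambda>n. ln q) \<longlonglongrightarrow> ln q"
      by simp
    \<comment> \<open>The factor \<open>1 + 1 / n\<close> turns the denominator \<open>n + 1\<close>
      of the standard limit into \<open>n\<close>.\<close>
    moreover have "(\<lambda>n. (real m * (ln (real (Suc n)) / real (Suc n))) * (1 + 1 / real n)) \<longlonglongrightarrow> (real m * 0) * (1 + 0)"
      by (intro tendsto_intros LIMSEQ_Suc[OF lim_ln_over_n] lim_1_over_n)
    moreover have "ln q \<le> (real m * (ln (real (Suc n)) / real (Suc n))) * (1 + 1 / real n)" if "n \<ge> 1" for n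
    proof -
      have "1 + 1 / real n = real (Suc n) / real n"
        using that by (simp add: field_simps)
      then show ?thesis
        using ln_le[of n] that by (simp add: pos_le_divide_eq mult.commute del: of_nat_Suc)
    qed
    ultimately have "ln q \<le> 0"
      using LIMSEQ_le[of "\<lambda>n. ln q" "ln q"] by fastforce
    then show False
      using q by simp
  qed
qed

text \<open>As \<open>S\<close> is abelian, the supports of the convolution powers of \<open>f\<close> grow polynomially, so that
  comparing the $\ell^1$- and $\ell^2$-norms of these powers costs nothing in the limit of roots.\<close>

lemma evaluation_le:
  assumes \<nu>: "\<nu> \<in> dual_group G S" and f: "f \<in> finsupp S"
  shows "cmod (evaluation \<nu> f) \<le> norm (regular f)"
proof -
  have F: "finite {s. f s \<noteq> 0}" "{s. f s \<noteq> 0} \<subseteq> S"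
    using f by (auto simp: finsupp_def)
  obtain ss where ss: "set ss = {s. f s \<noteq> 0}"
    using finite_list[OF F(1)] by blast
  have ssS: "set ss \<subseteq> S"
    using ss F(2) by simp
  define B where "B = pball ss"
  \<comment> \<open>The pairing with \<nu> is restricted to the finite box \<open>B n\<close>, which
    supports the iterate \<open>\<xi> n\<close>; \<nu> itself need not be square-summable.\<close>
  define lf where "lf n \<xi> = (\<Sum>k\<in>B n. \<nu> k * coord \<xi> k)" for n and \<xi> :: "'a ell2"
  define \<xi> where "\<xi> n = (app (regular f) ^^ n) (basis \<one>)" for n
  have BS: "B n \<subseteq> S" and Bfin: "finite (B n)" for n
    using pball_props[OF ssS] by (auto simp: B_def)
  have \<nu>1: "cmod (\<nu> s) = 1" if "s \<in> S" for s
    using \<nu> that by (simp add: dual_group_def)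
  have lf_sum: "lf n (\<Sum>i\<in>I. g i) = (\<Sum>i\<in>I. lf n (g i))" for n I and g :: "'a \<Rightarrow> 'a ell2"
    unfolding lf_def coord_sum sum_distrib_left by (rule sum.swap)
  have lf_cscale: "lf n (cscale z \<zeta>) = z * lf n \<zeta>" for n z \<zeta>
    by (simp add: lf_def sum_distrib_left mult_ac)
  have lf_basis: "lf n (basis k) = \<nu> k" if "k \<in> B n" for n k
    using that Bfin by (simp add: lf_def coord_basis sum.delta' if_distrib cong: if_cong)
  \<comment> \<open>Multiplicativity of \<nu> lets the pairing factor: one application of
    \<open>regular f\<close> enlarges the box by one step and multiplies the pairing by
    \<open>evaluation \<nu> f\<close>.\<close>
  have step: "(\<forall>k. k \<notin> B (Suc n) \<longrightarrow> coord (app (regular f) \<zeta>) k = 0) \<and>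
      lf (Suc n) (app (regular f) \<zeta>) = evaluation \<nu> f * lf n \<zeta>"
    if supp: "\<And>k. k \<notin> B n \<Longrightarrow> coord \<zeta> k = 0" for n \<zeta>
  proof -
    have \<zeta>: "\<zeta> = (\<Sum>k\<in>B n. cscale (coord \<zeta> k) (basis k))"
      using supp Bfin by (intro ell2_eqI) (auto simp: coord_basis sum.delta if_distrib cong: if_cong)
    have mem: "s \<otimes> k \<in> B (Suc n)" if "f s \<noteq> 0" "k \<in> B n" for s k
      using pball_mult[OF ssS] that ss by (auto simp: B_def)
    have "app (regular f) \<zeta> = (\<Sum>k\<in>B n. \<Sum>s | f s \<noteq> 0. cscale (coord \<zeta> k * f s) (basis (s \<otimes> k)))"
    proof (subst \<zeta>, unfold app_sum, intro sum.cong refl)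
      fix k assume k: "k \<in> B n"
      have "app (regular f) (basis k) = (\<Sum>s | f s \<noteq> 0. cscale (f s) (basis (s \<otimes> k)))"
        unfolding regular_def app_sum_left
        by (intro sum.cong refl) (use k BS F in \<open>auto simp: delta_basis subset_iff\<close>)
      then show "app (regular f) (cscale (coord \<zeta> k) (basis k)) =
          (\<Sum>s | f s \<noteq> 0. cscale (coord \<zeta> k * f s) (basis (s \<otimes> k)))"
        by (simp add: cscale_sum)
    qed
    note app = this
    have out: "coord (app (regular f) \<zeta>) k = 0" if k: "k \<notin> B (Suc n)" for k
      unfolding app coord_sum by (intro sum.neutral ballI) (use mem k in \<open>auto simp: coord_basis\<close>)
    have "lf (Suc n) (app (regular f) \<zeta>) = (\<Sum>k\<in>B n. \<Sum>s | f s \<noteq> 0. (coord \<zeta> k * f s) * \<nu> (s \<otimes> k))"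
      unfolding app lf_sum by (intro sum.cong refl) (auto simp: lf_cscale lf_basis mem)
    also have "\<dots> = (\<Sum>k\<in>B n. \<Sum>s | f s \<noteq> 0. (f s * \<nu> s) * (\<nu> k * coord \<zeta> k))"
      by (intro sum.cong refl) (use \<nu> BS F in \<open>auto simp: dual_group_def subset_iff\<close>)
    also have "\<dots> = evaluation \<nu> f * lf n \<zeta>"
      unfolding lf_def evaluation_def sum_product by (rule sum.swap)
    finally show ?thesis
      using out by blast
  qed
  have supp: "coord (\<xi> n) k = 0" if "k \<notin> B n" for n k
    using that
  proof (induction n arbitrary: k)
    case 0
    then show ?case
      using pball_props(5)[OF ssS, of 0] by (auto simp: \<xi>_def coord_basis B_def)
  next
    case (Suc n)
    then show ?case
      using step[of n "\<xi> n"] by (simp add: \<xi>_def)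
  qed
  have lf_\<xi>: "lf n (\<xi> n) = evaluation \<nu> f ^ n" for n
  proof (induction n)
    case 0
    then show ?case
      using pball_props(5)[OF ssS, of 0] dual_group_simps(1)[OF subgroup_S \<nu>]
      by (simp add: \<xi>_def lf_basis B_def)
  next
    case (Suc n)
    have "lf (Suc n) (\<xi> (Suc n)) = evaluation \<nu> f * lf n (\<xi> n)"
      using step[OF supp] by (simp add: \<xi>_def)
    then show ?case
      using Suc by simp
  qed
  have norm_\<xi>: "norm (\<xi> n) \<le> norm (regular f) ^ n" for n
  proof (induction n)
    case (Suc n)
    have "norm (\<xi> (Suc n)) \<le> norm (regular f) * norm (\<xi> n)"
      by (simp add: \<xi>_def norm_app_le)
    also have "\<dots> \<le> norm (regular f) * norm (regular f) ^ n"
      by (intro mult_left_mono Suc norm_ge_zero)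
    finally show ?case
      by simp
  qed (simp add: \<xi>_def)
  have "cmod (evaluation \<nu> f) ^ n \<le> sqrt (real (Suc n ^ length ss)) * norm (regular f) ^ n" for n
  proof -
    have "cmod (lf n (\<xi> n)) \<le> (\<Sum>k\<in>B n. cmod (coord (\<xi> n) k))"
      unfolding lf_def by (rule sum_norm_le) (simp add: norm_mult \<nu>1[OF subsetD[OF BS]])
    \<comment> \<open>Cauchy-Schwarz on the box; its cardinality is the polynomial factor.\<close>
    also have "\<dots> \<le> sqrt (real (card (B n))) * norm (\<xi> n)"
    proof (rule power2_le_imp_le)
      have "(\<Sum>k\<in>B n. cmod (coord (\<xi> n) k))\<^sup>2 \<le> (\<Sum>k\<in>B n. (cmod (coord (\<xi> n) k))\<^sup>2) * card (B n)"
        by (rule sum_squared_le_sum_of_squares)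
      also have "\<dots> \<le> (norm (\<xi> n))\<^sup>2 * card (B n)"
        by (intro mult_right_mono sum_coord_le Bfin) simp
      finally show "(\<Sum>k\<in>B n. cmod (coord (\<xi> n) k))\<^sup>2 \<le> (sqrt (real (card (B n))) * norm (\<xi> n))\<^sup>2"
        by (simp add: power_mult_distrib mult.commute)
    qed simp
    also have "\<dots> \<le> sqrt (real (Suc n ^ length ss)) * norm (regular f) ^ n"
      using pball_props(3)[OF ssS, of n] norm_\<xi> by (intro mult_mono real_sqrt_le_mono) (auto simp: B_def simp del: of_nat_power)
    finally show ?thesis
      by (simp add: lf_\<xi> norm_power)
  qed
  then show ?thesis
    by (rule root_growth_le) simp_all
qed

end

context twisted_trivial
begin

subsection \<open>Multiplicative functionals\<close>

text \<open>As in \<open>spectrum\<close>, neither continuity nor compatibility with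
  \<open>adj\<close> is required; both are derived below.\<close>

definition is_character :: "('a oper \<Rightarrow> complex) \<Rightarrow> bool" where
  "is_character x \<longleftrightarrow>
    (\<forall>a\<in>alg S. \<forall>b\<in>alg S. x (a + b) = x a + x b \<and> x (a * b) = x a * x b) \<and>
    (\<forall>z. \<forall>a\<in>alg S. x (z \<star> a) = z * x a) \<and> (\<exists>b\<in>alg S. x b \<noteq> 0)"

lemma character_simps:
  assumes "is_character x"
  shows "a \<in> alg S \<Longrightarrow> b \<in> alg S \<Longrightarrow> x (a + b) = x a + x b"
    "a \<in> alg S \<Longrightarrow> b \<in> alg S \<Longrightarrow> x (a * b) = x a * x b"
    "a \<in> alg S \<Longrightarrow> x (z \<star> a) = z * x a"
    "a \<in> alg S \<Longrightarrow> b \<in> alg S \<Longrightarrow> x (a - b) = x a - x b"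
    "x 0 = 0" "x (delta \<one>) = 1"
proof -
  show add: "x (a + b) = x a + x b" if "a \<in> alg S" "b \<in> alg S" for a b
    using assms that by (simp add: is_character_def)
  show mult: "x (a * b) = x a * x b" if "a \<in> alg S" "b \<in> alg S" for a b
    using assms that by (simp add: is_character_def)
  show scale: "x (z \<star> a) = z * x a" if "a \<in> alg S" for a z
    using assms that by (simp add: is_character_def)
  show "x (a - b) = x a - x b" if "a \<in> alg S" "b \<in> alg S"
    using add[OF that(1) alg_scale[OF that(2), of "- 1"]] scale[OF that(2), of "- 1"]
    by (simp add: cscale_oper_minus_one)
  show "x 0 = 0"
    using scale[of 0 0] by simp
  obtain b where b: "b \<in> alg S" "x b \<noteq> 0"
    using assms by (auto simp: is_character_def)
  then have "x (delta \<one>) * x b = x b"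
    using mult[of "delta \<one>" b] by simp
  then show "x (delta \<one>) = 1"
    using b by simp
qed

text \<open>If \<open>x b = 1\<close> with \<open>norm b < 1\<close>, then \<open>Y = b + b Y\<close> has a solution and \<open>x Y = 1 + x Y\<close>.\<close>

lemma character_le:
  assumes x: "is_character x" and a: "a \<in> alg S"
  shows "cmod (x a) \<le> norm a"
proof (rule ccontr)
  assume "\<not> cmod (x a) \<le> norm a"
  then have less: "norm a < cmod (x a)"
    by simp
  then have x0: "x a \<noteq> 0"
    using norm_ge_zero[of a] by (auto simp del: norm_ge_zero)
  define b where "b = (1 / x a) \<star> a"
  have b: "b \<in> alg S" "x b = 1"
    using a x0 by (simp_all add: b_def character_simps[OF x])
  have "norm b \<le> cmod (1 / x a) * norm a"
    unfolding b_def by (rule norm_cscale_oper_le)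
  also have "\<dots> < 1"
    using less x0 by (simp add: norm_divide)
  finally obtain Y where Y: "Y \<in> alg S" "Y = b + b * Y"
  proof (rule neumann_fixpoint[OF _ closed_alg])
    show "alg S \<noteq> {}"
      using zero_alg by blast
  qed (use b(1) in auto)
  then have "x Y = 1 + x Y"
    using character_simps(1,2)[OF x] b by (metis alg_S_mult mult_1)
  then show False
    by simp
qed

lemma continuous_on_character:
  assumes x: "is_character x"
  shows "continuous_on (alg S) x"
proof (rule continuous_onI)
  fix a e assume "a \<in> alg S" "0 < (e :: real)"
  moreover have "dist (x b) (x a) \<le> dist b a" if "b \<in> alg S" for b
    using character_le[OF x, of "b - a"] character_simps(4)[OF x that \<open>a \<in> alg S\<close>] that \<open>a \<in> alg S\<close>
    by (simp add: dist_norm)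
  ultimately show "\<exists>d>0. \<forall>b\<in>alg S. dist b a < d \<longrightarrow> dist (x b) (x a) \<le> e"
    by (intro exI[of _ e]) force
qed

lemma continuous_on_character_compose:
  assumes x: "is_character x" and f: "continuous_on A f" "\<And>a. a \<in> A \<Longrightarrow> f a \<in> alg S"
  shows "continuous_on A (\<lambda>a. x (f a))"
  using continuous_on_compose2[OF continuous_on_character[OF x] f(1)] f(2) by auto

text \<open>Continuity of a character is known only on \<open>alg S\<close>, so membership in the
  domain is part of the set; the inductions using this carry it along in their property.\<close>

lemma closed_Collect_character:
  assumes x: "is_character x" and A: "closed A" and f: "continuous_on A f" "\<And>a. a \<in> A \<Longrightarrow> f a \<in> alg S"
    and g: "continuous_on A g"
  shows "closed {a. a \<in> A \<and> x (f a) = g a}"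
  using continuous_closed_preimage_constant[OF continuous_on_diff[OF continuous_on_character_compose[OF x f] g] A, of 0]
  by simp

text \<open>Contractivity bounds the values at \<open>delta s\<close> and at
  \<open>delta (inv s)\<close> by 1, while their product is 1.\<close>

lemma character_delta:
  assumes x: "is_character x"
  shows "(\<lambda>s\<in>S. x (delta s)) \<in> dual_group G S"
proof -
  have le: "cmod (x (delta s)) \<le> 1" if "s \<in> S" for s
    using character_le[OF x, of "delta s"] norm_delta_le[of s] that by simp
  have mult: "x (delta (s \<otimes> t)) = x (delta s) * x (delta t)" if "s \<in> S" "t \<in> S" for s t
    using character_simps(2)[OF x, of "delta s" "delta t"] that by (simp add: delta_S_mult)
  have "cmod (x (delta s)) = 1" if s: "s \<in> S" for s
  proof -
    have "cmod (x (delta s)) * cmod (x (delta (inv s))) = 1"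
      using mult[of s "inv s"] s by (simp add: character_simps(6)[OF x] flip: norm_mult)
    then have "1 \<le> cmod (x (delta s))"
      using le[of "inv s"] s mult_left_mono[of "cmod (x (delta (inv s)))" 1 "cmod (x (delta s))"] by simp
    then show ?thesis
      using le[OF s] by simp
  qed
  then show ?thesis
    by (simp add: dual_group_def mult)
qed

lemma character_regular:
  assumes x: "is_character x" and f: "f \<in> finsupp S"
  shows "x (regular f) = (\<Sum>s | f s \<noteq> 0. f s * x (delta s))"
proof -
  have "finite F \<Longrightarrow> F \<subseteq> S \<Longrightarrow>
      (\<Sum>s\<in>F. f s \<star> delta s) \<in> alg S \<and> x (\<Sum>s\<in>F. f s \<star> delta s) = (\<Sum>s\<in>F. f s * x (delta s))" for F
    by (induction F rule: finite_induct) (simp_all add: character_simps[OF x])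
  then show ?thesis
    using f unfolding regular_def finsupp_def by blast
qed

lemma character_adj:
  assumes x: "is_character x" and a: "a \<in> alg S"
  shows "x (adj a) = cnj (x a)"
proof -
  have "a \<in> alg S \<and> x (adj a) = cnj (x a)"
    using a
  proof (induction rule: alg_induct)
    case closed
    show ?case
      by (intro closed_Collect_character[OF x closed_alg] continuous_intros
          continuous_on_character[OF x] continuous_on_cnj alg_S_adj)
  next
    case (delta s)
    then show ?case
      using dual_group_simps(2)[OF subgroup_S character_delta[OF x], of s] by (simp add: adj_delta_S)
  qed (simp_all add: character_simps[OF x])
  then show ?thesis ..
qed

lemma character_eqI:
  assumes x: "is_character x" and y: "is_character y" and eq: "\<And>s. s \<in> S \<Longrightarrow> x (delta s) = y (delta s)"
    and a: "a \<in> alg S"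
  shows "x a = y a"
proof -
  have "a \<in> alg S \<and> x a = y a"
    using a
  proof (induction rule: alg_induct)
    case closed
    show ?case
      by (intro closed_Collect_character[OF x closed_alg] continuous_on_character[OF y] continuous_intros)
  qed (simp_all add: character_simps[OF x] character_simps[OF y] eq)
  then show ?thesis ..
qed

text \<open>An element \<open>adj a * a\<close> of \<open>alg S\<close> equals its own expectation,
  hence is a square \<open>d * d\<close> with \<open>d\<close> selfadjoint in \<open>alg S\<close>,
  where \<open>x\<close> respects \<open>adj\<close>. So the positivity condition in
  \<open>weyl_dom\<close> reduces to nonvanishing.\<close>

lemma character_positive:
  assumes x: "is_character x" and a: "a \<in> alg (carrier G)" "adj a * a \<in> alg S"
  shows "x (adj a * a) \<in> \<real>" "0 \<le> Re (x (adj a * a))"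
proof -
  obtain d where d: "d \<in> alg S" "adj d = d" "expect (adj a * a) = d * d"
    using expect_positive[OF a(1)] .
  have "x (adj a * a) = cnj (x d) * x d"
    using d a(2) character_adj[OF x d(1)] by (simp add: character_simps[OF x])
  then have "x (adj a * a) = of_real ((cmod (x d))\<^sup>2)"
    unfolding complex_norm_square by (simp add: mult.commute)
  then show "x (adj a * a) \<in> \<real>" "0 \<le> Re (x (adj a * a))"
    by simp_all
qed

section \<open>Extension of group characters to the completed algebra\<close>

lemma evaluation_superset: "finite F \<Longrightarrow> {s. f s \<noteq> 0} \<subseteq> F \<Longrightarrow> evaluation \<nu> f = (\<Sum>s\<in>F. f s * \<nu> s)"
  unfolding evaluation_def by (rule sum.mono_neutral_left) auto

lemma evaluation_diff:
  assumes "f \<in> finsupp S" "h \<in> finsupp S"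
  shows "evaluation \<nu> (\<lambda>s. f s + (- 1) * h s) = evaluation \<nu> f - evaluation \<nu> h"
proof -
  let ?F = "{g. f g \<noteq> 0} \<union> {g. h g \<noteq> 0}"
  have F: "finite ?F" "{g. f g + (- 1) * h g \<noteq> 0} \<subseteq> ?F"
    using assms by (auto simp: finsupp_def)
  show ?thesis
    using evaluation_superset[OF F, of \<nu>] evaluation_superset[OF F(1), of f \<nu>] evaluation_superset[OF F(1), of h \<nu>]
    by (simp add: algebra_simps sum_subtractf)
qed

text \<open>By \<open>evaluation_le\<close> the evaluation is Lipschitz with constant 1 on the dense
  set of finite combinations, so it extends continuously; the algebraic identities then pass to the
  closure, one variable at a time.\<close>

lemma character_exists:
  assumes \<nu>: "\<nu> \<in> dual_group G S"
  obtains x where "is_character x" "\<And>s. s \<in> S \<Longrightarrow> x (delta s) = \<nu> s"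
proof -
  \<comment> \<open>Reading the coefficients from the column of \<open>T\<close> at \<one> makes
    \<phi> a function of the operator, so independence of the choice of \<open>f\<close> needs no
    separate argument.\<close>
  define \<phi> where "\<phi> T = evaluation \<nu> (coord (app T (basis \<one>)))" for T
  have \<phi>: "\<phi> (regular f) = evaluation \<nu> f" if "f \<in> finsupp S" for f
  proof -
    have "coord (app (regular f) (basis \<one>)) = f"
      using coord_regular[OF that] by blast
    then show ?thesis
      by (simp add: \<phi>_def)
  qed
  have "dist (\<phi> (regular f)) (\<phi> (regular h)) \<le> 1 * dist (regular f) (regular h)"
    if f: "f \<in> finsupp S" and h: "h \<in> finsupp S" for f h
  proof -
    note h' = regular_scale[OF h, of "- 1"]
    have "regular (\<lambda>s. f s + (- 1) * h s) = regular f - regular h"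
      unfolding regular_add(2)[OF f h'(1)] h'(2) by (simp only: cscale_oper_minus_one diff_conv_add_uminus)
    then show ?thesis
      using evaluation_le[OF \<nu> regular_add(1)[OF f h'(1)]]
      by (simp add: dist_norm \<phi> f h evaluation_diff[OF f h, simplified])
  qed
  then have "1-lipschitz_on (regular ` finsupp S) \<phi>"
    by (intro lipschitz_onI) auto
  then have "uniformly_continuous_on (regular ` finsupp S) \<phi>"
    by (rule lipschitz_on_uniformly_continuous)
  then obtain x where ux: "uniformly_continuous_on (alg S) x" and x\<phi>: "\<And>a. a \<in> regular ` finsupp S \<Longrightarrow> \<phi> a = x a"
    unfolding alg_def using uniformly_continuous_on_extension_on_closure by metis
  have cx: "continuous_on (alg S) x"
    using ux by (rule uniformly_continuous_imp_continuous)
  have comp: "continuous_on (alg S) (\<lambda>a. x (f a))" if "continuous_on (alg S) f" "\<And>a. a \<in> alg S \<Longrightarrow> f a \<in> alg S" for f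
    using continuous_on_compose2[OF cx that(1)] that(2) by auto
  have x: "x (regular f) = evaluation \<nu> f" if "f \<in> finsupp S" for f
    using x\<phi>[of "regular f"] \<phi>[OF that] that by auto
  have dense: "h a = 0" if "continuous_on (alg S) h" "\<And>f. f \<in> finsupp S \<Longrightarrow> h (regular f) = 0" "a \<in> alg S"
    for h :: "'a oper \<Rightarrow> complex" and a
  proof -
    have cl: "closed {a \<in> alg S. h a = 0}"
      by (rule continuous_closed_preimage_constant[OF that(1) closed_alg])
    have "regular ` finsupp S \<subseteq> {a \<in> alg S. h a = 0}"
      using that(2) regular_alg by auto
    from closure_minimal[OF this cl, folded alg_def] show ?thesis
      using that(3) by auto
  qed
  have sc: "x (z \<star> a) = z * x a" if "a \<in> alg S" for z a
  proof -
    have "x (z \<star> a) - z * x a = 0"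
    proof (rule dense[OF _ _ that])
      show "continuous_on (alg S) (\<lambda>a. x (z \<star> a) - z * x a)"
        by (intro continuous_intros comp cx alg_scale)
      fix f assume f: "f \<in> finsupp S"
      have F: "finite {s. f s \<noteq> 0}" "{s. z * f s \<noteq> 0} \<subseteq> {s. f s \<noteq> 0}"
        using f by (auto simp: finsupp_def)
      show "x (z \<star> regular f) - z * x (regular f) = 0"
        using x[OF regular_scale(1)[OF f]] evaluation_superset[OF F, of \<nu>]
        by (simp add: regular_scale(2)[OF f] x[OF f] evaluation_def sum_distrib_left mult.assoc)
    qed
    then show ?thesis by simp
  qed
  have add_reg: "x (regular f + regular h) = x (regular f) + x (regular h)"
    if f: "f \<in> finsupp S" and h: "h \<in> finsupp S" for f h
  proof -
    let ?F = "{g. f g \<noteq> 0} \<union> {g. h g \<noteq> 0}"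
    have F: "finite ?F" "{g. f g + h g \<noteq> 0} \<subseteq> ?F"
      using f h by (auto simp: finsupp_def)
    show ?thesis
      using x[OF regular_add(1)[OF f h]] evaluation_superset[OF F, of \<nu>]
        evaluation_superset[OF F(1), of f \<nu>] evaluation_superset[OF F(1), of h \<nu>]
      by (simp add: regular_add(2)[OF f h] x f h algebra_simps sum.distrib)
  qed
  have add1: "x (regular f + b) = x (regular f) + x b" if f: "f \<in> finsupp S" and b: "b \<in> alg S" for f b
  proof -
    have "continuous_on (alg S) (\<lambda>b. x (regular f + b) - x (regular f) - x b)"
      using regular_alg[OF f] by (intro continuous_intros comp cx) simp
    then have "x (regular f + b) - x (regular f) - x b = 0"
      by (rule dense[OF _ _ b]) (simp add: add_reg f)
    then show ?thesis
      by (simp add: algebra_simps)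
  qed
  have add: "x (a + b) = x a + x b" if a: "a \<in> alg S" and b: "b \<in> alg S" for a b
  proof -
    have "continuous_on (alg S) (\<lambda>a. x (a + b) - x a - x b)"
      using b by (intro continuous_intros comp cx) simp
    then have "x (a + b) - x a - x b = 0"
      by (rule dense[OF _ _ a]) (simp add: add1 b)
    then show ?thesis
      by (simp add: algebra_simps)
  qed
  have xd: "x (delta s) = \<nu> s" if "s \<in> S" for s
  proof -
    have "{t. point_mass s t \<noteq> 0} \<subseteq> {s}"
      by (auto simp: point_mass_def)
    then have "evaluation \<nu> (point_mass s) = \<nu> s"
      by (simp add: evaluation_superset[of "{s}"] point_mass_def)
    then show ?thesis
      using x[OF point_mass_finsupp[OF that]] by (simp add: regular_point_mass)
  qed
  have "a \<in> alg S \<and> (\<forall>b\<in>alg S. x (a * b) = x a * x b)" if "a \<in> alg S" for a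
  proof -
    have "a \<in> alg S \<and> x (a * b) = x a * x b" if b: "b \<in> alg S" for b
      using \<open>a \<in> alg S\<close>
    proof (induction rule: alg_induct)
      case closed
      have "closed {a \<in> alg S. x (a * b) - x a * x b = 0}"
        using b by (intro continuous_closed_preimage_constant closed_alg continuous_intros comp cx) simp
      then show ?case
        by simp
    next
      case (delta s)
      have "b \<in> alg S \<and> x (delta s * b) = x (delta s) * x b"
        using b
      proof (induction rule: alg_induct)
        case closed
        have "closed {b \<in> alg S. x (delta s * b) - x (delta s) * x b = 0}"
          using delta by (intro continuous_closed_preimage_constant closed_alg continuous_intros comp cx) simp
        then show ?case
          by simp
      next
        case zero
        then show ?case
          using sc[of 0 0] by simp
      next
        case (delta t)
        then show ?case
          using \<open>s \<in> S\<close> \<nu> by (simp add: delta_S_mult xd dual_group_def)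
      qed (use delta in \<open>simp_all add: distrib_left add sc algebra_simps\<close>)
      then show ?case
        using delta by simp
    next
      case zero
      then show ?case
        using sc[of 0 0] by simp
    qed (use b in \<open>simp_all add: distrib_right add sc algebra_simps\<close>)
    then show ?thesis
      using that by blast
  qed
  moreover have "x (delta \<one>) \<noteq> 0"
    using xd[of \<one>] dual_group_simps(1)[OF subgroup_S \<nu>] by simp
  ultimately have "is_character x"
    unfolding is_character_def using add sc delta_one_alg by blast
  then show ?thesis
    using that xd by blast
qed

subsection \<open>Normalizers\<close>

definition normalizer :: "'a oper \<Rightarrow> bool" where
  "normalizer n \<longleftrightarrow> n \<in> alg (carrier G) \<and> (\<forall>b\<in>alg S. n * b * adj n \<in> alg S \<and> adj n * b * n \<in> alg S)"

lemma normalizerD: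
  assumes "normalizer n"
  shows "n \<in> alg (carrier G)" "b \<in> alg S \<Longrightarrow> n * b * adj n \<in> alg S" "b \<in> alg S \<Longrightarrow> adj n * b * n \<in> alg S"
    "n * adj n \<in> alg S" "adj n * n \<in> alg S"
proof -
  show n: "n \<in> alg (carrier G)" and "b \<in> alg S \<Longrightarrow> n * b * adj n \<in> alg S" "b \<in> alg S \<Longrightarrow> adj n * b * n \<in> alg S"
    using assms by (auto simp: normalizer_def)
  have "n * delta \<one> * adj n \<in> alg S" "adj n * delta \<one> * n \<in> alg S"
    using assms delta_one_alg unfolding normalizer_def by blast+
  then show "n * adj n \<in> alg S" "adj n * n \<in> alg S"
    using n by simp_all
qed

lemma normalizer_adj: "normalizer n \<Longrightarrow> normalizer (adj n)"
  by (simp add: normalizer_def)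

lemma normalizer_mult:
  assumes n: "normalizer n" and m: "normalizer m"
  shows "normalizer (n * m)"
  unfolding normalizer_def
proof (intro conjI ballI)
  show "n * m \<in> alg (carrier G)"
    using normalizerD(1) n m by simp
  fix b assume b: "b \<in> alg S"
  show "n * m * b * adj (n * m) \<in> alg S"
    using normalizerD(2)[OF n normalizerD(2)[OF m b]] by (simp add: mult.assoc)
  show "adj (n * m) * b * (n * m) \<in> alg S"
    using normalizerD(3)[OF m normalizerD(3)[OF n b]] by (simp add: mult.assoc)
qed

text \<open>The inner factor \<open>n * adj n\<close> lies in the commutative \<open>alg S\<close>
  and can be moved past \<open>b\<close>. So conjugation by \<open>n\<close> is multiplicative up to
  the factor \<open>adj n * n\<close>.\<close>

lemma normalizer_mult_identity:
  assumes n: "normalizer n" and b: "b \<in> alg S" and b': "b' \<in> alg S"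
  shows "(adj n * b * n) * (adj n * b' * n) = (adj n * n) * (adj n * (b * b') * n)"
proof -
  have "(adj n * b * n) * (adj n * b' * n) = adj n * (b * (n * adj n)) * b' * n"
    by (simp add: mult.assoc)
  also have "b * (n * adj n) = (n * adj n) * b"
    by (rule alg_S_commute[OF b normalizerD(4)[OF n]])
  finally show ?thesis
    by (simp add: mult.assoc)
qed

lemma character_normalizer_mult:
  assumes x: "is_character x" and n: "normalizer n" and b: "b \<in> alg S" and b': "b' \<in> alg S"
  shows "x (adj n * b * n) * x (adj n * b' * n) = x (adj n * n) * x (adj n * (b * b') * n)"
  using arg_cong[OF normalizer_mult_identity[OF n b b'], of x] normalizerD[OF n] b b'
  by (simp add: character_simps[OF x])

text \<open>With \<open>b' = b\<close> in \<open>character_normalizer_mult\<close> the square of the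
  value is 0. This justifies the value 0 off the domain in \<open>weyl_map\<close>.\<close>

lemma character_normalizer_zero:
  assumes x: "is_character x" and n: "normalizer n" and b: "b \<in> alg S" and 0: "x (adj n * n) = 0"
  shows "x (adj n * b * n) = 0"
  using character_normalizer_mult[OF x n b b] 0 by simp

lemma character_transport:
  assumes x: "is_character x" and n: "normalizer n" and x0: "x (adj n * n) \<noteq> 0"
  shows "is_character (\<lambda>b. x (adj n * b * n) / x (adj n * n))"
  unfolding is_character_def
proof (intro conjI ballI allI)
  note nD = normalizerD[OF n]
  fix a b assume a: "a \<in> alg S" and b: "b \<in> alg S"
  show "x (adj n * (a + b) * n) / x (adj n * n) = x (adj n * a * n) / x (adj n * n) + x (adj n * b * n) / x (adj n * n)"
    using nD a b by (simp add: distrib_left distrib_right character_simps[OF x] add_divide_distrib)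
  show "x (adj n * (a * b) * n) / x (adj n * n) = x (adj n * a * n) / x (adj n * n) * (x (adj n * b * n) / x (adj n * n))"
    using character_normalizer_mult[OF x n a b] x0 by simp
next
  fix z a assume "a \<in> alg S"
  then show "x (adj n * (z \<star> a) * n) / x (adj n * n) = z * (x (adj n * a * n) / x (adj n * n))"
    using normalizerD[OF n] by (simp add: character_simps[OF x])
next
  have "adj n * delta \<one> * n = adj n * n"
    using normalizerD(1)[OF n] by simp
  then show "\<exists>b\<in>alg S. x (adj n * b * n) / x (adj n * n) \<noteq> 0"
    using x0 by (intro bexI[of _ "delta \<one>"]) auto
qed

text \<open>Used to show that transport by \<open>adj n\<close> undoes transport by
  \<open>n\<close>.\<close>

lemma character_transport_adj:
  assumes x: "is_character x" and n: "normalizer n" and b: "b \<in> alg S"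
  shows "x (adj n * (n * b * adj n) * n) = x (adj n * n) * x (adj n * n) * x b"
proof -
  have "adj n * (n * b * adj n) * n = (adj n * n) * b * (adj n * n)"
    by (simp add: mult.assoc)
  then show ?thesis
    using normalizerD[OF n] b by (simp add: character_simps[OF x])
qed

end

section \<open>Normalizers of the subalgebra near a given character\<close>

locale twisted_normal = twisted_trivial + normal S G
begin

text \<open>The source of the scalar in the formula for the induced action;
  \<open>induced_action_formula\<close> reads it off here.\<close>

lemma conj_delta:
  assumes g: "g \<in> carrier G" and s: "s \<in> S"
  shows "adj (delta g) * delta s * delta g =
    (cnj (c g (inv g)) * c (inv g) s * c (inv g \<otimes> s) g) \<star> delta (inv g \<otimes> s \<otimes> g)"
  using g s by (simp add: adj_delta delta_mult mult.assoc)

lemma normalizer_delta: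
  assumes g: "g \<in> carrier G"
  shows "normalizer (delta g)"
proof -
  have conj: "adj (delta h) * b * delta h \<in> alg S" if h: "h \<in> carrier G" and b: "b \<in> alg S" for h b
    using b
  proof (induction rule: alg_induct)
    case closed
    show ?case
      by (intro closed_Collect_mem closed_alg continuous_intros)
  next
    case (delta s)
    then show ?case
      using h inv_op_closed1 by (simp add: conj_delta)
  qed (simp_all add: distrib_left distrib_right)
  \<comment> \<open>The adjoint of \<open>delta (inv g)\<close> is a unimodular multiple of
    \<open>delta g\<close>, so up to scalars this is the conjugation already treated, with
    \<open>inv g\<close> in place of \<open>g\<close>.\<close>
  have "delta g * b * adj (delta g) \<in> alg S" if b: "b \<in> alg S" for b
  proof -
    have "adj (delta (inv g)) = cnj (c (inv g) g) \<star> delta g"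
      using g adj_delta[of "inv g"] by simp
    then have "delta g * b * adj (delta g) = (cnj (c g (inv g)) * c (inv g) g) \<star> (adj (delta (inv g)) * b * delta (inv g))"
      using g cnj_c[of "inv g" g] by (simp add: adj_delta mult.assoc mult.commute[of "c (inv g) g"])
    then show ?thesis
      using conj[of "inv g" b] g b by simp
  qed
  then show ?thesis
    unfolding normalizer_def using g conj by auto
qed

text \<open>Put \<open>m = adj (delta g) * n\<close>. Taking expectations in
  \<open>m * (adj m * d * m) = (m * adj m * d) * m\<close>, where both brackets lie in
  \<open>alg S\<close>, and applying \<open>x\<close>, one can cancel \<open>x (expect m)\<close>.
  The case \<open>d = delta \<one>\<close> identifies \<open>x (m * adj m)\<close> with
  \<open>x (adj n * n)\<close>, and \<open>d = adj (delta g) * b * delta g\<close> gives the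
  claim.\<close>

lemma normalizer_local_form:
  assumes x: "is_character x" and n: "normalizer n" and g: "g \<in> carrier G"
    and e: "x (expect (adj (delta g) * n)) \<noteq> 0" and b: "b \<in> alg S"
  shows "x (adj n * b * n) = x (adj (delta g) * b * delta g) * x (adj n * n)"
proof -
  define m where "m = adj (delta g) * n"
  have m: "normalizer m"
    unfolding m_def by (intro normalizer_mult normalizer_adj normalizer_delta g n)
  note mD = normalizerD[OF m]
  have "delta g * (adj (delta g) * n) = n"
    using delta_unitary(2)[OF g] normalizerD(1)[OF n] by (simp flip: mult.assoc)
  then have gm1: "delta g * m = n"
    by (simp add: m_def)
  note gm = gm1 arg_cong[OF gm1, of adj, unfolded adj_simps(3)]
  have key: "x (m * adj m) * x d = x (adj m * d * m)" if d: "d \<in> alg S" for d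
  proof -
    have "expect (m * (adj m * d * m)) = expect (m * adj m * d * m)"
      by (simp add: mult.assoc)
    then have "expect m * (adj m * d * m) = (m * adj m * d) * expect m"
      using mD d by (simp add: expect_mult_right expect_mult_left)
    from arg_cong[OF this, of x] show ?thesis
      using mD d e by (simp add: character_simps[OF x] m_def[symmetric])
  qed
  have mm: "adj m * m = adj n * n"
  proof -
    have "adj m * m = adj m * (adj (delta g) * delta g) * m"
      using mD(1) delta_unitary(1)[OF g] by simp
    also have "\<dots> = (adj m * adj (delta g)) * (delta g * m)"
      by (simp only: mult.assoc)
    finally show ?thesis
      by (simp only: gm)
  qed
  have "adj m * delta \<one> * m = adj m * m"
    using mD(1) by simp
  then have one: "x (m * adj m) = x (adj n * n)"
    using key[of "delta \<one>"] by (simp add: character_simps[OF x] mm)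
  have "adj m * (adj (delta g) * b * delta g) * m = (adj m * adj (delta g)) * b * (delta g * m)"
    by (simp only: mult.assoc)
  then have "adj m * (adj (delta g) * b * delta g) * m = adj n * b * n"
    by (simp only: gm)
  then show ?thesis
    using key[OF normalizerD(3)[OF normalizer_delta[OF g] b]] one by (simp add: mult.commute)
qed

text \<open>Otherwise \<open>x (expect (adj n' * n))\<close> vanishes for every
  \<open>n' = delta g\<close>, hence, being conjugate-linear and continuous in \<open>n'\<close>,
  for all \<open>n'\<close> in the algebra; at \<open>n' = n\<close> it equals
  \<open>x (adj n * n)\<close>.\<close>

lemma normalizer_local_exists:
  assumes x: "is_character x" and n: "normalizer n" and x0: "x (adj n * n) \<noteq> 0"
  obtains g where "g \<in> carrier G" "x (expect (adj (delta g) * n)) \<noteq> 0"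
proof (rule ccontr)
  assume "\<not> thesis"
  then have zero: "x (expect (adj (delta g) * n)) = 0" if "g \<in> carrier G" for g
    using that \<open>\<And>g. \<lbrakk>g \<in> carrier G; x (expect (adj (delta g) * n)) \<noteq> 0\<rbrakk> \<Longrightarrow> thesis\<close> by blast
  note nD = normalizerD[OF n]
  have "n \<in> alg (carrier G) \<and> x (expect (adj n' * n)) = 0" if "n' \<in> alg (carrier G)" for n'
  proof -
    have "n' \<in> alg (carrier G) \<and> x (expect (adj n' * n)) = 0"
      using that
    proof (induction rule: alg_induct)
      case closed
      show ?case
        using nD(1) by (intro closed_Collect_character[OF x closed_alg] continuous_intros) simp
    qed (use nD(1) in \<open>simp_all add: zero distrib_right character_simps[OF x]\<close>)
    then show ?thesis
      using nD(1) by blast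
  qed
  from this[OF nD(1)] show False
    using x0 nD by simp
qed

end

lemma continuous_map_euclidean_iff:
  "continuous_map X euclidean f \<longleftrightarrow> (\<forall>x\<in>topspace X. (f \<longlongrightarrow> f x) (atin X x))"
  by (simp add: continuous_map_atin)

lemma eventually_atin_topspace: "\<forall>\<^sub>F x in atin X a. x \<in> topspace X"
  unfolding eventually_atin by (auto intro: exI[of _ "topspace X"])

section \<open>Translation to the concrete reduced algebra\<close>

context twisted_normal
begin

abbreviation "cop \<equiv> conc (carrier G)"
abbreviation "RA \<equiv> reduced_algebra G c"
abbreviation "RB \<equiv> reduced_set G c S"
abbreviation "spec \<equiv> spectrum (reduced_algebra G c) (reduced_set G c S)"
abbreviation "spec_top \<equiv> spectrum_topology (reduced_algebra G c) (reduced_set G c S)"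

lemma RB_eq: "RB = cop ` alg S"
  by (rule reduced_set_eq[OF subset])

lemma RA_simps:
  "carrier RA = cop ` alg (carrier G)" "zero RA = cop 0"
  "add RA (cop a) (cop b) = cop (a + b)" "smult RA z (cop a) = cop (z \<star> a)"
  "b \<in> alg (carrier G) \<Longrightarrow> monoid.mult RA (cop a) (cop b) = cop (a * b)"
  "a \<in> alg (carrier G) \<Longrightarrow> star RA (cop a) = cop (adj a)"
  "a \<in> alg (carrier G) \<Longrightarrow> alg_norm RA (cop a) = norm a"
  using alg_corner l2_operators_simps[of "carrier G"] l2_operators_mult[of b "carrier G" a]
    star_conc[of a "carrier G"] alg_norm_conc[of a "carrier G"]
  by (auto simp: reduced_algebra_def reduced_set_eq)

lemma cop_eq_iff [simp]: "a \<in> alg (carrier G) \<Longrightarrow> b \<in> alg (carrier G) \<Longrightarrow> cop a = cop b \<longleftrightarrow> a = b"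
  using inj_on_conc alg_corner by (metis inj_onD subsetD)

lemma cop_mem_iff: "a \<in> alg (carrier G) \<Longrightarrow> cop a \<in> RB \<longleftrightarrow> a \<in> alg S"
  unfolding RB_eq by auto

lemma Ball_RB: "(\<forall>b\<in>RB. Q b) \<longleftrightarrow> (\<forall>a\<in>alg S. Q (cop a))"
  by (simp add: RB_eq)

lemma spectrum_iff: "x \<in> spec \<longleftrightarrow> x \<in> extensional RB \<and> is_character (\<lambda>a. x (cop a))"
  unfolding spectrum_def is_character_def RB_eq by (auto simp: RA_simps)

lemma spectrum_eqI:
  assumes "x \<in> spec" "y \<in> spec" "\<And>a. a \<in> alg S \<Longrightarrow> x (cop a) = y (cop a)"
  shows "x = y"
proof (rule extensionalityI[of x RB y])
  show "x \<in> extensional RB" "y \<in> extensional RB"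
    using assms(1,2) spectrum_iff by blast+
  show "x b = y b" if "b \<in> RB" for b
    using that assms(3) unfolding RB_eq by blast
qed

text \<open>Carries a functional on \<open>alg S\<close> over to the concrete algebra; restriction
  to \<open>RB\<close> makes it extensional, as \<open>spectrum\<close> requires.\<close>

definition transfer_fun :: "('a oper \<Rightarrow> complex) \<Rightarrow> 'a l2_op \<Rightarrow> complex" where
  "transfer_fun x = (\<lambda>b\<in>RB. x (inv_into (alg S) cop b))"

lemma transfer_fun_cop: "a \<in> alg S \<Longrightarrow> transfer_fun x (cop a) = x a"
proof -
  assume a: "a \<in> alg S"
  have "inj_on cop (alg S)"
    by (rule inj_onI) simp
  then show ?thesis
    using a by (simp add: transfer_fun_def RB_eq)
qed

lemma transfer_fun_spec:
  assumes "is_character x"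
  shows "transfer_fun x \<in> spec"
  unfolding spectrum_iff
proof
  show "transfer_fun x \<in> extensional RB"
    by (simp add: transfer_fun_def)
  show "is_character (\<lambda>a. transfer_fun x (cop a))"
    using assms unfolding is_character_def by (simp add: transfer_fun_cop)
qed

lemma normalizers_eq: "normalizers RA RB = cop ` {n. normalizer n}"
proof -
  have "cop n \<in> normalizers RA RB \<longleftrightarrow> normalizer n" if n: "n \<in> alg (carrier G)" for n
    using n unfolding normalizers_def normalizer_def Ball_RB by (simp add: RA_simps cop_mem_iff)
  moreover have "normalizers RA RB \<subseteq> cop ` alg (carrier G)"
    by (auto simp: normalizers_def RA_simps)
  ultimately show ?thesis
    using normalizerD(1) by blast
qed

subsection \<open>The spectrum as the dual group\<close>

lemma topspace_dual [simp]: "topspace (dual_topology G S) = dual_group G S"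
  by (auto simp: dual_topology_def dual_group_def intro: extensional_arb)

lemma topspace_spec [simp]: "topspace spec_top = spec"
proof -
  have "spec \<subseteq> extensional RB"
    using spectrum_iff by blast
  then show ?thesis
    unfolding spectrum_topology_def topspace_subtopology topspace_product_topology by (auto simp: PiE_def)
qed

text \<open>The inverse of \<open>Psi\<close> in explicit form. It agrees with
  \<open>Psi_inv\<close> on the spectrum by \<open>Psi_inv_eq\<close>, and its coordinates are
  visibly continuous.\<close>

definition restrict_dual :: "('a l2_op \<Rightarrow> complex) \<Rightarrow> 'a \<Rightarrow> complex" where
  "restrict_dual x = (\<lambda>s\<in>S. x (cop (delta s)))"

lemma restrict_dual_mem: "x \<in> spec \<Longrightarrow> restrict_dual x \<in> dual_group G S"
  unfolding restrict_dual_def by (rule character_delta) (simp add: spectrum_iff)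

lemma spectrum_eq_deltaI:
  assumes "x \<in> spec" "y \<in> spec" "\<And>s. s \<in> S \<Longrightarrow> x (cop (delta s)) = y (cop (delta s))"
  shows "x = y"
proof (rule spectrum_eqI[OF assms(1,2)])
  have "is_character (\<lambda>a. x (cop a))" "is_character (\<lambda>a. y (cop a))"
    using assms(1,2) by (simp_all add: spectrum_iff)
  then show "x (cop a) = y (cop a)" if "a \<in> alg S" for a
    using assms(3) that by (rule character_eqI)
qed

lemma left_regular_cop: "f \<in> finsupp S \<Longrightarrow> left_regular G c f = cop (regular f)"
  by (rule left_regular_eq) (use subset in \<open>auto simp: finsupp_def\<close>)

lemma Psi_props:
  assumes \<nu>: "\<nu> \<in> dual_group G S"
  shows "Psi G c S \<nu> \<in> spec" "s \<in> S \<Longrightarrow> Psi G c S \<nu> (cop (delta s)) = \<nu> s"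
    "f \<in> finsupp S \<Longrightarrow> Psi G c S \<nu> (left_regular G c f) = (\<Sum>s | f s \<noteq> 0. f s * \<nu> s)"
proof -
  obtain x where x: "is_character x" and xd: "\<And>s. s \<in> S \<Longrightarrow> x (delta s) = \<nu> s"
    using character_exists[OF \<nu>] by blast
  define p where "p = transfer_fun x"
  have p: "p \<in> spec" "\<And>s. s \<in> S \<Longrightarrow> p (cop (delta s)) = \<nu> s"
    using transfer_fun_spec[OF x] by (simp_all add: p_def transfer_fun_cop xd)
  have pf: "p (left_regular G c f) = (\<Sum>s | f s \<noteq> 0. f s * \<nu> s)" if f: "f \<in> finsupp S" for f
  proof -
    have "p (left_regular G c f) = (\<Sum>s | f s \<noteq> 0. f s * p (cop (delta s)))"
      using character_regular[of "\<lambda>a. p (cop a)" f] p(1) f by (simp add: left_regular_cop spectrum_iff)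
    also have "\<dots> = (\<Sum>s | f s \<noteq> 0. f s * \<nu> s)"
      using f by (intro sum.cong refl) (auto simp: p(2) finsupp_def)
    finally show ?thesis .
  qed
  have "Psi G c S \<nu> = p"
    unfolding Psi_def
  proof (rule the_equality)
    show "p \<in> spec \<and> (\<forall>b\<in>finsupp S. p (left_regular G c b) = (\<Sum>s | b s \<noteq> 0. b s * \<nu> s))"
      using p(1) pf by blast
    fix y assume y: "y \<in> spec \<and> (\<forall>b\<in>finsupp S. y (left_regular G c b) = (\<Sum>s | b s \<noteq> 0. b s * \<nu> s))"
    show "y = p"
    proof (rule spectrum_eq_deltaI)
      fix s assume s: "s \<in> S"
      have "cop (delta s) = left_regular G c (point_mass s)"
        by (simp add: left_regular_cop point_mass_finsupp s regular_point_mass)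
      then show "y (cop (delta s)) = p (cop (delta s))"
        using y pf point_mass_finsupp[OF s] by simp
    qed (use y p in auto)
  qed
  with p pf show "Psi G c S \<nu> \<in> spec" "s \<in> S \<Longrightarrow> Psi G c S \<nu> (cop (delta s)) = \<nu> s"
    "f \<in> finsupp S \<Longrightarrow> Psi G c S \<nu> (left_regular G c f) = (\<Sum>s | f s \<noteq> 0. f s * \<nu> s)"
    by auto
qed

lemma restrict_Psi: "\<nu> \<in> dual_group G S \<Longrightarrow> restrict_dual (Psi G c S \<nu>) = \<nu>"
  by (rule extensionalityI[of _ S]) (auto simp: restrict_dual_def Psi_props(2) dual_group_def)

lemma Psi_restrict: "x \<in> spec \<Longrightarrow> Psi G c S (restrict_dual x) = x"
  by (rule spectrum_eq_deltaI) (auto simp: Psi_props restrict_dual_mem, simp add: restrict_dual_def)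

lemma Psi_inv_eq:
  assumes "x \<in> spec"
  shows "Psi_inv G c S x = restrict_dual x"
proof -
  have "inj_on (Psi G c S) (dual_group G S)"
    by (rule inj_on_inverseI[of _ restrict_dual]) (rule restrict_Psi)
  then show ?thesis
    unfolding Psi_inv_def using inv_into_f_f[of "Psi G c S" _ "restrict_dual x"] assms
    by (simp add: restrict_dual_mem Psi_restrict)
qed

lemma continuous_map_dual_coordinate: "s \<in> S \<Longrightarrow> continuous_map (dual_topology G S) euclidean (\<lambda>\<nu>. \<nu> s)"
  unfolding dual_topology_def by (intro continuous_map_from_subtopology continuous_map_product_projection)

lemma continuous_map_spec_coordinate: "a \<in> alg S \<Longrightarrow> continuous_map spec_top euclidean (\<lambda>x. x (cop a))"
  unfolding spectrum_topology_def
  by (intro continuous_map_from_subtopology continuous_map_product_projection) (simp add: RB_eq)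

lemma continuous_map_spec_iff:
  "continuous_map X spec_top f \<longleftrightarrow> f ` topspace X \<subseteq> spec \<and>
    (\<forall>a\<in>alg S. continuous_map X euclidean (\<lambda>x. f x (cop a)))"
proof -
  have "spec \<subseteq> extensional RB"
    using spectrum_iff by blast
  then show ?thesis
    unfolding spectrum_topology_def continuous_map_in_subtopology continuous_map_componentwise Ball_RB
      image_subset_iff Pi_iff by blast
qed

lemma continuous_map_dual_iff:
  "continuous_map X (dual_topology G S) f \<longleftrightarrow> f ` topspace X \<subseteq> dual_group G S \<and>
    (\<forall>s\<in>S. continuous_map X euclidean (\<lambda>x. f x s))"
proof -
  have "dual_group G S \<subseteq> extensional S"
    by (auto simp: dual_group_def)
  then show ?thesis
    unfolding dual_topology_def continuous_map_in_subtopology continuous_map_componentwise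
      image_subset_iff Pi_iff by blast
qed

text \<open>Characters are contractive, so a finitely supported \<open>f\<close> with
  \<open>regular f\<close> close to \<open>a\<close> approximates the value at \<open>a\<close>
  uniformly in \<nu>. For \<open>f\<close> the value is a finite sum of coordinates, and the
  estimate splits into three parts below \<open>e / 3\<close>.\<close>

lemma continuous_map_Psi_coordinate:
  assumes a: "a \<in> alg S"
  shows "continuous_map (dual_topology G S) euclidean (\<lambda>\<nu>. Psi G c S \<nu> (cop a))"
  unfolding continuous_map_euclidean_iff
proof (intro ballI tendstoI)
  fix \<nu>0 e assume "\<nu>0 \<in> topspace (dual_topology G S)" and e: "0 < (e :: real)"
  then have \<nu>0: "\<nu>0 \<in> dual_group G S" by simp
  obtain f where f: "f \<in> finsupp S" "dist (regular f) a < e / 3"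
    using a e unfolding alg_def closure_approachable by (metis (no_types, lifting) imageE zero_less_divide_iff zero_less_numeral)
  define h where "h \<nu> = (\<Sum>s | f s \<noteq> 0. f s * \<nu> s)" for \<nu> :: "'a \<Rightarrow> complex"
  have close: "dist (Psi G c S \<nu> (cop a)) (h \<nu>) < e / 3" if \<nu>: "\<nu> \<in> dual_group G S" for \<nu>
  proof -
    have x: "is_character (\<lambda>a. Psi G c S \<nu> (cop a))"
      using Psi_props(1)[OF \<nu>] by (simp add: spectrum_iff)
    have "dist (Psi G c S \<nu> (cop a)) (h \<nu>) = cmod (Psi G c S \<nu> (cop (a - regular f)))"
      using character_simps(4)[OF x a regular_alg[OF f(1)]] Psi_props(3)[OF \<nu> f(1)] f(1)
      by (simp add: dist_norm h_def left_regular_cop)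
    also have "\<dots> \<le> norm (a - regular f)"
      using character_le[OF x] a regular_alg[OF f(1)] by simp
    also have "\<dots> < e / 3"
      using f(2) by (simp add: dist_norm norm_minus_commute)
    finally show ?thesis .
  qed
  have "(h \<longlongrightarrow> h \<nu>0) (atin (dual_topology G S) \<nu>0)"
    unfolding h_def
  proof (intro tendsto_intros)
    fix s assume "s \<in> {s. f s \<noteq> 0}"
    then have "s \<in> S"
      using f(1) by (auto simp: finsupp_def)
    then show "((\<lambda>\<nu>. \<nu> s) \<longlongrightarrow> \<nu>0 s) (atin (dual_topology G S) \<nu>0)"
      using continuous_map_dual_coordinate \<nu>0 unfolding continuous_map_euclidean_iff by simp
  qed
  then have "\<forall>\<^sub>F \<nu> in atin (dual_topology G S) \<nu>0. dist (h \<nu>) (h \<nu>0) < e / 3"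
    using e by (intro tendstoD) simp_all
  with eventually_atin_topspace
  show "\<forall>\<^sub>F \<nu> in atin (dual_topology G S) \<nu>0. dist (Psi G c S \<nu> (cop a)) (Psi G c S \<nu>0 (cop a)) < e"
  proof eventually_elim
    case (elim \<nu>)
    then show ?case
      using close[of \<nu>] close[OF \<nu>0] dist_triangle[of "Psi G c S \<nu> (cop a)" "Psi G c S \<nu>0 (cop a)" "h \<nu>"]
        dist_triangle[of "h \<nu>" "Psi G c S \<nu>0 (cop a)" "h \<nu>0"]
      by (simp add: dist_commute)
  qed
qed

lemma homeomorphic_maps_Psi: "homeomorphic_maps (dual_topology G S) spec_top (Psi G c S) restrict_dual"
  unfolding homeomorphic_maps_def
proof (intro conjI ballI)
  show "continuous_map (dual_topology G S) spec_top (Psi G c S)"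
    by (auto simp: continuous_map_spec_iff Psi_props(1) continuous_map_Psi_coordinate)
  show "continuous_map spec_top (dual_topology G S) restrict_dual"
    by (auto simp: continuous_map_dual_iff restrict_dual_mem)
      (simp add: restrict_dual_def continuous_map_spec_coordinate)
qed (simp_all add: restrict_Psi Psi_restrict)

subsection \<open>The Weyl maps\<close>

text \<open>Nonvanishing replaces the positivity in \<open>weyl_dom\<close>; for normalizers the two
  agree by \<open>weyl_dom_eq\<close>.\<close>

definition wdom :: "'a oper \<Rightarrow> ('a l2_op \<Rightarrow> complex) set" where
  "wdom n = {x \<in> spec. x (cop (adj n * n)) \<noteq> 0}"

text \<open>The transported character in explicit form, which \<open>weyl_map_eq\<close> identifies
  with the map fixed by the definite description in \<open>weyl_map\<close>.\<close>

definition wmap :: "'a oper \<Rightarrow> ('a l2_op \<Rightarrow> complex) \<Rightarrow> 'a l2_op \<Rightarrow> complex" where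
  "wmap n = (\<lambda>x\<in>wdom n. transfer_fun (\<lambda>a. x (cop (adj n * a * n)) / x (cop (adj n * n))))"

lemma spec_character: "x \<in> spec \<Longrightarrow> is_character (\<lambda>a. x (cop a))"
  by (simp add: spectrum_iff)

lemma wmap_spec: "normalizer n \<Longrightarrow> x \<in> wdom n \<Longrightarrow> wmap n x \<in> spec"
  using character_transport[OF spec_character] by (auto simp: wmap_def wdom_def intro!: transfer_fun_spec)

lemma wmap_cop: "x \<in> wdom n \<Longrightarrow> a \<in> alg S \<Longrightarrow> wmap n x (cop a) = x (cop (adj n * a * n)) / x (cop (adj n * n))"
  by (simp add: wmap_def transfer_fun_cop)

lemma wdom_subset: "wdom n \<subseteq> spec"
  by (auto simp: wdom_def)

lemma openin_wdom:
  assumes "normalizer n"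
  shows "openin spec_top (wdom n)"
proof -
  have "openin spec_top {x \<in> topspace spec_top. x (cop (adj n * n)) \<in> - {0}}"
    by (rule openin_continuous_map_preimage[OF continuous_map_spec_coordinate])
      (use normalizerD(5)[OF assms] in \<open>auto simp: open_Compl\<close>)
  then show ?thesis
    by (simp add: wdom_def)
qed

text \<open>The value of \<open>wmap n x\<close> at \<open>n * adj n\<close> is again
  \<open>x (cop (adj n * n))\<close>, so all denominators cancel against the factors in
  \<open>character_transport_adj\<close>.\<close>

lemma wmap_inverse:
  assumes n: "normalizer n" and x: "x \<in> wdom n"
  shows "wmap n x \<in> wdom (adj n)" "wmap (adj n) (wmap n x) = x"
proof -
  note nD = normalizerD[OF n]
  have xs: "x \<in> spec" "x (cop (adj n * n)) \<noteq> 0"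
    using x by (auto simp: wdom_def)
  have tr: "x (cop (adj n * (n * b * adj n) * n)) = x (cop (adj n * n)) * x (cop (adj n * n)) * x (cop b)" if "b \<in> alg S" for b
    using character_transport_adj[OF spec_character[OF xs(1)] n that] .
  have one: "x (cop (delta \<one>)) = 1"
    using character_simps(6)[OF spec_character[OF xs(1)]] .
  have "n * delta \<one> * adj n = n * adj n"
    using nD(1) by simp
  then have nn: "wmap n x (cop (n * adj n)) = x (cop (adj n * n))"
    using tr[of "delta \<one>"] one xs(2) nD(4) by (simp add: wmap_cop[OF x])
  then show dom: "wmap n x \<in> wdom (adj n)"
    using wmap_spec[OF n x] xs(2) by (simp add: wdom_def)
  show "wmap (adj n) (wmap n x) = x"
  proof (rule spectrum_eqI)
    show "wmap (adj n) (wmap n x) \<in> spec"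
      by (rule wmap_spec[OF normalizer_adj[OF n] dom])
    fix a assume a: "a \<in> alg S"
    then show "wmap (adj n) (wmap n x) (cop a) = x (cop a)"
      using tr[OF a] xs(2) nD(2)[OF a] nn by (simp add: wmap_cop[OF dom] wmap_cop[OF x])
  qed (rule xs(1))
qed

lemma continuous_map_wmap:
  assumes n: "normalizer n"
  shows "continuous_map (subtopology spec_top (wdom n)) (subtopology spec_top (wdom (adj n))) (wmap n)"
  unfolding continuous_map_in_subtopology continuous_map_spec_iff
proof (intro conjI ballI)
  have top: "topspace (subtopology spec_top (wdom n)) = wdom n"
    using wdom_subset by auto
  show "wmap n \<in> topspace (subtopology spec_top (wdom n)) \<rightarrow> wdom (adj n)"
    "wmap n ` topspace (subtopology spec_top (wdom n)) \<subseteq> spec"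
    using wmap_inverse(1)[OF n] wmap_spec[OF n] by (auto simp: top)
  fix a assume a: "a \<in> alg S"
  have co: "continuous_map (subtopology spec_top (wdom n)) euclidean (\<lambda>x. x (cop b))" if "b \<in> alg S" for b
    by (rule continuous_map_from_subtopology[OF continuous_map_spec_coordinate[OF that]])
  have "continuous_map (subtopology spec_top (wdom n)) euclidean
      (\<lambda>x. x (cop (adj n * a * n)) / x (cop (adj n * n)))"
    unfolding continuous_map_euclidean_iff top
    using co[OF normalizerD(3)[OF n a]] co[OF normalizerD(5)[OF n]]
    unfolding continuous_map_euclidean_iff top by (auto intro!: tendsto_divide simp: wdom_def)
  then show "continuous_map (subtopology spec_top (wdom n)) euclidean (\<lambda>x. wmap n x (cop a))"
    by (rule continuous_map_eq) (simp add: wmap_cop a top)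
qed

lemma weyl_dom_eq:
  assumes n: "normalizer n"
  shows "weyl_dom RA RB (cop n) = wdom n"
proof -
  have "x (cop (adj n * n)) \<in> \<real> \<and> 0 < Re (x (cop (adj n * n))) \<longleftrightarrow> x (cop (adj n * n)) \<noteq> 0" if "x \<in> spec" for x
    using character_positive[OF spec_character[OF that] normalizerD(1)[OF n] normalizerD(5)[OF n]]
    by (auto simp: complex_is_Real_iff complex_eq_iff)
  then show ?thesis
    using normalizerD(1)[OF n] by (auto simp: weyl_dom_def wdom_def RA_simps)
qed

lemma weyl_map_eq:
  assumes n: "normalizer n"
  shows "weyl_map RA RB (cop n) = wmap n"
  unfolding weyl_map_def
proof (rule the_equality)
  note nD = normalizerD[OF n]
  have star: "star RA (cop n) = cop (adj n)"
    using nD(1) by (simp add: RA_simps)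
  have prod: "monoid.mult RA (star RA (cop n)) (cop n) = cop (adj n * n)"
    using nD(1) by (simp add: RA_simps)
  have prod3: "monoid.mult RA (monoid.mult RA (star RA (cop n)) (cop a)) (cop n) = cop (adj n * a * n)" if "a \<in> alg S" for a
    using nD(1) that by (simp add: RA_simps)
  have doms: "weyl_dom RA RB (cop n) = wdom n" "weyl_dom RA RB (star RA (cop n)) = wdom (adj n)"
    using weyl_dom_eq[OF n] weyl_dom_eq[OF normalizer_adj[OF n]] by (simp_all add: star)
  have tops: "topspace (subtopology spec_top (wdom m)) = wdom m" for m
    using wdom_subset by auto
  show "wmap n \<in> extensional (weyl_dom RA RB (cop n)) \<and>
    homeomorphic_map (subtopology spec_top (weyl_dom RA RB (cop n)))
      (subtopology spec_top (weyl_dom RA RB (star RA (cop n)))) (wmap n) \<and>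
    (\<forall>b\<in>RB. \<forall>x\<in>spec. x (monoid.mult RA (monoid.mult RA (star RA (cop n)) b) (cop n)) =
      (if x \<in> weyl_dom RA RB (cop n) then wmap n x b * x (monoid.mult RA (star RA (cop n)) (cop n)) else 0))"
  proof (intro conjI ballI)
    show "wmap n \<in> extensional (weyl_dom RA RB (cop n))"
      by (simp add: doms wmap_def)
    have "homeomorphic_maps (subtopology spec_top (wdom n)) (subtopology spec_top (wdom (adj n))) (wmap n) (wmap (adj n))"
      unfolding homeomorphic_maps_def tops
      using continuous_map_wmap[OF n] continuous_map_wmap[OF normalizer_adj[OF n]]
        wmap_inverse[OF n] wmap_inverse[OF normalizer_adj[OF n]] by simp
    then show "homeomorphic_map (subtopology spec_top (weyl_dom RA RB (cop n)))
      (subtopology spec_top (weyl_dom RA RB (star RA (cop n)))) (wmap n)"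
      unfolding doms by (rule homeomorphic_maps_imp_map)
    fix b x assume "b \<in> RB" and x: "x \<in> spec"
    then obtain a where a: "a \<in> alg S" "b = cop a"
      by (auto simp: RB_eq)
    show "x (monoid.mult RA (monoid.mult RA (star RA (cop n)) b) (cop n)) =
      (if x \<in> weyl_dom RA RB (cop n) then wmap n x b * x (monoid.mult RA (star RA (cop n)) (cop n)) else 0)"
    proof (cases "x \<in> wdom n")
      case True
      then show ?thesis
        using wmap_cop[OF True a(1)] by (simp add: doms a(2) prod prod3[OF a(1)] wdom_def)
    next
      case False
      then have "x (cop (adj n * n)) = 0"
        using x by (simp add: wdom_def)
      then show ?thesis
        using False character_normalizer_zero[OF spec_character[OF x] n a(1)]
        by (simp add: doms a(2) prod3[OF a(1)])
    qed
  qed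
  fix f assume f: "f \<in> extensional (weyl_dom RA RB (cop n)) \<and>
    homeomorphic_map (subtopology spec_top (weyl_dom RA RB (cop n)))
      (subtopology spec_top (weyl_dom RA RB (star RA (cop n)))) f \<and>
    (\<forall>b\<in>RB. \<forall>x\<in>spec. x (monoid.mult RA (monoid.mult RA (star RA (cop n)) b) (cop n)) =
      (if x \<in> weyl_dom RA RB (cop n) then f x b * x (monoid.mult RA (star RA (cop n)) (cop n)) else 0))"
  show "f = wmap n"
  proof (rule extensionalityI)
    show "f \<in> extensional (wdom n)" "wmap n \<in> extensional (wdom n)"
      using f by (simp_all add: doms wmap_def)
    fix x assume x: "x \<in> wdom n"
    \<comment> \<open>The homeomorphism clause is what puts \<open>f x\<close> in the spectrum; its
      values are then found by dividing by the nonzero \<open>x (cop (adj n * n))\<close>.\<close>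
    have "f ` wdom n = wdom (adj n)"
      using f homeomorphic_imp_surjective_map unfolding doms tops by (metis tops)
    then have fx: "f x \<in> spec"
      using x wdom_subset by blast
    show "f x = wmap n x"
    proof (rule spectrum_eqI[OF fx wmap_spec[OF n x]])
      fix a assume a: "a \<in> alg S"
      then have "cop a \<in> RB"
        by (simp add: RB_eq)
      moreover have "x \<in> spec"
        using x wdom_subset by blast
      ultimately have "x (monoid.mult RA (monoid.mult RA (star RA (cop n)) (cop a)) (cop n)) =
          (if x \<in> weyl_dom RA RB (cop n) then f x (cop a) * x (monoid.mult RA (star RA (cop n)) (cop n)) else 0)"
        using f by blast
      then have "x (monoid.mult RA (monoid.mult RA (star RA (cop n)) (cop a)) (cop n)) =
          f x (cop a) * x (monoid.mult RA (star RA (cop n)) (cop n))"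
        using x by (simp only: doms if_True)
      then have "x (cop (adj n * a * n)) = f x (cop a) * x (cop (adj n * n))"
        unfolding prod prod3[OF a] .
      then show "f x (cop a) = wmap n x (cop a)"
        using x by (simp add: wmap_cop[OF x a] wdom_def)
    qed
  qed
qed

lemma wmap_mult:
  assumes n: "normalizer n" and m: "normalizer m" and x: "x \<in> wdom m" and y: "wmap m x \<in> wdom n"
  shows "x \<in> wdom (n * m)" "wmap (n * m) x = wmap n (wmap m x)"
proof -
  have xs: "x \<in> spec" "x (cop (adj m * m)) \<noteq> 0"
    using x by (auto simp: wdom_def)
  have nm: "adj (n * m) * (n * m) = adj m * (adj n * n) * m" "adj (n * m) * a * (n * m) = adj m * (adj n * a * n) * m" for a
    by (simp_all add: mult.assoc)
  have 1: "wmap m x (cop (adj n * n)) = x (cop (adj (n * m) * (n * m))) / x (cop (adj m * m))"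
    unfolding nm by (rule wmap_cop[OF x normalizerD(5)[OF n]])
  then show dom: "x \<in> wdom (n * m)"
    using y xs by (auto simp: wdom_def)
  show "wmap (n * m) x = wmap n (wmap m x)"
  proof (rule spectrum_eqI[OF wmap_spec[OF normalizer_mult[OF n m] dom] wmap_spec[OF n y]])
    fix a assume a: "a \<in> alg S"
    have "wmap m x (cop (adj n * a * n)) = x (cop (adj (n * m) * a * (n * m))) / x (cop (adj m * m))"
      unfolding nm by (rule wmap_cop[OF x normalizerD(3)[OF n a]])
    then show "wmap (n * m) x (cop a) = wmap n (wmap m x) (cop a)"
      using 1 xs(2) by (simp add: wmap_cop[OF dom a] wmap_cop[OF y a])
  qed
qed

lemma wdom_delta [simp]:
  assumes g: "g \<in> carrier G"
  shows "wdom (delta g) = spec"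
proof -
  have "x (cop (delta \<one>)) \<noteq> 0" if "x \<in> spec" for x
    using character_simps(6)[OF spec_character[OF that]] by simp
  then show ?thesis
    unfolding wdom_def delta_unitary(1)[OF g] by blast
qed

lemma wmap_delta:
  assumes g: "g \<in> carrier G" and x: "x \<in> spec" and a: "a \<in> alg S"
  shows "wmap (delta g) x (cop a) = x (cop (adj (delta g) * a * delta g))"
  using wmap_cop[of x "delta g" a] assms character_simps(6)[OF spec_character[OF x]] by (simp add: delta_unitary)

lemma wmap_delta_spec [simp]: "g \<in> carrier G \<Longrightarrow> x \<in> spec \<Longrightarrow> wmap (delta g) x \<in> spec"
  using wmap_spec[OF normalizer_delta] by simp

text \<open>\<open>delta g * delta h\<close> and \<open>delta (g \<otimes> h)\<close> differ by a
  unimodular scalar, which cancels in conjugation. So the cocycle does not disturb the action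
  property.\<close>

lemma wmap_delta_mult:
  assumes g: "g \<in> carrier G" and h: "h \<in> carrier G" and x: "x \<in> spec"
  shows "wmap (delta (g \<otimes> h)) x = wmap (delta g) (wmap (delta h) x)"
proof (rule spectrum_eqI)
  fix a assume a: "a \<in> alg S"
  have "adj (delta g * delta h) * a * (delta g * delta h) =
      (cnj (c g h) * c g h) \<star> (adj (delta (g \<otimes> h)) * a * delta (g \<otimes> h))"
    using g h by (simp add: delta_mult mult.commute)
  then have "adj (delta (g \<otimes> h)) * a * delta (g \<otimes> h) = adj (delta h) * (adj (delta g) * a * delta g) * delta h"
    using g h by (simp add: cnj_c) (simp add: mult.assoc)
  then show "wmap (delta (g \<otimes> h)) x (cop a) = wmap (delta g) (wmap (delta h) x) (cop a)"
    using assms a normalizerD(3)[OF normalizer_delta[OF g] a] by (simp add: wmap_delta)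
qed (use assms in auto)

text \<open>Conjugation by \<open>delta s\<close> is trivial on the commutative
  \<open>alg S\<close>; this is why the action descends to cosets.\<close>

lemma wmap_delta_S:
  assumes s: "s \<in> S" and x: "x \<in> spec"
  shows "wmap (delta s) x = x"
proof (rule spectrum_eqI)
  fix a assume a: "a \<in> alg S"
  have "adj (delta s) * a * delta s = (adj (delta s) * delta s) * a"
    using alg_S_commute[OF a delta_alg[OF s]] by (simp add: mult.assoc)
  also have "\<dots> = a"
    using s a by (simp add: delta_unitary)
  finally show "wmap (delta s) x (cop a) = x (cop a)"
    using s x a by (simp add: wmap_delta)
qed (use assms in auto)

text \<open>The set where \<open>expect (adj (delta g) * n)\<close> does not vanish is open, and on
  its part inside \<open>wdom n\<close> the formula of \<open>normalizer_local_form\<close> holds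
  with one and the same \<open>g\<close>.\<close>

lemma wmap_local_form:
  assumes n: "normalizer n" and x: "x \<in> wdom n"
  obtains g U where "g \<in> carrier G" "openin spec_top U" "x \<in> U" "U \<subseteq> wdom n"
    "\<And>z. z \<in> U \<Longrightarrow> wmap n z = wmap (delta g) z"
proof -
  have xs: "x \<in> spec" "x (cop (adj n * n)) \<noteq> 0"
    using x by (auto simp: wdom_def)
  obtain g where g: "g \<in> carrier G" "x (cop (expect (adj (delta g) * n))) \<noteq> 0"
    using normalizer_local_exists[OF spec_character[OF xs(1)] n xs(2)] by blast
  define e where "e = expect (adj (delta g) * n)"
  have e: "e \<in> alg S"
    unfolding e_def using g(1) normalizerD(1)[OF n] by (intro expect_alg alg_G_mult alg_G_adj) auto
  define U where "U = {z \<in> topspace spec_top. z (cop e) \<in> - {0}} \<inter> wdom n"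
  have "openin spec_top U"
    unfolding U_def
    by (intro openin_Int openin_wdom n openin_continuous_map_preimage[OF continuous_map_spec_coordinate[OF e]])
      (auto simp: open_Compl)
  moreover have "x \<in> U"
    using x xs g by (simp add: U_def e_def)
  moreover have "wmap n z = wmap (delta g) z" if z: "z \<in> U" for z
  proof (rule spectrum_eqI)
    have zd: "z \<in> wdom n" "z \<in> spec" "z (cop e) \<noteq> 0"
      using z wdom_subset by (auto simp: U_def)
    show "wmap n z \<in> spec" "wmap (delta g) z \<in> spec"
      using wmap_spec[OF n zd(1)] g zd by auto
    fix a assume a: "a \<in> alg S"
    show "wmap n z (cop a) = wmap (delta g) z (cop a)"
      using normalizer_local_form[OF spec_character[OF zd(2)] n g(1) zd(3)[unfolded e_def] a] zd(1)
      by (simp add: wmap_cop[OF zd(1) a] wmap_delta[OF g(1) zd(2) a] wdom_def)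
  qed
  ultimately show ?thesis
    using that[of g U] g(1) by (auto simp: U_def)
qed

end

section \<open>Topological freeness\<close>

locale twisted_cartan = twisted_normal +
  assumes max: "maximal_abelian_symmetric G c S" and imm: "immediately_centralizing G S"
begin

lemma dual_neighbourhood:
  assumes V: "openin (dual_topology G S) V" and \<nu>0: "\<nu>0 \<in> V"
  obtains F \<epsilon> where "finite F" "F \<subseteq> S" "\<epsilon> > 0"
    "\<And>\<nu>. \<nu> \<in> dual_group G S \<Longrightarrow> (\<And>s. s \<in> F \<Longrightarrow> cmod (\<nu> s - \<nu>0 s) < \<epsilon>) \<Longrightarrow> \<nu> \<in> V"
proof -
  obtain T where T: "openin (product_topology (\<lambda>_. euclidean) S) T" "V = T \<inter> dual_group G S"
    using V unfolding dual_topology_def openin_subtopology by blast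
  have "\<forall>x\<in>T. \<exists>U. finite {s \<in> S. U s \<noteq> topspace (euclidean :: complex topology)} \<and>
      (\<forall>s\<in>S. openin euclidean (U s)) \<and> x \<in> Pi\<^sub>E S U \<and> Pi\<^sub>E S U \<subseteq> T"
    using T(1) by (simp only: openin_product_topology_alt)
  moreover have "\<nu>0 \<in> T"
    using \<nu>0 T(2) by simp
  ultimately have "\<exists>U. finite {s \<in> S. U s \<noteq> topspace (euclidean :: complex topology)} \<and>
      (\<forall>s\<in>S. openin euclidean (U s)) \<and> \<nu>0 \<in> Pi\<^sub>E S U \<and> Pi\<^sub>E S U \<subseteq> T"
    by (rule bspec)
  then obtain U where "finite {s \<in> S. U s \<noteq> topspace (euclidean :: complex topology)} \<and>
      (\<forall>s\<in>S. openin euclidean (U s)) \<and> \<nu>0 \<in> Pi\<^sub>E S U \<and> Pi\<^sub>E S U \<subseteq> T" ..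
  then have U: "finite {s \<in> S. U s \<noteq> (UNIV :: complex set)}" "\<And>s. s \<in> S \<Longrightarrow> open (U s)"
      "\<nu>0 \<in> Pi\<^sub>E S U" "Pi\<^sub>E S U \<subseteq> T"
    by (simp_all flip: open_openin)
  define F where "F = {s \<in> S. U s \<noteq> UNIV}"
  have "\<exists>r>0. ball (\<nu>0 s) r \<subseteq> U s" if "s \<in> S" for s
    using U(2)[OF that] PiE_mem[OF U(3) that] by (simp add: open_contains_ball)
  then obtain r where r: "\<And>s. s \<in> S \<Longrightarrow> r s > 0 \<and> ball (\<nu>0 s) (r s) \<subseteq> U s"
    by metis
  define \<epsilon> where "\<epsilon> = Min (insert 1 (r ` F))"
  have fin: "finite F"
    using U(1) by (simp add: F_def)
  have "\<epsilon> > 0"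
    unfolding \<epsilon>_def using fin r by (auto simp: F_def)
  moreover have "\<nu> \<in> V" if \<nu>: "\<nu> \<in> dual_group G S" and close: "\<And>s. s \<in> F \<Longrightarrow> cmod (\<nu> s - \<nu>0 s) < \<epsilon>" for \<nu>
  proof -
    have "\<nu> s \<in> U s" if s: "s \<in> S" for s
    proof (cases "s \<in> F")
      case True
      then have "\<epsilon> \<le> r s"
        unfolding \<epsilon>_def using fin by auto
      then have "\<nu> s \<in> ball (\<nu>0 s) (r s)"
        using close[OF True] by (simp add: dist_norm norm_minus_commute)
      then show ?thesis
        using r[OF s] by blast
    qed (use s in \<open>simp add: F_def\<close>)
    then have "\<nu> \<in> Pi\<^sub>E S U"
      using \<nu> by (simp add: PiE_iff dual_group_def)
    then show ?thesis
      using U(4) T(2) \<nu> by blast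
  qed
  ultimately show ?thesis
    using that[of F \<epsilon>] fin by (auto simp: F_def)
qed

text \<open>Simultaneous Dirichlet approximation of the arguments of \<nu> on a list of the elements
  of \<open>F\<close>. The bound on the exponent depends on \<open>F\<close> and \<epsilon> but not
  on \<nu>, which makes a common exponent possible.\<close>

lemma dual_power_near_one:
  assumes F: "finite F" "F \<subseteq> S" and \<epsilon>: "\<epsilon> > 0"
  obtains N :: nat where "\<And>\<nu>. \<nu> \<in> dual_group G S \<Longrightarrow> \<exists>q>0. q \<le> N \<and> (\<forall>s\<in>F. cmod (\<nu> s ^ q - 1) < \<epsilon>)"
proof -
  obtain ss where ss: "set ss = F"
    using finite_list[OF F(1)] by blast
  \<comment> \<open>With arguments measured in full turns, an error below \<open>1 / K\<close> moves
    the value by less than \<open>2 * pi / K < \<epsilon>\<close>.\<close>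
  obtain K :: nat where K: "2 * pi / \<epsilon> < real K"
    using reals_Archimedean2 by blast
  have "0 < 2 * pi / \<epsilon>"
    using \<epsilon> by simp
  then have K0: "K > 0"
    using K by (metis of_nat_0_less_iff less_trans)
  have "\<exists>q>0. q \<le> K ^ length ss \<and> (\<forall>s\<in>F. cmod (\<nu> s ^ q - 1) < \<epsilon>)" if \<nu>: "\<nu> \<in> dual_group G S" for \<nu>
  proof -
    define \<theta> where "\<theta> i = Arg (\<nu> (ss ! i)) / (2 * pi)" for i
    obtain q :: int and p where q: "0 < q" "q \<le> int (K ^ length ss)"
        "\<And>i. i < length ss \<Longrightarrow> \<bar>of_int q * \<theta> i - of_int (p i)\<bar> < 1 / real K"
      using Dirichlet_approx_simult[OF K0, of "length ss" \<theta>] by blast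
    have "cmod (\<nu> s ^ nat q - 1) < \<epsilon>" if s: "s \<in> F" for s
    proof -
      obtain i where i: "i < length ss" "s = ss ! i"
        using s ss by (metis in_set_conv_nth)
      have "cmod (\<nu> s) = 1"
        using \<nu> s F(2) by (auto simp: dual_group_def)
      then have "\<nu> s \<noteq> 0" "sgn (\<nu> s) = \<nu> s"
        by (auto simp: sgn_eq)
      then have "\<nu> s = cis (2 * pi * \<theta> i)"
        using cis_Arg[of "\<nu> s"] by (simp add: \<theta>_def i(2))
      then have "\<nu> s ^ nat q = cis (real (nat q) * (2 * pi * \<theta> i))"
        by (simp add: Complex.DeMoivre)
      also have "real (nat q) = of_int q"
        using q(1) by simp
      also have "of_int q * (2 * pi * \<theta> i) = 2 * pi * (of_int q * \<theta> i - of_int (p i)) + 2 * pi * of_int (p i)"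
        by (simp add: algebra_simps)
      also have "cis \<dots> = cis (2 * pi * (of_int q * \<theta> i - of_int (p i)))"
        by (simp flip: cis_mult)
      finally have "cmod (\<nu> s ^ nat q - 1) = 2 * \<bar>sin (2 * pi * (of_int q * \<theta> i - of_int (p i)) / 2)\<bar>"
        using dist_exp_i_1[of "2 * pi * (of_int q * \<theta> i - of_int (p i))"] by (simp add: cis_conv_exp)
      also have "\<dots> \<le> 2 * \<bar>2 * pi * (of_int q * \<theta> i - of_int (p i)) / 2\<bar>"
        by (intro mult_left_mono abs_sin_x_le_abs_x) simp
      also have "\<dots> = 2 * pi * \<bar>of_int q * \<theta> i - of_int (p i)\<bar>"
        by (simp add: abs_mult)
      also have "\<dots> < 2 * pi * (1 / real K)"
        by (intro mult_strict_left_mono q(3) i(1)) simp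
      also have "\<dots> < \<epsilon>"
        using K \<epsilon> K0 by (simp add: field_simps)
      finally show ?thesis .
    qed
    then show ?thesis
      using q(1,2) by (intro exI[of _ "nat q"]) (auto simp: nat_le_iff)
  qed
  then show ?thesis
    using that by blast
qed

lemma dual_mult: "\<nu> \<in> dual_group G S \<Longrightarrow> \<eta> \<in> dual_group G S \<Longrightarrow> (\<lambda>s\<in>S. \<nu> s * \<eta> s) \<in> dual_group G S"
  by (auto simp: dual_group_def norm_mult)

lemma dual_power: "\<nu> \<in> dual_group G S \<Longrightarrow> (\<lambda>s\<in>S. \<nu> s ^ q) \<in> dual_group G S"
  by (auto simp: dual_group_def norm_power power_mult_distrib)

text \<open>A power of any character is close to \<open>1\<close>, with exponent bounded by Dirichlet's theorem. Hence
  the elements \<open>t\<close> annihilated by a neighbourhood of \<open>1\<close> have a common exponent, and the hypothesis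
  that \<open>S\<close> is immediately centralizing applies to them.\<close>

lemma topologically_free:
  assumes g: "g \<in> carrier G" and U: "openin spec_top U" "x0 \<in> U"
    and fixed: "\<And>z. z \<in> U \<Longrightarrow> wmap (delta g) z = z"
  shows "g \<in> S"
proof -
  \<comment> \<open>Conjugation by \<open>delta g\<close> sends \<open>delta s\<close> to
    \<open>ch s\<close> times the operator of the conjugate of \<open>s\<close>, and
    \<open>t s\<close> compares that conjugate with \<open>s\<close>.\<close>
  define ch where "ch s = cnj (c g (inv g)) * c (inv g) s * c (inv g \<otimes> s) g" for s
  define t where "t s = inv g \<otimes> s \<otimes> g \<otimes> inv s" for s
  have conjS: "inv g \<otimes> s \<otimes> g \<in> S" if "s \<in> S" for s
    using inv_op_closed1[OF g that] .
  have tS: "t s \<in> S" if "s \<in> S" for s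
    unfolding t_def using conjS[OF that] that by simp
  define V where "V = {\<nu> \<in> topspace (dual_topology G S). Psi G c S \<nu> \<in> U}"
  have V: "openin (dual_topology G S) V"
    unfolding V_def using homeomorphic_maps_Psi U(1)
    by (intro openin_continuous_map_preimage[of _ spec_top]) (auto simp: homeomorphic_maps_def)
  have fix\<nu>: "ch s * \<nu> (inv g \<otimes> s \<otimes> g) = \<nu> s" if \<nu>: "\<nu> \<in> V" and s: "s \<in> S" for \<nu> s
  proof -
    have \<nu>': "\<nu> \<in> dual_group G S" "Psi G c S \<nu> \<in> U"
      using \<nu> by (auto simp: V_def)
    note P = Psi_props[OF \<nu>'(1)]
    have "\<nu> s = wmap (delta g) (Psi G c S \<nu>) (cop (delta s))"
      using fixed[OF \<nu>'(2)] P(2)[OF s] by simp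
    also have "\<dots> = Psi G c S \<nu> (cop (ch s \<star> delta (inv g \<otimes> s \<otimes> g)))"
      using s by (simp add: wmap_delta[OF g P(1)] conj_delta[OF g s] ch_def)
    also have "\<dots> = ch s * \<nu> (inv g \<otimes> s \<otimes> g)"
      using character_simps(3)[OF spec_character[OF P(1)], of "delta (inv g \<otimes> s \<otimes> g)" "ch s"] conjS[OF s] P(2)
      by simp
    finally show ?thesis by simp
  qed
  have x0: "x0 \<in> spec"
    using U openin_subset by fastforce
  define \<nu>0 where "\<nu>0 = restrict_dual x0"
  have \<nu>0: "\<nu>0 \<in> V" "\<nu>0 \<in> dual_group G S"
    using U(2) x0 by (simp_all add: V_def \<nu>0_def restrict_dual_mem Psi_restrict)
  obtain F \<epsilon> where F: "finite F" "F \<subseteq> S" "\<epsilon> > 0" and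
    nb: "\<And>\<nu>. \<nu> \<in> dual_group G S \<Longrightarrow> (\<And>s. s \<in> F \<Longrightarrow> cmod (\<nu> s - \<nu>0 s) < \<epsilon>) \<Longrightarrow> \<nu> \<in> V"
    using dual_neighbourhood[OF V \<nu>0(1)] by blast
  \<comment> \<open>Both \<nu>0 and its product with \<eta> lie in \<open>V\<close>. Comparing their
    two fixed-point equations eliminates the scalar \<open>ch s\<close> and leaves
    \<open>\<eta> (inv g \<otimes> s \<otimes> g) = \<eta> s\<close>.\<close>
  have near: "\<eta> (t s) = 1" if \<eta>: "\<eta> \<in> dual_group G S" "\<And>s. s \<in> F \<Longrightarrow> cmod (\<eta> s - 1) < \<epsilon>" and s: "s \<in> S" for \<eta> s
  proof -
    let ?\<nu> = "\<lambda>s\<in>S. \<nu>0 s * \<eta> s"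
    have \<nu>0_unit: "cmod (\<nu>0 s) = 1" if "s \<in> S" for s
      using \<nu>0(2) that by (simp add: dual_group_def)
    have "?\<nu> \<in> V"
    proof (rule nb[OF dual_mult[OF \<nu>0(2) \<eta>(1)]])
      fix s assume s: "s \<in> F"
      then have "?\<nu> s - \<nu>0 s = \<nu>0 s * (\<eta> s - 1)"
        using F(2) by (auto simp: algebra_simps)
      then show "cmod (?\<nu> s - \<nu>0 s) < \<epsilon>"
        using \<eta>(2)[OF s] s F(2) by (simp add: norm_mult \<nu>0_unit subset_iff)
    qed
    from fix\<nu>[OF this s] fix\<nu>[OF \<nu>0(1) s] have "\<nu>0 s * \<eta> (inv g \<otimes> s \<otimes> g) = \<nu>0 s * \<eta> s"
      using s conjS[OF s] by (simp add: mult.assoc[symmetric])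
    then have eq: "\<eta> (inv g \<otimes> s \<otimes> g) = \<eta> s"
      using \<nu>0_unit[OF s] by auto
    have "\<eta> (t s) = \<eta> (inv g \<otimes> s \<otimes> g) * \<eta> (inv s)"
      unfolding t_def using \<eta>(1) conjS[OF s] m_inv_closed[OF s] by (simp add: dual_group_def)
    also have "\<dots> = \<eta> s * \<eta> (inv s)"
      by (simp only: eq)
    also have "\<dots> = 1"
      using \<eta>(1) s by (simp add: dual_group_simps(2)[OF subgroup_S \<eta>(1)] dual_group_def
          flip: complex_norm_square)
    finally show ?thesis .
  qed
  obtain N where N: "\<And>\<nu>. \<nu> \<in> dual_group G S \<Longrightarrow> \<exists>q>0. q \<le> N \<and> (\<forall>s\<in>F. cmod (\<nu> s ^ q - 1) < \<epsilon>)"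
    using dual_power_near_one[OF F] by blast
  \<comment> \<open>\<open>fact N\<close> is a multiple of every positive \<open>q \<le> N\<close>,
    so one exponent serves all characters; \<open>dual_group_separates\<close> then turns
    \<open>\<nu> (t s [^] K) = 1\<close> for all \<nu> into an identity in \<open>S\<close>.\<close>
  define K where "K = (fact N :: nat)"
  have K: "K \<ge> 1"
    by (simp add: K_def)
  have torsion: "t s [^] K = \<one>" if s: "s \<in> S" for s
  proof (rule ccontr)
    assume "t s [^] K \<noteq> \<one>"
    then obtain \<nu> where \<nu>: "\<nu> \<in> dual_group G S" "\<nu> (t s [^] K) \<noteq> 1"
      using dual_group_separates[OF subgroup_S comm_S pow_S[OF tS[OF s], of K]] by blast
    obtain q where q: "q > 0" "q \<le> N" "\<forall>s\<in>F. cmod (\<nu> s ^ q - 1) < \<epsilon>"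
      using N[OF \<nu>(1)] by blast
    have "(\<lambda>s\<in>S. \<nu> s ^ q) (t s) = 1"
      by (rule near[OF dual_power[OF \<nu>(1)] _ s]) (use q(3) F(2) in \<open>auto simp: subset_iff\<close>)
    then have "\<nu> (t s) ^ q = 1"
      using tS[OF s] by simp
    moreover obtain r where "K = q * r"
      using q dvd_fact[of q N] by (auto simp: K_def dvd_def)
    ultimately have "\<nu> (t s [^] K) = 1"
      using dual_group_simps(3)[OF subgroup_S \<nu>(1) tS[OF s]] by (simp add: power_mult)
    then show False
      using \<nu>(2) by simp
  qed
  \<comment> \<open>Both \<open>inv g \<otimes> s \<otimes> g\<close> and \<open>inv s\<close> lie
    in the abelian \<open>S\<close>, so powers of their product are computed factor by
    factor.\<close>
  have tpow: "t s [^] n = inv g \<otimes> s [^] n \<otimes> g \<otimes> inv (s [^] n)" if s: "s \<in> S" for s and n :: nat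
  proof (induction n)
    case (Suc n)
    define a b where "a = inv g \<otimes> s [^] n \<otimes> g" and "b = inv g \<otimes> s \<otimes> g"
    have ab: "a \<in> S" "b \<in> S" "s [^] n \<in> S" "inv (s [^] n) \<in> S" "inv s \<in> S"
      unfolding a_def b_def using conjS pow_S[OF s] s by auto
    have "t s [^] Suc n = (a \<otimes> inv (s [^] n)) \<otimes> (b \<otimes> inv s)"
      using Suc by (simp add: a_def b_def t_def)
    also have "\<dots> = a \<otimes> (inv (s [^] n) \<otimes> b) \<otimes> inv s"
      using ab by (simp add: m_assoc)
    also have "inv (s [^] n) \<otimes> b = b \<otimes> inv (s [^] n)"
      by (rule comm_S[OF ab(4,2)])
    also have "a \<otimes> (b \<otimes> inv (s [^] n)) \<otimes> inv s = (a \<otimes> b) \<otimes> (inv (s [^] n) \<otimes> inv s)"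
      using ab by (simp add: m_assoc)
    also have "inv (s [^] n) \<otimes> inv s = inv (s [^] Suc n)"
      using s ab(3) comm_S[OF s ab(3)] by (simp add: inv_mult_group[symmetric])
    also have "a \<otimes> b = inv g \<otimes> s [^] Suc n \<otimes> g"
      using g s ab(3) by (simp add: a_def b_def m_assoc)
    finally show ?case .
  qed (use g s in simp)
  have "k_centralizing G S K g"
    unfolding k_centralizing_def
  proof (intro conjI ballI g)
    fix s assume s: "s \<in> S"
    have sk: "s [^] K \<in> carrier G"
      using s by simp
    have "inv g \<otimes> s [^] K \<otimes> g = s [^] K"
    proof -
      have "inv g \<otimes> s [^] K \<otimes> g \<otimes> inv (s [^] K) \<otimes> s [^] K = \<one> \<otimes> s [^] K"
        using torsion[OF s] tpow[OF s, of K] by simp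
      then show ?thesis
        using g sk by (simp add: inv_cancel(4))
    qed
    then have "g \<otimes> s [^] K = g \<otimes> (inv g \<otimes> (s [^] K \<otimes> g))"
      using g sk by (simp add: m_assoc)
    then have "g \<otimes> s [^] K = s [^] K \<otimes> g"
      using g sk by simp
    then show "\<exists>j\<in>{1..K}. g \<otimes> s [^] j = s [^] j \<otimes> g"
      using K by (intro bexI[of _ K]) auto
  qed
  then have "k_centralizing G S 1 g"
    using imm K by (auto simp: immediately_centralizing_def)
  then have gs: "g \<otimes> s = s \<otimes> g" if "s \<in> S" for s
    using that by (force simp: k_centralizing_def)
  show ?thesis
  proof (rule maximal_abelian_symmetric_commutant[OF max g])
    fix s assume s: "s \<in> S"
    have conj: "inv g \<otimes> s \<otimes> g = s"
      using g s gs[OF s] by (simp add: m_assoc flip: gs[OF s])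
    \<comment> \<open>Once conjugation fixes \<open>s\<close>, the fixed-point equation at \<nu>0
      leaves only the scalar, and \<open>ch s = 1\<close> means that \<open>delta g\<close> commutes
      with \<open>delta s\<close>.\<close>
    have "ch s * \<nu>0 s = \<nu>0 s" "\<nu>0 s \<noteq> 0"
      using fix\<nu>[OF \<nu>0(1) s] conj \<nu>0(2) s by (auto simp: dual_group_def)
    then have "ch s = 1"
      by simp
    then have "delta g * (adj (delta g) * delta s * delta g) = delta g * delta s"
      using conj_delta[OF g s] conj by (simp add: ch_def)
    moreover have "delta g * (adj (delta g) * delta s * delta g) = (delta g * adj (delta g)) * (delta s * delta g)"
      by (simp only: mult.assoc)
    ultimately have "delta s * delta g = delta g * delta s"
      using g s by (simp add: delta_unitary)
    then have "app (delta s * delta g) (basis \<one>) = app (delta g * delta s) (basis \<one>)"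
      by simp
    then have "coord (app (delta s * delta g) (basis \<one>)) (s \<otimes> g) = coord (app (delta g * delta s) (basis \<one>)) (s \<otimes> g)"
      by simp
    then show "delta_commute g s"
      using g s gs[OF s] by (simp add: delta_commute_def delta_basis coord_basis)
  qed
qed

section \<open>The Cartan pair\<close>

lemma RA_eq: "RA = (l2_operators (carrier G))\<lparr>carrier := cop ` alg (carrier G)\<rparr>"
  by (simp add: reduced_algebra_def reduced_set_eq)

lemma norm_closure_RA: "Y \<subseteq> alg (carrier G) \<Longrightarrow> norm_closure RA (cop ` Y) = cop ` (alg (carrier G) \<inter> closure Y)"
  using alg_corner by (intro norm_closure_conc RA_eq) auto

lemma cstar_subalgebra_RB: "cstar_subalgebra RA RB"
  unfolding cstar_subalgebra_def Ball_RB
proof (intro conjI ballI allI)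
  have sub: "alg S \<subseteq> alg (carrier G)"
    by auto
  then show "RB \<subseteq> carrier RA"
    by (auto simp: RB_eq RA_simps)
  show "norm_closure RA RB \<subseteq> RB"
    using norm_closure_RA[OF sub] by (simp add: RB_eq closure_closed image_mono)
qed (auto simp: RA_simps cop_mem_iff)

lemma commuting_RB: "commuting RA RB"
  unfolding commuting_def Ball_RB by (simp add: RA_simps alg_S_commute)

lemma maximal_abelian_RB: "maximal_abelian RA RB"
  unfolding maximal_abelian_def
proof (intro conjI allI impI cstar_subalgebra_RB commuting_RB)
  fix C assume C: "cstar_subalgebra RA C \<and> commuting RA C \<and> RB \<subseteq> C"
  have "C \<subseteq> RB"
  proof
    fix y assume y: "y \<in> C"
    then obtain a where a: "a \<in> alg (carrier G)" "y = cop a"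
      using C by (auto simp: cstar_subalgebra_def RA_simps)
    have "delta s * a = a * delta s" if s: "s \<in> S" for s
    proof -
      have "cop (delta s) \<in> C"
        using C s by (auto simp: RB_eq)
      then have "monoid.mult RA (cop (delta s)) (cop a) = monoid.mult RA (cop a) (cop (delta s))"
        using C y a(2) unfolding commuting_def by blast
      then show ?thesis
        using s a(1) by (simp add: RA_simps)
    qed
    then show "y \<in> RB"
      using commutant_alg[OF max imm a(1)] a by (simp add: RB_eq)
  qed
  then show "C = RB"
    using C by blast
qed

lemma expectation_RB: "\<exists>E. conditional_expectation RA RB E \<and> faithful_map RA E"
proof -
  define E where "E y = cop (expect (inv_into (alg (carrier G)) cop y))" for y
  have "inj_on cop (alg (carrier G))"
    by (rule inj_onI) simp
  then have E: "E (cop a) = cop (expect a)" if "a \<in> alg (carrier G)" for a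
    using that by (simp add: E_def)
  have ball: "(\<forall>y\<in>carrier RA. Q y) \<longleftrightarrow> (\<forall>a\<in>alg (carrier G). Q (cop a))" for Q
    by (simp add: RA_simps)
  have "conditional_expectation RA RB E"
    unfolding conditional_expectation_def ball Ball_RB
  proof (intro conjI ballI allI)
    fix a assume a: "a \<in> alg (carrier G)"
    show "alg_norm RA (E (cop a)) \<le> alg_norm RA (cop a)"
      using a by (simp add: E RA_simps norm_expect_le)
    obtain d where "d \<in> alg S" "adj d = d" "expect (adj a * a) = d * d"
      using expect_positive[OF a] .
    then show "\<exists>d\<in>RB. E (monoid.mult RA (star RA (cop a)) (cop a)) = monoid.mult RA (star RA d) d"
      using a by (intro bexI[of _ "cop d"]) (simp_all add: E RA_simps RB_eq)
  qed (simp_all add: E RA_simps cop_mem_iff expect_mult_left expect_mult_right)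
  moreover have "faithful_map RA E"
    unfolding faithful_map_def ball
  proof (intro ballI impI)
    fix a assume a: "a \<in> alg (carrier G)" "E (monoid.mult RA (star RA (cop a)) (cop a)) = zero RA"
    then have "cop (expect (adj a * a)) = cop 0"
      by (simp add: E RA_simps)
    then have "expect (adj a * a) = 0"
      using a(1) by simp
    then show "cop a = zero RA"
      using expect_faithful[OF a(1)] by (simp add: RA_simps)
  qed
  ultimately show ?thesis
    by blast
qed

text \<open>Every \<open>delta g\<close> is a normalizer, so a subalgebra containing all normalizers
  contains the finite combinations of these operators and, being closed, also their limits.\<close>

lemma generates_RA: "generates RA (normalizers RA RB)"
  unfolding generates_def
proof (intro allI impI)
  fix C assume C: "cstar_subalgebra RA C \<and> normalizers RA RB \<subseteq> C"
  define D where "D = {a \<in> alg (carrier G). cop a \<in> C}"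
  have C_D: "C = cop ` D"
    using C by (auto simp: D_def cstar_subalgebra_def RA_simps)
  have ops: "cop 0 \<in> C" "cop a \<in> C \<Longrightarrow> cop b \<in> C \<Longrightarrow> cop (a + b) \<in> C" "cop a \<in> C \<Longrightarrow> cop (z \<star> a) \<in> C" for a b z
  proof -
    note cs = C[THEN conjunct1, unfolded cstar_subalgebra_def, THEN conjunct2]
    note cs(1)[THEN conjunct1] cs[THEN conjunct2, THEN conjunct1] cs[THEN conjunct2, THEN conjunct2, THEN conjunct1]
    then have "zero RA \<in> C" "cop a \<in> C \<Longrightarrow> cop b \<in> C \<Longrightarrow> add RA (cop a) (cop b) \<in> C"
      "cop a \<in> C \<Longrightarrow> smult RA z (cop a) \<in> C"
      by simp_all
    then show "cop 0 \<in> C" "cop a \<in> C \<Longrightarrow> cop b \<in> C \<Longrightarrow> cop (a + b) \<in> C" "cop a \<in> C \<Longrightarrow> cop (z \<star> a) \<in> C"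
      by (simp_all add: RA_simps)
  qed
  have delta: "cop (delta g) \<in> C" if "g \<in> carrier G" for g
    using C normalizer_delta[OF that] by (auto simp: normalizers_eq)
  have "regular f \<in> D" if "f \<in> finsupp (carrier G)" for f
    unfolding D_def
    by (rule regular_induct[OF that]) (use ops delta in auto)
  then have "alg (carrier G) \<subseteq> closure D"
    unfolding alg_def by (intro closure_mono) auto
  then have "carrier RA = norm_closure RA (cop ` D)"
    using norm_closure_RA[of D] by (auto simp: D_def RA_simps)
  also have "\<dots> \<subseteq> C"
    using C by (simp add: cstar_subalgebra_def flip: C_D)
  finally show "C = carrier RA"
    using C by (auto simp: cstar_subalgebra_def)
qed

text \<open>The algebra is unital, so a net concentrated at the unit will do: the principal filter
  at \<open>cop (delta \<one>)\<close>.\<close>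

lemma approximate_identity_RB: "contains_approximate_identity RA RB"
  unfolding contains_approximate_identity_def
proof (intro exI[of _ "principal {cop (delta \<one>)}"] conjI ballI)
  show "\<forall>\<^sub>F u in principal {cop (delta \<one>)}. u \<in> RB \<and> alg_norm RA u \<le> 1"
    using norm_delta_le[of \<one>] by (simp add: eventually_principal RA_simps cop_mem_iff)
  fix y assume "y \<in> carrier RA"
  then obtain a where a: "a \<in> alg (carrier G)" "y = cop a"
    by (auto simp: RA_simps)
  have z: "a + (- 1) \<star> a = 0"
    by (simp only: cscale_oper_minus_one) simp
  have lim: "(h \<longlongrightarrow> 0) (principal {cop (delta \<one>)})" if "h (cop (delta \<one>)) = 0" for h :: "'a l2_op \<Rightarrow> real"
    by (rule tendsto_eventually) (simp add: eventually_principal that)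
  show "((\<lambda>u. alg_norm RA (add RA (monoid.mult RA u y) (smult RA (- 1) y))) \<longlongrightarrow> 0) (principal {cop (delta \<one>)})"
    "((\<lambda>u. alg_norm RA (add RA (monoid.mult RA y u) (smult RA (- 1) y))) \<longlongrightarrow> 0) (principal {cop (delta \<one>)})"
    by (rule lim, use a in \<open>simp add: RA_simps z\<close>)+
qed (simp add: principal_eq_bot_iff)

lemma cartan_pair_RB: "cartan_pair RA RB"
  unfolding cartan_pair_def
  using cstar_subalgebra_RB maximal_abelian_RB expectation_RB generates_RA approximate_identity_RB by blast

end

context twisted_cartan
begin

section \<open>The action of the quotient group\<close>

lemma wmap_delta_coset:
  assumes g: "g \<in> carrier G" and h: "h \<in> S #> g"
  shows "h \<in> carrier G" "wmap (delta h) = wmap (delta g)"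
proof -
  obtain s where s: "s \<in> S" "h = s \<otimes> g"
    using h by (auto simp: r_coset_def)
  show hG: "h \<in> carrier G"
    using s g by simp
  show "wmap (delta h) = wmap (delta g)"
  proof (rule extensionalityI[of _ spec])
    show "wmap (delta h) \<in> extensional spec" "wmap (delta g) \<in> extensional spec"
      using hG g by (simp_all add: wmap_def)
    fix x assume x: "x \<in> spec"
    then show "wmap (delta h) x = wmap (delta g) x"
      using s g by (simp add: wmap_delta_mult wmap_delta_S)
  qed
qed

lemma coset_wmap_cong:
  assumes "g \<in> carrier G" "h \<in> carrier G" "S #> g = S #> h"
  shows "wmap (delta g) = wmap (delta h)"
  using wmap_delta_coset(2)[OF assms(2), of g] rcos_self[OF assms(1) subgroup_S] assms(3) by simp

lemma alpha_map_eq: "g \<in> carrier G \<Longrightarrow> alpha_map G c S g = wmap (delta g)"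
  by (simp add: alpha_map_def delta_op_eq weyl_map_eq normalizer_delta)

lemma induced_action_eq:
  assumes g: "g \<in> carrier G"
  shows "induced_action G c S (S #> g) = (\<lambda>\<nu>\<in>dual_group G S. restrict_dual (wmap (delta g) (Psi G c S \<nu>)))"
proof -
  have "(THE f. \<forall>h\<in>S #> g. alpha_map G c S h = f) = wmap (delta g)"
  proof (rule the_equality)
    show "\<forall>h\<in>S #> g. alpha_map G c S h = wmap (delta g)"
      using wmap_delta_coset[OF g] by (simp add: alpha_map_eq)
    show "f = wmap (delta g)" if "\<forall>h\<in>S #> g. alpha_map G c S h = f" for f
      using that rcos_self[OF g subgroup_S] alpha_map_eq[OF g] by simp
  qed
  then show ?thesis
    unfolding induced_action_def using g by (intro restrict_ext) (simp add: Psi_inv_eq Psi_props(1))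
qed

lemma induced_action_apply:
  assumes "g \<in> carrier G" "\<nu> \<in> dual_group G S"
  shows "induced_action G c S (S #> g) \<nu> = restrict_dual (wmap (delta g) (Psi G c S \<nu>))"
  using assms by (simp add: induced_action_eq)

lemma induced_action_mem:
  "g \<in> carrier G \<Longrightarrow> \<nu> \<in> dual_group G S \<Longrightarrow> induced_action G c S (S #> g) \<nu> \<in> dual_group G S"
  by (simp add: induced_action_apply restrict_dual_mem Psi_props(1))

lemma induced_action_formula:
  assumes g: "g \<in> carrier G" and \<nu>: "\<nu> \<in> dual_group G S" and s: "s \<in> S"
  shows "induced_action G c S (S #> g) \<nu> s =
    cnj (c g (inv g)) * c (inv g) s * c (inv g \<otimes> s) g * \<nu> (inv g \<otimes> s \<otimes> g)"
proof -
  have conjS: "inv g \<otimes> s \<otimes> g \<in> S"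
    using inv_op_closed1[OF g s] .
  note P = Psi_props(1,2)[OF \<nu>]
  have "induced_action G c S (S #> g) \<nu> s = Psi G c S \<nu> (cop (adj (delta g) * delta s * delta g))"
    using g \<nu> s P(1) by (simp add: induced_action_apply restrict_dual_def wmap_delta)
  also have "\<dots> = cnj (c g (inv g)) * c (inv g) s * c (inv g \<otimes> s) g * \<nu> (inv g \<otimes> s \<otimes> g)"
    using character_simps(3)[OF spec_character[OF P(1)] delta_alg[OF conjS]] P(2)[OF conjS]
    by (simp only: conj_delta[OF g s])
  finally show ?thesis .
qed

lemma induced_action_mult:
  assumes g: "g \<in> carrier G" and h: "h \<in> carrier G" and \<nu>: "\<nu> \<in> dual_group G S"
  shows "induced_action G c S (S #> (g \<otimes> h)) \<nu> =
    induced_action G c S (S #> g) (induced_action G c S (S #> h) \<nu>)"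
proof -
  have "wmap (delta h) (Psi G c S \<nu>) \<in> spec"
    using h \<nu> by (simp add: Psi_props(1))
  then show ?thesis
    using assms by (simp add: induced_action_apply restrict_dual_mem Psi_restrict wmap_delta_mult Psi_props(1))
qed

lemma induced_action_one: "\<nu> \<in> dual_group G S \<Longrightarrow> induced_action G c S (S #> \<one>) \<nu> = \<nu>"
  by (simp add: induced_action_apply wmap_delta_S Psi_props(1) restrict_Psi)

lemma induced_action_inverse:
  assumes g: "g \<in> carrier G" and \<nu>: "\<nu> \<in> dual_group G S"
  shows "induced_action G c S (S #> inv g) (induced_action G c S (S #> g) \<nu>) = \<nu>"
    "induced_action G c S (S #> g) (induced_action G c S (S #> inv g) \<nu>) = \<nu>"
  using induced_action_mult[of "inv g" g \<nu>] induced_action_mult[of g "inv g" \<nu>] assms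
  by (simp_all add: induced_action_one)

lemma carrier_quotient: "carrier (G Mod S) = {S #> g | g. g \<in> carrier G}"
  by (auto simp: FactGroup_def RCOSETS_def)

lemma group_action_induced: "group_action (G Mod S) (dual_group G S) (induced_action G c S)"
proof -
  have Bij: "induced_action G c S (S #> g) \<in> Bij (dual_group G S)" if g: "g \<in> carrier G" for g
  proof -
    have "bij_betw (induced_action G c S (S #> g)) (dual_group G S) (dual_group G S)"
      using g by (intro bij_betwI[where g = "induced_action G c S (S #> inv g)"])
        (auto simp: induced_action_mem induced_action_inverse)
    then show ?thesis
      using g by (simp add: Bij_def induced_action_eq)
  qed
  have "group_hom (G Mod S) (BijGroup (dual_group G S)) (induced_action G c S)"
  proof (intro group_hom.intro group_hom_axioms.intro factorgroup_is_group group_BijGroup homI)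
    fix q assume "q \<in> carrier (G Mod S)"
    then show "induced_action G c S q \<in> carrier (BijGroup (dual_group G S))"
      using Bij by (auto simp: carrier_quotient BijGroup_def)
  next
    fix q q' assume "q \<in> carrier (G Mod S)" "q' \<in> carrier (G Mod S)"
    then obtain g h where gh: "g \<in> carrier G" "h \<in> carrier G" "q = S #> g" "q' = S #> h"
      by (auto simp: carrier_quotient)
    have "induced_action G c S (S #> (g \<otimes> h)) =
        compose (dual_group G S) (induced_action G c S (S #> g)) (induced_action G c S (S #> h))"
    proof (rule extensionalityI[of _ "dual_group G S"])
      show "induced_action G c S (S #> (g \<otimes> h)) \<in> extensional (dual_group G S)"
        using gh by (simp add: induced_action_eq)
    qed (use gh in \<open>auto simp: compose_def induced_action_mult\<close>)
    then show "induced_action G c S (q \<otimes>\<^bsub>G Mod S\<^esub> q') =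
        induced_action G c S q \<otimes>\<^bsub>BijGroup (dual_group G S)\<^esub> induced_action G c S q'"
      using gh Bij by (simp add: BijGroup_def rcos_sum)
  qed
  then show ?thesis
    by (simp add: group_action_def)
qed

lemma continuous_map_wmap_delta: "g \<in> carrier G \<Longrightarrow> continuous_map spec_top spec_top (wmap (delta g))"
  using continuous_map_wmap[OF normalizer_delta, of g] subtopology_topspace[of spec_top]
  by (simp add: continuous_map_in_subtopology)

lemma continuous_map_induced:
  assumes g: "g \<in> carrier G"
  shows "continuous_map (dual_topology G S) (dual_topology G S) (induced_action G c S (S #> g))"
proof -
  have "continuous_map (dual_topology G S) (dual_topology G S) (restrict_dual \<circ> (wmap (delta g) \<circ> Psi G c S))"
    using homeomorphic_maps_Psi continuous_map_wmap_delta[OF g]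
    by (intro continuous_map_compose) (auto simp: homeomorphic_maps_def)
  then show ?thesis
    by (rule continuous_map_eq) (simp add: induced_action_apply g)
qed

lemma homeomorphic_map_induced:
  assumes "q \<in> carrier (G Mod S)"
  shows "homeomorphic_map (dual_topology G S) (dual_topology G S) (induced_action G c S q)"
proof -
  obtain g where g: "g \<in> carrier G" "q = S #> g"
    using assms by (auto simp: carrier_quotient)
  have "homeomorphic_maps (dual_topology G S) (dual_topology G S)
      (induced_action G c S (S #> g)) (induced_action G c S (S #> inv g))"
    unfolding homeomorphic_maps_def using g by (simp add: continuous_map_induced induced_action_inverse)
  then show ?thesis
    unfolding g(2) by (rule homeomorphic_maps_imp_map)
qed

section \<open>The Weyl groupoid\<close>

lemma weyl_triples_eq: "weyl_triples RA RB = {(wmap n x, cop n, x) | n x. normalizer n \<and> x \<in> wdom n}"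
  unfolding weyl_triples_def normalizers_eq using weyl_map_eq weyl_dom_eq by auto

definition locally_equal :: "'a oper \<Rightarrow> 'a oper \<Rightarrow> ('a l2_op \<Rightarrow> complex) \<Rightarrow> bool" where
  "locally_equal n m x \<longleftrightarrow> (\<exists>U. openin spec_top U \<and> x \<in> U \<and> U \<subseteq> wdom n \<inter> wdom m \<and>
    (\<forall>z\<in>U. wmap n z = wmap m z))"

lemma weyl_equiv_iff:
  assumes n: "normalizer n" and m: "normalizer m"
  shows "((y, cop n, x), (y', cop m, x')) \<in> weyl_equiv RA RB \<longleftrightarrow>
    x = x' \<and> y = wmap n x \<and> y' = wmap m x \<and> locally_equal n m x"
proof -
  have triple: "(y, cop k, x) \<in> weyl_triples RA RB \<longleftrightarrow> x \<in> wdom k \<and> y = wmap k x" if k: "normalizer k" for k y x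
    using k normalizerD(1) cop_eq_iff unfolding weyl_triples_eq by blast
  show ?thesis
    unfolding weyl_equiv_def locally_equal_def
    by (simp add: triple n m weyl_dom_eq weyl_map_eq) blast
qed

lemma locally_equal_refl: "normalizer n \<Longrightarrow> x \<in> wdom n \<Longrightarrow> locally_equal n n x"
  unfolding locally_equal_def using openin_wdom by blast

lemma locally_equal_sym: "locally_equal n m x \<Longrightarrow> locally_equal m n x"
  unfolding locally_equal_def by (metis Int_commute)

lemma locally_equal_trans:
  assumes "locally_equal n m x" "locally_equal m k x"
  shows "locally_equal n k x"
proof -
  obtain U V where "openin spec_top U" "x \<in> U" "U \<subseteq> wdom n \<inter> wdom m" "\<forall>z\<in>U. wmap n z = wmap m z"
    and "openin spec_top V" "x \<in> V" "V \<subseteq> wdom m \<inter> wdom k" "\<forall>z\<in>V. wmap m z = wmap k z"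
    using assms unfolding locally_equal_def by blast
  then show ?thesis
    unfolding locally_equal_def by (intro exI[of _ "U \<inter> V"]) auto
qed

lemma locally_equalD: "locally_equal n m x \<Longrightarrow> x \<in> wdom n \<and> x \<in> wdom m \<and> wmap n x = wmap m x"
  unfolding locally_equal_def by auto

abbreviation "germ n x \<equiv> weyl_germ RA RB (cop n) x"

text \<open>All triples in a germ share their first and last components, since locally equal maps
  agree at \<open>x\<close>; so the definite descriptions in \<open>src\<close> and
  \<open>rng\<close> have unique solutions.\<close>

lemma germ_eq:
  assumes n: "normalizer n"
  shows "germ n x = {(wmap m x, cop m, x) | m. normalizer m \<and> locally_equal n m x}"
proof
  show "germ n x \<subseteq> {(wmap m x, cop m, x) | m. normalizer m \<and> locally_equal n m x}"
  proof
    fix p assume p: "p \<in> germ n x"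
    then have rel: "((wmap n x, cop n, x), p) \<in> weyl_equiv RA RB"
      by (simp add: weyl_germ_def weyl_map_eq n)
    obtain y k x' where pk: "p = (y, k, x')"
      by (cases p)
    have "p \<in> weyl_triples RA RB"
      using rel unfolding weyl_equiv_def by auto
    then obtain m where "normalizer m" "k = cop m"
      using pk unfolding weyl_triples_eq by auto
    then show "p \<in> {(wmap m x, cop m, x) | m. normalizer m \<and> locally_equal n m x}"
      using rel weyl_equiv_iff[OF n] unfolding pk by auto
  qed
  show "{(wmap m x, cop m, x) | m. normalizer m \<and> locally_equal n m x} \<subseteq> germ n x"
    using weyl_equiv_iff[OF n] by (auto simp: weyl_germ_def weyl_map_eq n)
qed

lemma germ_self: "normalizer n \<Longrightarrow> x \<in> wdom n \<Longrightarrow> (wmap n x, cop n, x) \<in> germ n x"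
  using locally_equal_refl by (auto simp: germ_eq)

lemma germ_eq_iff:
  assumes n: "normalizer n" "x \<in> wdom n" and m: "normalizer m" "y \<in> wdom m"
  shows "germ n x = germ m y \<longleftrightarrow> x = y \<and> locally_equal n m x"
proof
  assume "germ n x = germ m y"
  then have "(wmap m y, cop m, y) \<in> germ n x"
    using germ_self[OF m] by simp
  then obtain k where k: "normalizer k" "locally_equal n k x" "cop m = cop k" "y = x"
    unfolding germ_eq[OF n(1)] by auto
  then have "m = k"
    using m(1) normalizerD(1) cop_eq_iff by blast
  then show "x = y \<and> locally_equal n m x"
    using k by simp
next
  assume "x = y \<and> locally_equal n m x"
  then show "germ n x = germ m y"
    unfolding germ_eq[OF n(1)] germ_eq[OF m(1)] using locally_equal_trans locally_equal_sym by blast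
qed

lemma germ_delta_form:
  assumes n: "normalizer n" and x: "x \<in> wdom n"
  obtains g where "g \<in> carrier G" "locally_equal n (delta g) x"
proof -
  obtain g U where gU: "g \<in> carrier G" "openin spec_top U" "x \<in> U" "U \<subseteq> wdom n"
    "\<And>z. z \<in> U \<Longrightarrow> wmap n z = wmap (delta g) z"
    using wmap_local_form[OF n x] by blast
  moreover have "U \<subseteq> wdom (delta g)"
    using gU(1,4) wdom_subset by auto
  ultimately have "locally_equal n (delta g) x"
    unfolding locally_equal_def by (intro exI[of _ U]) simp
  then show ?thesis
    using that gU(1) by blast
qed

text \<open>If \<open>g\<close> and \<open>h\<close> agree near \<open>x\<close>, then
  \<open>inv g \<otimes> h\<close> fixes a neighbourhood of \<open>x\<close> pointwise and lies in
  \<open>S\<close> by \<open>topologically_free\<close>. Normality converts this into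
  \<open>h \<otimes> inv g \<in> S\<close>, the form that right cosets require.\<close>

lemma locally_equal_delta_iff:
  assumes g: "g \<in> carrier G" and h: "h \<in> carrier G" and x: "x \<in> spec"
  shows "locally_equal (delta g) (delta h) x \<longleftrightarrow> S #> g = S #> h"
proof
  assume "locally_equal (delta g) (delta h) x"
  then obtain U where U: "openin spec_top U" "x \<in> U" "U \<subseteq> spec" "\<And>z. z \<in> U \<Longrightarrow> wmap (delta g) z = wmap (delta h) z"
    using g h unfolding locally_equal_def by auto
  have "inv g \<otimes> h \<in> S"
  proof (rule topologically_free[OF _ U(1,2)])
    fix z assume z: "z \<in> U"
    then have zs: "z \<in> spec"
      using U(3) by blast
    have "wmap (delta (inv g \<otimes> h)) z = wmap (delta (inv g)) (wmap (delta g) z)"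
      using g h zs U(4)[OF z] by (simp add: wmap_delta_mult)
    also have "\<dots> = wmap (delta (inv g \<otimes> g)) z"
      using g zs by (subst wmap_delta_mult) simp_all
    finally show "wmap (delta (inv g \<otimes> h)) z = z"
      using g zs by (simp add: wmap_delta_S)
  qed (use g h in simp)
  then have "g \<otimes> (inv g \<otimes> h) \<otimes> inv g \<in> S"
    by (rule inv_op_closed2[OF g])
  then have "h \<otimes> inv g \<in> S"
    using g h by (simp add: inv_cancel)
  then show "S #> g = S #> h"
    using coset_eq_iff[OF h g] by simp
next
  assume "S #> g = S #> h"
  then have "wmap (delta g) = wmap (delta h)"
    by (rule coset_wmap_cong[OF g h])
  then show "locally_equal (delta g) (delta h) x"
    unfolding locally_equal_def using g h x openin_topspace[of spec_top] by (intro exI[of _ spec]) auto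
qed

lemma germ_delta_eq_iff:
  assumes "g \<in> carrier G" "h \<in> carrier G" "x \<in> spec" "y \<in> spec"
  shows "germ (delta g) x = germ (delta h) y \<longleftrightarrow> x = y \<and> S #> g = S #> h"
  using assms by (auto simp: germ_eq_iff normalizer_delta locally_equal_delta_iff)

lemma src_germ: "normalizer n \<Longrightarrow> x \<in> wdom n \<Longrightarrow> src (weyl_groupoid RA RB) (germ n x) = x"
  unfolding weyl_groupoid_def using germ_self by (auto simp: germ_eq intro!: the_equality)

lemma rng_germ: "normalizer n \<Longrightarrow> x \<in> wdom n \<Longrightarrow> rng (weyl_groupoid RA RB) (germ n x) = wmap n x"
  unfolding weyl_groupoid_def using germ_self
  by (auto simp: germ_eq dest: locally_equalD intro!: the_equality)

lemma locally_equal_mult: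
  assumes n: "normalizer n" and m: "normalizer m" and g: "g \<in> carrier G" and h: "h \<in> carrier G"
    and nm: "locally_equal m (delta h) x" "locally_equal n (delta g) (wmap (delta h) x)"
  shows "locally_equal (n * m) (delta (g \<otimes> h)) x"
proof -
  obtain U V where U: "openin spec_top U" "x \<in> U" "U \<subseteq> wdom m \<inter> wdom (delta h)" "\<And>z. z \<in> U \<Longrightarrow> wmap m z = wmap (delta h) z"
    and V: "openin spec_top V" "wmap (delta h) x \<in> V" "V \<subseteq> wdom n \<inter> wdom (delta g)" "\<And>z. z \<in> V \<Longrightarrow> wmap n z = wmap (delta g) z"
    using nm unfolding locally_equal_def by blast
  define W where "W = {z \<in> topspace spec_top. wmap (delta h) z \<in> V} \<inter> U"
  have "openin spec_top W"
    unfolding W_def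
    by (intro openin_Int U(1) openin_continuous_map_preimage[OF continuous_map_wmap_delta[OF h] V(1)])
  moreover have "x \<in> W"
    using U(2,3) V(2) h by (auto simp: W_def)
  moreover have "z \<in> wdom (n * m) \<and> wmap (n * m) z = wmap (delta (g \<otimes> h)) z" "z \<in> spec" if z: "z \<in> W" for z
  proof -
    show zs: "z \<in> spec"
      using z by (simp add: W_def)
    have "z \<in> wdom m" "wmap m z = wmap (delta h) z" "wmap (delta h) z \<in> V"
      using z U(3,4) by (auto simp: W_def)
    moreover have "wmap (delta h) z \<in> wdom n" "wmap n (wmap (delta h) z) = wmap (delta g) (wmap (delta h) z)"
      using V(3,4) \<open>wmap (delta h) z \<in> V\<close> by auto
    ultimately show "z \<in> wdom (n * m) \<and> wmap (n * m) z = wmap (delta (g \<otimes> h)) z"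
      using wmap_mult[OF n m, of z] wmap_delta_mult[OF g h zs] by simp
  qed
  ultimately show ?thesis
    unfolding locally_equal_def using g h by (intro exI[of _ W]) auto
qed

text \<open>The product is a definite description over all normalizers representing the two germs;
  \<open>key\<close> shows that every choice yields the same germ.\<close>

lemma weyl_mult_germ:
  assumes g: "g \<in> carrier G" and h: "h \<in> carrier G" and x: "x \<in> spec"
  shows "weyl_mult RA RB (germ (delta g) (wmap (delta h) x)) (germ (delta h) x) = germ (delta (g \<otimes> h)) x"
proof -
  have y: "wmap (delta h) x \<in> spec"
    using h x by simp
  have RA_mult: "monoid.mult RA (cop n) (cop m) = cop (n * m)" if "normalizer m" for n m
    using normalizerD(1)[OF that] by (simp add: RA_simps)
  have key: "germ (n * m) x = germ (delta (g \<otimes> h)) x"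
    if n: "normalizer n" "wmap (delta h) x \<in> wdom n" "germ (delta g) (wmap (delta h) x) = germ n (wmap (delta h) x)"
      and m: "normalizer m" "x \<in> wdom m" "germ (delta h) x = germ m x" for n m
  proof -
    have "locally_equal (delta h) m x"
      using m(3) germ_eq_iff[OF normalizer_delta[OF h] _ m(1,2), of x] h x by simp
    moreover have "locally_equal (delta g) n (wmap (delta h) x)"
      using n(3) germ_eq_iff[OF normalizer_delta[OF g] _ n(1,2), of "wmap (delta h) x"] g y by simp
    ultimately have "locally_equal m (delta h) x" "locally_equal n (delta g) (wmap (delta h) x)"
      by (simp_all add: locally_equal_sym)
    then have le: "locally_equal (n * m) (delta (g \<otimes> h)) x"
      by (rule locally_equal_mult[OF n(1) m(1) g h])
    then have "x \<in> wdom (n * m)"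
      using locally_equalD by blast
    then show ?thesis
      using le g h x n(1) m(1) by (simp add: germ_eq_iff normalizer_mult normalizer_delta)
  qed
  show ?thesis
    unfolding weyl_mult_def
  proof (rule the_equality)
    show "\<exists>n\<in>normalizers RA RB. \<exists>m\<in>normalizers RA RB. \<exists>x'\<in>weyl_dom RA RB m.
      weyl_map RA RB m x' \<in> weyl_dom RA RB n \<and>
      germ (delta g) (wmap (delta h) x) = weyl_germ RA RB n (weyl_map RA RB m x') \<and>
      germ (delta h) x = weyl_germ RA RB m x' \<and>
      germ (delta (g \<otimes> h)) x = weyl_germ RA RB (monoid.mult RA n m) x'"
      using key[of "delta g" "delta h"] g h x y normalizer_delta[OF g] normalizer_delta[OF h]
      by (intro bexI[of _ "cop (delta g)"] bexI[of _ "cop (delta h)"] bexI[of _ x])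
        (simp_all add: weyl_map_eq weyl_dom_eq RA_mult normalizers_eq)
    fix k assume "\<exists>n\<in>normalizers RA RB. \<exists>m\<in>normalizers RA RB. \<exists>x'\<in>weyl_dom RA RB m.
      weyl_map RA RB m x' \<in> weyl_dom RA RB n \<and>
      germ (delta g) (wmap (delta h) x) = weyl_germ RA RB n (weyl_map RA RB m x') \<and>
      germ (delta h) x = weyl_germ RA RB m x' \<and> k = weyl_germ RA RB (monoid.mult RA n m) x'"
    then obtain n m x' where nm: "normalizer n" "normalizer m" "x' \<in> wdom m" "wmap m x' \<in> wdom n"
        "germ (delta g) (wmap (delta h) x) = germ n (wmap m x')" "germ (delta h) x = germ m x'" "k = germ (n * m) x'"
      unfolding normalizers_eq by (auto simp: weyl_map_eq weyl_dom_eq RA_mult)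
    have "x = x'" "locally_equal (delta h) m x"
      using nm(2,3,6) h x by (auto simp: germ_eq_iff normalizer_delta)
    moreover have "wmap (delta h) x = wmap m x'"
      using nm(1,4,5) g y by (simp add: germ_eq_iff normalizer_delta)
    ultimately show "k = germ (delta (g \<otimes> h)) x"
      using key[of n m] nm by simp
  qed
qed

section \<open>The topology on germs\<close>

definition germ_set :: "'a oper \<Rightarrow> ('a l2_op \<Rightarrow> complex) set \<Rightarrow> ('a l2_op \<Rightarrow> complex) set \<Rightarrow> 'a l2_op weyl_triple set set" where
  "germ_set n U V = {germ n x | x. x \<in> wdom n \<and> wmap n x \<in> V \<and> x \<in> U}"

lemma weyl_topology_eq:
  "weyl_topology RA RB = topology_generated_by
    {germ_set n U V | n U V. normalizer n \<and> openin spec_top U \<and> openin spec_top V}"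
proof -
  have "{{weyl_germ RA RB n x | x. x \<in> weyl_dom RA RB n \<and> weyl_map RA RB n x \<in> V \<and> x \<in> U} | n U V.
      n \<in> normalizers RA RB \<and> openin spec_top U \<and> openin spec_top V} =
    {{weyl_germ RA RB (cop n) x | x. x \<in> weyl_dom RA RB (cop n) \<and> weyl_map RA RB (cop n) x \<in> V \<and> x \<in> U} | n U V.
      normalizer n \<and> openin spec_top U \<and> openin spec_top V}"
    unfolding normalizers_eq by blast
  also have "\<dots> = {germ_set n U V | n U V. normalizer n \<and> openin spec_top U \<and> openin spec_top V}"
    (is "{?A n U V | n U V. ?P n U V} = _")
  proof -
    have eq: "?A n U V = germ_set n U V" if "?P n U V" for n U V
      using that by (simp add: germ_set_def weyl_map_eq weyl_dom_eq)
    show ?thesis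
    proof (intro equalityI subsetI; clarify)
      fix n U V assume "normalizer n" "openin spec_top U" "openin spec_top V"
      then show "\<exists>n' U' V'. ?A n U V = germ_set n' U' V' \<and> ?P n' U' V'"
        using eq[of n U V] by (intro exI[of _ n] exI[of _ U] exI[of _ V]) simp
    next
      fix n U V assume "normalizer n" "openin spec_top U" "openin spec_top V"
      then show "\<exists>n' U' V'. germ_set n U V = ?A n' U' V' \<and> ?P n' U' V'"
        using eq[of n U V] by (intro exI[of _ n] exI[of _ U] exI[of _ V]) simp
    qed
  qed
  finally show ?thesis
    unfolding weyl_topology_def by simp
qed

lemma openin_germ_set:
  "normalizer n \<Longrightarrow> openin spec_top U \<Longrightarrow> openin spec_top V \<Longrightarrow> openin (weyl_topology RA RB) (germ_set n U V)"
  unfolding weyl_topology_eq by (rule topology_generated_by_Basis) blast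

lemma germ_delta_cases:
  assumes n: "normalizer n" and x: "x \<in> wdom n"
  obtains g where "g \<in> carrier G" "germ n x = germ (delta g) x"
proof -
  obtain g where g: "g \<in> carrier G" "locally_equal n (delta g) x"
    using germ_delta_form[OF n x] .
  moreover have "x \<in> spec"
    using x wdom_subset by blast
  ultimately have "germ n x = germ (delta g) x"
    using n x by (simp add: germ_eq_iff normalizer_delta)
  then show ?thesis
    using that g(1) by blast
qed

lemma topspace_weyl: "topspace (weyl_topology RA RB) = {germ (delta g) x | g x. g \<in> carrier G \<and> x \<in> spec}"
proof
  show "topspace (weyl_topology RA RB) \<subseteq> {germ (delta g) x | g x. g \<in> carrier G \<and> x \<in> spec}"
  proof
    fix p assume "p \<in> topspace (weyl_topology RA RB)"
    then obtain n x where "normalizer n" "x \<in> wdom n" "p = germ n x"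
      unfolding weyl_topology_eq topology_generated_by_topspace germ_set_def by blast
    moreover from this(1,2) obtain g where "g \<in> carrier G" "germ n x = germ (delta g) x"
      using germ_delta_cases by blast
    moreover have "x \<in> spec"
      using \<open>x \<in> wdom n\<close> wdom_subset by blast
    ultimately show "p \<in> {germ (delta g) x | g x. g \<in> carrier G \<and> x \<in> spec}"
      by blast
  qed
  show "{germ (delta g) x | g x. g \<in> carrier G \<and> x \<in> spec} \<subseteq> topspace (weyl_topology RA RB)"
  proof clarify
    fix g x assume g: "g \<in> carrier G" and x: "x \<in> spec"
    have "openin (weyl_topology RA RB) (germ_set (delta g) (topspace spec_top) (topspace spec_top))"
      by (intro openin_germ_set normalizer_delta g openin_topspace)
    moreover have "germ (delta g) x \<in> germ_set (delta g) (topspace spec_top) (topspace spec_top)"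
      using g x unfolding germ_set_def by auto
    ultimately show "germ (delta g) x \<in> topspace (weyl_topology RA RB)"
      using openin_subset by blast
  qed
qed

section \<open>The isomorphism with the transformation groupoid\<close>

definition groupoid_map :: "'a l2_op weyl_triple set \<Rightarrow> 'a set \<times> ('a \<Rightarrow> complex)" where
  "groupoid_map a = (THE p. \<exists>g\<in>carrier G. \<exists>x\<in>spec. a = germ (delta g) x \<and> p = (S #> g, restrict_dual x))"

text \<open>By \<open>germ_delta_eq_iff\<close> the coset and the source are functions of the germ;
  this is where topological freeness enters the isomorphism.\<close>

lemma groupoid_map_germ:
  assumes g: "g \<in> carrier G" and x: "x \<in> spec"
  shows "groupoid_map (germ (delta g) x) = (S #> g, restrict_dual x)"
  unfolding groupoid_map_def
proof (rule the_equality)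
  fix p assume "\<exists>g'\<in>carrier G. \<exists>x'\<in>spec. germ (delta g) x = germ (delta g') x' \<and> p = (S #> g', restrict_dual x')"
  then show "p = (S #> g, restrict_dual x)"
    using germ_delta_eq_iff[OF g _ x] by auto
qed (use assms in blast)

text \<open>The choice of a representative is harmless: elements of one coset have equal
  germs.\<close>

definition inverse_groupoid_map :: "'a set \<times> ('a \<Rightarrow> complex) \<Rightarrow> 'a l2_op weyl_triple set" where
  "inverse_groupoid_map p = germ (delta (SOME g. g \<in> carrier G \<and> S #> g = fst p)) (Psi G c S (snd p))"

lemma inverse_groupoid_map_eq:
  assumes g: "g \<in> carrier G" and \<nu>: "\<nu> \<in> dual_group G S"
  shows "inverse_groupoid_map (S #> g, \<nu>) = germ (delta g) (Psi G c S \<nu>)"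
proof -
  define h where "h = (SOME h. h \<in> carrier G \<and> S #> h = S #> g)"
  have "h \<in> carrier G \<and> S #> h = S #> g"
    unfolding h_def by (rule someI[of "\<lambda>h. h \<in> carrier G \<and> S #> h = S #> g" g]) (simp add: g)
  then show ?thesis
    using germ_delta_eq_iff[of h g] g Psi_props(1)[OF \<nu>]
    by (simp add: inverse_groupoid_map_def flip: h_def)
qed

abbreviation "HT \<equiv> prod_topology (discrete_topology (carrier (G Mod S))) (dual_topology G S)"

text \<open>For each \<open>g\<close> the slice \<open>U g\<close> of \<open>W\<close> over the
  coset of \<open>g\<close> is open in the spectrum, and the preimage of \<open>W\<close> is the
  union of the basic sets of germs of \<open>delta g\<close> over these slices.\<close>

lemma continuous_map_groupoid_map: "continuous_map (weyl_topology RA RB) HT groupoid_map"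
  unfolding continuous_map_def
proof (intro conjI allI impI)
  show "groupoid_map \<in> topspace (weyl_topology RA RB) \<rightarrow> topspace HT"
    by (auto simp: topspace_weyl groupoid_map_germ restrict_dual_mem carrier_quotient)
  fix W assume W: "openin HT W"
  define U where "U g = {x \<in> topspace spec_top. (S #> g, restrict_dual x) \<in> W}" for g
  have U: "openin spec_top (U g)" if g: "g \<in> carrier G" for g
    unfolding U_def
  proof (rule openin_continuous_map_preimage[OF _ W])
    show "continuous_map spec_top HT (\<lambda>x. (S #> g, restrict_dual x))"
      using homeomorphic_maps_Psi g
      by (intro continuous_map_pairedI) (auto simp: homeomorphic_maps_def carrier_quotient eta_contract_eq)
  qed
  have germs: "germ_set (delta g) (U g) (topspace spec_top) = germ (delta g) ` U g" if "g \<in> carrier G" for g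
    using that by (auto simp: germ_set_def U_def)
  have "{a \<in> topspace (weyl_topology RA RB). groupoid_map a \<in> W} = (\<Union>g\<in>carrier G. germ (delta g) ` U g)"
  proof
    show "{a \<in> topspace (weyl_topology RA RB). groupoid_map a \<in> W} \<subseteq> (\<Union>g\<in>carrier G. germ (delta g) ` U g)"
    proof
      fix a assume "a \<in> {a \<in> topspace (weyl_topology RA RB). groupoid_map a \<in> W}"
      then obtain g x where g: "g \<in> carrier G" and x: "x \<in> spec" and a: "a = germ (delta g) x" "groupoid_map a \<in> W"
        unfolding topspace_weyl by blast
      then have "x \<in> U g"
        by (simp add: U_def groupoid_map_germ)
      then show "a \<in> (\<Union>g\<in>carrier G. germ (delta g) ` U g)"
        using g a(1) by blast
    qed
    show "(\<Union>g\<in>carrier G. germ (delta g) ` U g) \<subseteq> {a \<in> topspace (weyl_topology RA RB). groupoid_map a \<in> W}"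
    proof clarify
      fix g x assume g: "g \<in> carrier G" and x: "x \<in> U g"
      then show "germ (delta g) x \<in> topspace (weyl_topology RA RB) \<and> groupoid_map (germ (delta g) x) \<in> W"
        unfolding topspace_weyl U_def topspace_spec using groupoid_map_germ by (simp) blast
    qed
  qed
  also have "\<dots> = (\<Union>g\<in>carrier G. germ_set (delta g) (U g) (topspace spec_top))"
    by (intro SUP_cong refl germs[symmetric])
  also have "openin (weyl_topology RA RB) \<dots>"
    by (intro openin_Union ballI) (use U in \<open>auto intro!: openin_germ_set normalizer_delta simp del: topspace_spec\<close>)
  finally show "openin (weyl_topology RA RB) {a \<in> topspace (weyl_topology RA RB). groupoid_map a \<in> W}" .
qed

text \<open>A basic set is built from an arbitrary normalizer \<open>n\<close>. Near a point where
  the germ of \<open>n\<close> is that of \<open>delta g\<close> the two maps agree on an open set,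
  so over the coset of \<open>g\<close> the germs of \<open>delta g\<close> stay in the basic set
  for nearby characters.\<close>

lemma continuous_map_inverse_groupoid_map: "continuous_map HT (weyl_topology RA RB) inverse_groupoid_map"
  unfolding weyl_topology_eq
proof (rule continuous_on_generated_topo)
  have HT: "topspace HT = carrier (G Mod S) \<times> dual_group G S"
    by simp
  show "inverse_groupoid_map ` topspace HT \<subseteq>
      \<Union>{germ_set n U V | n U V. normalizer n \<and> openin spec_top U \<and> openin spec_top V}"
  proof (rule image_subsetI)
    fix p assume "p \<in> topspace HT"
    then obtain g \<nu> where "g \<in> carrier G" "\<nu> \<in> dual_group G S" "p = (S #> g, \<nu>)"
      by (auto simp: carrier_quotient)
    then have "inverse_groupoid_map p \<in> topspace (weyl_topology RA RB)"
      unfolding topspace_weyl using Psi_props(1) by (auto simp: inverse_groupoid_map_eq)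
    then show "inverse_groupoid_map p \<in> \<Union>{germ_set n U V | n U V. normalizer n \<and> openin spec_top U \<and> openin spec_top V}"
      unfolding weyl_topology_eq topology_generated_by_topspace .
  qed
  fix A assume "A \<in> {germ_set n U V | n U V. normalizer n \<and> openin spec_top U \<and> openin spec_top V}"
  then obtain n U V where n: "normalizer n" and U: "openin spec_top U" and V: "openin spec_top V" and A: "A = germ_set n U V"
    by blast
  show "openin HT (inverse_groupoid_map -` A \<inter> topspace HT)"
  proof (subst openin_subopen, intro ballI)
    fix p assume p: "p \<in> inverse_groupoid_map -` A \<inter> topspace HT"
    then obtain g \<nu>0 where g: "g \<in> carrier G" and \<nu>0: "\<nu>0 \<in> dual_group G S" and pg: "p = (S #> g, \<nu>0)"
      by (auto simp: carrier_quotient)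
    define x where "x = Psi G c S \<nu>0"
    have xs: "x \<in> spec"
      using Psi_props(1)[OF \<nu>0] by (simp add: x_def)
    have "germ (delta g) x \<in> germ_set n U V"
      using p by (simp add: pg A inverse_groupoid_map_eq g \<nu>0 x_def)
    then obtain x' where x': "germ (delta g) x = germ n x'" "x' \<in> wdom n" "wmap n x' \<in> V" "x' \<in> U"
      unfolding germ_set_def by blast
    then have xn: "x \<in> wdom n" "wmap n x \<in> V" "x \<in> U" and "locally_equal n (delta g) x"
      using g n xs by (auto simp: germ_eq_iff normalizer_delta intro: locally_equal_sym)
    then obtain U1 where U1: "openin spec_top U1" "x \<in> U1" "U1 \<subseteq> wdom n \<inter> wdom (delta g)"
        "\<And>z. z \<in> U1 \<Longrightarrow> wmap n z = wmap (delta g) z"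
      unfolding locally_equal_def by blast
    define U2 where "U2 = {z \<in> topspace spec_top. wmap (delta g) z \<in> V} \<inter> (U1 \<inter> U)"
    have U2: "openin spec_top U2"
      unfolding U2_def
      by (intro openin_Int U1(1) U openin_continuous_map_preimage[OF continuous_map_wmap_delta[OF g] V])
    define W where "W = {\<nu> \<in> topspace (dual_topology G S). Psi G c S \<nu> \<in> U2}"
    have W: "openin (dual_topology G S) W"
      unfolding W_def using homeomorphic_maps_Psi U2
      by (intro openin_continuous_map_preimage[of _ spec_top]) (auto simp: homeomorphic_maps_def)
    have "openin HT ({S #> g} \<times> W)"
      using g W by (auto simp: openin_prod_Times_iff carrier_quotient)
    moreover have "p \<in> {S #> g} \<times> W"
      using xn U1 xs \<nu>0 by (auto simp: pg W_def U2_def simp flip: x_def)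
    moreover have "{S #> g} \<times> W \<subseteq> inverse_groupoid_map -` A \<inter> topspace HT"
    proof clarify
      fix \<nu> assume \<nu>W: "\<nu> \<in> W"
      then have \<nu>: "\<nu> \<in> dual_group G S" "Psi G c S \<nu> \<in> U2"
        by (auto simp: W_def)
      define z where "z = Psi G c S \<nu>"
      have z: "z \<in> U1" "z \<in> U" "wmap (delta g) z \<in> V" "z \<in> spec"
        using \<nu>(2) by (auto simp: U2_def z_def)
      then have "z \<in> wdom n" "wmap n z \<in> V"
        using U1(3,4) by auto
      moreover have "locally_equal (delta g) n z"
        using U1 z(1) unfolding locally_equal_def by (intro exI[of _ U1]) auto
      then have "germ (delta g) z = germ n z"
        using g n z(4) \<open>z \<in> wdom n\<close> by (simp add: germ_eq_iff normalizer_delta)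
      ultimately have "germ (delta g) z \<in> A"
        unfolding A germ_set_def using z(2) by blast
      then show "(S #> g, \<nu>) \<in> inverse_groupoid_map -` A \<inter> topspace HT"
        using g \<nu>(1) by (auto simp: inverse_groupoid_map_eq z_def carrier_quotient)
    qed
    ultimately show "\<exists>T. openin HT T \<and> p \<in> T \<and> T \<subseteq> inverse_groupoid_map -` A \<inter> topspace HT"
      by blast
  qed
qed

lemma homeomorphic_map_groupoid_map: "homeomorphic_map (weyl_topology RA RB) HT groupoid_map"
proof (rule homeomorphic_maps_imp_map)
  show "homeomorphic_maps (weyl_topology RA RB) HT groupoid_map inverse_groupoid_map"
    unfolding homeomorphic_maps_def
  proof (intro conjI ballI continuous_map_groupoid_map continuous_map_inverse_groupoid_map)
    fix a assume "a \<in> topspace (weyl_topology RA RB)"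
    then show "inverse_groupoid_map (groupoid_map a) = a"
      by (auto simp: topspace_weyl groupoid_map_germ inverse_groupoid_map_eq restrict_dual_mem Psi_restrict)
  next
    fix p assume "p \<in> topspace HT"
    then show "groupoid_map (inverse_groupoid_map p) = p"
      by (auto simp: carrier_quotient inverse_groupoid_map_eq groupoid_map_germ Psi_props(1) restrict_Psi)
  qed
qed

lemma restrict_dual_eq_iff: "x \<in> spec \<Longrightarrow> y \<in> spec \<Longrightarrow> restrict_dual x = restrict_dual y \<longleftrightarrow> x = y"
  using Psi_restrict by metis

lemma top_groupoid_iso_groupoid_map:
  "top_groupoid_iso (weyl_groupoid RA RB)
    (transformation_groupoid (G Mod S) (dual_topology G S) (induced_action G c S)) groupoid_map"
  unfolding top_groupoid_iso_def
proof (intro conjI ballI)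
  have arrows: "arrows (weyl_groupoid RA RB) = weyl_topology RA RB"
    "gmult (weyl_groupoid RA RB) = weyl_mult RA RB"
    by (simp_all add: weyl_groupoid_def)
  show "homeomorphic_map (arrows (weyl_groupoid RA RB))
      (arrows (transformation_groupoid (G Mod S) (dual_topology G S) (induced_action G c S))) groupoid_map"
    using homeomorphic_map_groupoid_map by (simp add: arrows transformation_groupoid_def)
  fix a b assume "a \<in> topspace (arrows (weyl_groupoid RA RB))" "b \<in> topspace (arrows (weyl_groupoid RA RB))"
  then obtain g x h y where a: "g \<in> carrier G" "x \<in> spec" "a = germ (delta g) x"
    and b: "h \<in> carrier G" "y \<in> spec" "b = germ (delta h) y"
    unfolding arrows topspace_weyl by blast
  have src: "src (weyl_groupoid RA RB) a = x" and rng: "rng (weyl_groupoid RA RB) b = wmap (delta h) y"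
    using a b by (simp_all add: src_germ rng_germ normalizer_delta)
  have \<phi>: "groupoid_map a = (S #> g, restrict_dual x)" "groupoid_map b = (S #> h, restrict_dual y)"
    using a b by (simp_all add: groupoid_map_germ)
  show "src (weyl_groupoid RA RB) a = rng (weyl_groupoid RA RB) b \<longleftrightarrow>
    src (transformation_groupoid (G Mod S) (dual_topology G S) (induced_action G c S)) (groupoid_map a) =
    rng (transformation_groupoid (G Mod S) (dual_topology G S) (induced_action G c S)) (groupoid_map b)"
    unfolding src rng \<phi> using a(1,2) b(1,2)
    by (simp add: transformation_groupoid_def induced_action_apply restrict_dual_mem Psi_restrict restrict_dual_eq_iff)
  show "src (weyl_groupoid RA RB) a = rng (weyl_groupoid RA RB) b \<longrightarrow>
    groupoid_map (gmult (weyl_groupoid RA RB) a b) =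
    gmult (transformation_groupoid (G Mod S) (dual_topology G S) (induced_action G c S)) (groupoid_map a) (groupoid_map b)"
    unfolding src rng
  proof
    assume "x = wmap (delta h) y"
    then have "gmult (weyl_groupoid RA RB) a b = germ (delta (g \<otimes> h)) y"
      using weyl_mult_germ[OF a(1) b(1,2)] by (simp add: arrows a(3) b(3))
    then show "groupoid_map (gmult (weyl_groupoid RA RB) a b) =
      gmult (transformation_groupoid (G Mod S) (dual_topology G S) (induced_action G c S)) (groupoid_map a) (groupoid_map b)"
      using a b by (simp add: \<phi> groupoid_map_germ transformation_groupoid_def rcos_sum)
  qed
qed

end

text \<open>\<open>induced_action\<close> is a definite description over a coset; the clause with
  \<open>alpha_map\<close> shows that every representative \<open>g\<close> computes it. The
  isomorphism is specified on the germs of the \<open>delta_op G c g\<close>, which by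
  \<open>topspace_weyl\<close> exhaust the arrows.\<close>

theorem proposition5p10:
  fixes G :: "('g, 'm) monoid_scheme" (structure)
    and c :: "'g \<Rightarrow> 'g \<Rightarrow> complex"
    and S :: "'g set"
  assumes "group G"
    and "countable (carrier G)"
    and "two_cocycle G c"
    and "maximal_abelian_symmetric G c S"
    and "S \<lhd> G"
    and "immediately_centralizing G S"
    and "\<forall>s\<in>S. \<forall>t\<in>S. c s t = 1"
  shows "cartan_pair (reduced_algebra G c) (reduced_set G c S) \<and>
    homeomorphic_map (dual_topology G S)
      (spectrum_topology (reduced_algebra G c) (reduced_set G c S)) (Psi G c S) \<and>
    (\<forall>\<nu>\<in>dual_group G S. \<forall>b\<in>finsupp S.
      Psi G c S \<nu> (left_regular G c b) = (\<Sum>s | b s \<noteq> 0. b s * \<nu> s)) \<and>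
    group_action (G Mod S) (dual_group G S) (induced_action G c S) \<and>
    (\<forall>q\<in>carrier (G Mod S).
      homeomorphic_map (dual_topology G S) (dual_topology G S) (induced_action G c S q)) \<and>
    (\<forall>g\<in>carrier G. \<forall>\<nu>\<in>dual_group G S.
      induced_action G c S (S #> g) \<nu> = Psi_inv G c S (alpha_map G c S g (Psi G c S \<nu>))) \<and>
    (\<forall>g\<in>carrier G. \<forall>\<nu>\<in>dual_group G S. \<forall>s\<in>S.
      induced_action G c S (S #> g) \<nu> s =
        cnj (c g (inv g)) * c (inv g) s * c (inv g \<otimes> s) g * \<nu> (inv g \<otimes> s \<otimes> g)) \<and>
    (\<exists>\<phi>. top_groupoid_iso
        (weyl_groupoid (reduced_algebra G c) (reduced_set G c S))
        (transformation_groupoid (G Mod S) (dual_topology G S) (induced_action G c S)) \<phi> \<and>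
      (\<forall>g\<in>carrier G. \<forall>x\<in>spectrum (reduced_algebra G c) (reduced_set G c S).
        \<phi> (weyl_germ (reduced_algebra G c) (reduced_set G c S) (delta_op G c g) x) =
          (S #> g, Psi_inv G c S x)))"
proof -
  interpret G: group G
    by fact
  interpret N: normal S G
    by fact
  interpret twisted_cartan G c S
    by unfold_locales
      (use assms in \<open>auto simp: maximal_abelian_symmetric_def abelian_symmetric_def\<close>)
  show ?thesis
  proof (intro conjI ballI exI[of _ groupoid_map])
    show "cartan_pair (reduced_algebra G c) (reduced_set G c S)"
      by (rule cartan_pair_RB)
    show "homeomorphic_map (dual_topology G S)
        (spectrum_topology (reduced_algebra G c) (reduced_set G c S)) (Psi G c S)"
      using homeomorphic_maps_Psi by (rule homeomorphic_maps_imp_map)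
    show "induced_action G c S (S #> g) \<nu> s =
        cnj (c g (inv g)) * c (inv g) s * c (inv g \<otimes> s) g * \<nu> (inv g \<otimes> s \<otimes> g)"
      if "g \<in> carrier G" "\<nu> \<in> dual_group G S" "s \<in> S" for g \<nu> s
      using that by (rule induced_action_formula)
    show "group_action (G Mod S) (dual_group G S) (induced_action G c S)"
      by (rule group_action_induced)
    show "top_groupoid_iso (weyl_groupoid (reduced_algebra G c) (reduced_set G c S))
        (transformation_groupoid (G Mod S) (dual_topology G S) (induced_action G c S)) groupoid_map"
      by (rule top_groupoid_iso_groupoid_map)
  qed (simp_all add: Psi_props homeomorphic_map_induced induced_action_apply alpha_map_eq Psi_inv_eq
      delta_op_eq groupoid_map_germ)
qed

end
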